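(* Let $A$ be an algebra and let $\mathcal{Z}$ be an irreducible component of $A$. If $\mathcal{Z}$ has a dense orbit, then for all $X$ and $Y$ in $\mathcal{Z}$ we have $\mathrm{Hom}_A(X,Y)\neq 0$. Furthermore, the following are equivalent: (1) some irreducible component of $A$ contains a pair of orthogonal orbits; (2) $A$ admits infinitely many (pairwise non-isomorphic) bricks of the same dimension. In fact, if $A$ is brick-finite, then for each irreducible component $\mathcal{Z}$ of $A$ and every pair $X$ and $Y$ in $\mathcal{Z}$, we have $\mathrm{Hom}_A(X,Y)\neq 0$.
   Context: Throughout, $k$ is an algebraically closed field and $A$ is a finite dimensional, unital, associative, basic and connected $k$-algebra of rank $n$ (i.e. with $n$ isomorphism classes of simple modules). $\mathrm{mod}\,A$ is the category of finitely generated left $A$-modules. For a dimension vector $\underline{d}\in\mathbb{Z}_{\ge 0}^n$, $\mathrm{rep}(A,\underline{d})$ is the affine variety parametrizing the modules of dimension vector $\underline{d}$ (writing $A\simeq kQ/I$ as a bound quiver algebra, its points are representations of $(Q,I)$ of dimension vector $\underline d$), with the group $\mathrm{GL}(\underline{d})$ acting by conjugation; the orbits correspond to isomorphism classes of modules, and $O_X$ denotes the orbit of $X$. An irreducible component of $A$ is an irreducible component of some variety $\mathrm{rep}(A,\underline{d})$ with $\underline{d}\neq 0$. Two orbits $O_X$, $O_Y$ in such a component $\mathcal{Z}$ are orthogonal if the (non-zero) modules $X,Y$ satisfy $\mathrm{Hom}_A(X,Y)=0=\mathrm{Hom}_A(Y,X)$. A brick is a module $X$ with $\mathrm{End}_A(X)\simeq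 k$; $A$ is brick-finite if it has only finitely many bricks up to isomorphism. *)

theory Defs
  imports
    "HOL-Analysis.Abstract_Topology"
    "HOL-Computational_Algebra.Polynomial"
    "HOL-Library.Function_Algebras"
begin

section \<open>Finite dimensional algebras\<close>

text \<open>An algebra over \<open>'k\<close> is a ring type \<open>'a\<close> with a scalar multiplication \<open>scl\<close>. The class
  \<open>ring_1\<close> makes it associative, unital and non-zero.\<close>

locale k_algebra = vector_space scl for scl :: "'k::field \<Rightarrow> 'a::ring_1 \<Rightarrow> 'a" +
  assumes scl_mult_left: "scl c x * y = scl c (x * y)"
    and scl_mult_right: "x * scl c y = scl c (x * y)"

definition finite_dimensional_algebra :: "('k::field \<Rightarrow> 'a::ring_1 \<Rightarrow> 'a) \<Rightarrow> bool" where
  "finite_dimensional_algebra scl \<longleftrightarrow>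
     k_algebra scl \<and> (\<exists>B. finite B \<and> module.span scl B = UNIV)"

definition primitive_idempotent :: "'a::ring_1 \<Rightarrow> bool" where
  "primitive_idempotent e \<longleftrightarrow> e \<noteq> 0 \<and> e * e = e \<and>
     (\<forall>f g. f * f = f \<and> g * g = g \<and> f * g = 0 \<and> g * f = 0 \<and> e = f + g \<longrightarrow> f = 0 \<or> g = 0)"

definition complete_primitive_orthogonal :: "'a::ring_1 set \<Rightarrow> bool" where
  "complete_primitive_orthogonal E \<longleftrightarrow> finite E \<and> (\<forall>e\<in>E. primitive_idempotent e) \<and>
     (\<forall>e\<in>E. \<forall>f\<in>E. e \<noteq> f \<longrightarrow> e * f = 0) \<and> \<Sum>E = 1"

definition principal_left_ideal :: "'a::ring_1 \<Rightarrow> 'a set" where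
  "principal_left_ideal e = {x * e | x. True}"

definition left_ideals_isomorphic :: "'a::ring_1 set \<Rightarrow> 'a set \<Rightarrow> bool" where
  "left_ideals_isomorphic L L' \<longleftrightarrow>
     (\<exists>\<theta>. bij_betw \<theta> L L' \<and> (\<forall>x\<in>L. \<forall>y\<in>L. \<theta> (x + y) = \<theta> x + \<theta> y) \<and> (\<forall>a. \<forall>x\<in>L. \<theta> (a * x) = a * \<theta> x))"

definition basic_algebra :: "'a::ring_1 itself \<Rightarrow> bool" where
  "basic_algebra _ \<longleftrightarrow> (\<exists>E :: 'a set. complete_primitive_orthogonal E \<and>
     (\<forall>e\<in>E. \<forall>f\<in>E. e \<noteq> f \<longrightarrow>
        \<not> left_ideals_isomorphic (principal_left_ideal e) (principal_left_ideal f)))"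

definition connected_algebra :: "'a::ring_1 itself \<Rightarrow> bool" where
  "connected_algebra _ \<longleftrightarrow> (\<forall>e :: 'a. e * e = e \<and> (\<forall>x. e * x = x * e) \<longrightarrow> e = 0 \<or> e = 1)"


section \<open>Finitely generated left modules\<close>

text \<open>The underlying space of a module is a linear subspace of the space of all families
  \<open>nat \<times> nat \<Rightarrow> 'k\<close>. Every finitely generated module over a finite dimensional algebra is
  isomorphic to a module of this kind.\<close>

type_synonym 'k fam = "nat \<times> nat \<Rightarrow> 'k"

definition fscale :: "'k::field \<Rightarrow> ('j \<Rightarrow> 'k) \<Rightarrow> 'j \<Rightarrow> 'k" where
  "fscale c v = (\<lambda>j. c * v j)"

interpretation fam: vector_space "fscale :: 'k::field \<Rightarrow> ('j \<Rightarrow> 'k) \<Rightarrow> 'j \<Rightarrow> 'k"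
  by unfold_locales (auto simp: fscale_def fun_eq_iff algebra_simps)

record ('a, 'k) lmodule =
  mod_space :: "'k fam set"
  mod_act :: "'a \<Rightarrow> 'k fam \<Rightarrow> 'k fam"

text \<open>The clause for \<open>scl c 1\<close> says that the \<open>'k\<close>-space structure inherited from the algebra is
  the ambient one.\<close>

definition left_module :: "('k::field \<Rightarrow> 'a::ring_1 \<Rightarrow> 'a) \<Rightarrow> ('a, 'k) lmodule \<Rightarrow> bool" where
  "left_module scl M \<longleftrightarrow> fam.subspace (mod_space M) \<and>
     (\<forall>a. \<forall>v\<in>mod_space M. mod_act M a v \<in> mod_space M) \<and>
     (\<forall>a. \<forall>v\<in>mod_space M. \<forall>w\<in>mod_space M. mod_act M a (v + w) = mod_act M a v + mod_act M a w) \<and>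
     (\<forall>a b. \<forall>v\<in>mod_space M. mod_act M (a + b) v = mod_act M a v + mod_act M b v) \<and>
     (\<forall>a b. \<forall>v\<in>mod_space M. mod_act M (a * b) v = mod_act M a (mod_act M b v)) \<and>
     (\<forall>v\<in>mod_space M. mod_act M 1 v = v) \<and>
     (\<forall>c. \<forall>v\<in>mod_space M. mod_act M (scl c 1) v = fscale c v)"

definition fg_module :: "('k::field \<Rightarrow> 'a::ring_1 \<Rightarrow> 'a) \<Rightarrow> ('a, 'k) lmodule \<Rightarrow> bool" where
  "fg_module scl M \<longleftrightarrow> left_module scl M \<and>
     (\<exists>S. finite S \<and> S \<subseteq> mod_space M \<and> (\<forall>v\<in>mod_space M. \<exists>c. v = (\<Sum>s\<in>S. mod_act M (c s) s)))"

text \<open>Homomorphisms are extended by zero outside the source, so that equality of functions is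
  equality of homomorphisms. They are automatically \<open>'k\<close>-linear, through the elements \<open>scl c 1\<close>.\<close>

definition Hom :: "('a::ring_1, 'k::field) lmodule \<Rightarrow> ('a, 'k) lmodule \<Rightarrow> ('k fam \<Rightarrow> 'k fam) set" where
  "Hom M N = {f. (\<forall>v\<in>mod_space M. f v \<in> mod_space N) \<and> (\<forall>v. v \<notin> mod_space M \<longrightarrow> f v = 0) \<and>
     (\<forall>v\<in>mod_space M. \<forall>w\<in>mod_space M. f (v + w) = f v + f w) \<and>
     (\<forall>a. \<forall>v\<in>mod_space M. f (mod_act M a v) = mod_act N a (f v))}"

definition module_iso :: "('a::ring_1, 'k::field) lmodule \<Rightarrow> ('a, 'k) lmodule \<Rightarrow> bool" where
  "module_iso M N \<longleftrightarrow> (\<exists>f\<in>Hom M N. bij_betw f (mod_space M) (mod_space N))"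

definition iso_classes ::
    "('k::field \<Rightarrow> 'a::ring_1 \<Rightarrow> 'a) \<Rightarrow> (('a, 'k) lmodule \<Rightarrow> bool) \<Rightarrow> ('a, 'k) lmodule set set" where
  "iso_classes scl P = {{N. fg_module scl N \<and> module_iso M N} | M. fg_module scl M \<and> P M}"

definition simple_module :: "('k::field \<Rightarrow> 'a::ring_1 \<Rightarrow> 'a) \<Rightarrow> ('a, 'k) lmodule \<Rightarrow> bool" where
  "simple_module scl M \<longleftrightarrow> fg_module scl M \<and> mod_space M \<noteq> {0} \<and>
     (\<forall>U. U \<subseteq> mod_space M \<and> left_module scl (M\<lparr>mod_space := U\<rparr>) \<longrightarrow> U = {0} \<or> U = mod_space M)"

definition algebra_rank :: "('k::field \<Rightarrow> 'a::ring_1 \<Rightarrow> 'a) \<Rightarrow> nat" where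
  "algebra_rank scl = card (iso_classes scl (simple_module scl))"

text \<open>A brick: there is an isomorphism of \<open>'k\<close>-algebras from \<open>'k\<close> to the endomorphism algebra.\<close>

definition brick :: "('k::field \<Rightarrow> 'a::ring_1 \<Rightarrow> 'a) \<Rightarrow> ('a, 'k) lmodule \<Rightarrow> bool" where
  "brick scl M \<longleftrightarrow> fg_module scl M \<and>
     (\<exists>\<theta>. bij_betw \<theta> (UNIV :: 'k set) (Hom M M) \<and>
        (\<forall>a b. \<theta> (a + b) = \<theta> a + \<theta> b) \<and>
        (\<forall>a b. \<theta> (a * b) = \<theta> a \<circ> \<theta> b) \<and>
        \<theta> 1 = (\<lambda>v. if v \<in> mod_space M then v else 0) \<and>
        (\<forall>c a v. \<theta> (c * a) v = fscale c (\<theta> a v)))"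

definition brick_finite :: "('k::field \<Rightarrow> 'a::ring_1 \<Rightarrow> 'a) \<Rightarrow> bool" where
  "brick_finite scl \<longleftrightarrow> finite (iso_classes scl (brick scl))"


section \<open>Path algebras of quivers\<close>

text \<open>The vertices of a quiver are \<open>0, \<dots>, num_verts Q - 1\<close>.\<close>

record 'e quiver =
  num_verts :: nat
  arrows :: "'e set"
  src :: "'e \<Rightarrow> nat"
  tgt :: "'e \<Rightarrow> nat"

definition finite_quiver :: "'e quiver \<Rightarrow> bool" where
  "finite_quiver Q \<longleftrightarrow> finite (arrows Q) \<and>
     (\<forall>a\<in>arrows Q. src Q a < num_verts Q \<and> tgt Q a < num_verts Q)"

text \<open>A path from \<open>s\<close> to \<open>t\<close> is a triple \<open>(t, as, s)\<close>. The arrows are listed in the order of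
  composition of maps: the last arrow of the list is traversed first. This is the convention under
  which representations of the quiver are left modules.\<close>

type_synonym 'e path = "nat \<times> 'e list \<times> nat"

fun is_path :: "'e quiver \<Rightarrow> 'e path \<Rightarrow> bool" where
  "is_path Q (t, [], s) \<longleftrightarrow> t = s \<and> s < num_verts Q"
| "is_path Q (t, a # as, s) \<longleftrightarrow> a \<in> arrows Q \<and> tgt Q a = t \<and> is_path Q (src Q a, as, s)"

definition path_algebra :: "'e quiver \<Rightarrow> ('e path \<Rightarrow> 'k::field) set" where
  "path_algebra Q = {w. finite {p. w p \<noteq> 0} \<and> (\<forall>p. w p \<noteq> 0 \<longrightarrow> is_path Q p)}"

text \<open>The bilinear extension of concatenation \<open>(t, as, j) (j, bs, s) = (t, as @ bs, s)\<close>, all other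
  products of paths being zero.\<close>

definition path_mult ::
    "'e quiver \<Rightarrow> ('e path \<Rightarrow> 'k::field) \<Rightarrow> ('e path \<Rightarrow> 'k) \<Rightarrow> 'e path \<Rightarrow> 'k" where
  "path_mult Q w u = (\<lambda>(t, as, s).
     \<Sum>m\<le>length as. \<Sum>j<num_verts Q. w (t, take m as, j) * u (j, drop m as, s))"

definition path_one :: "'e quiver \<Rightarrow> 'e path \<Rightarrow> 'k::field" where
  "path_one Q = (\<lambda>(t, as, s). if as = [] \<and> t = s \<and> s < num_verts Q then 1 else 0)"

definition path_ideal :: "'e quiver \<Rightarrow> ('e path \<Rightarrow> 'k::field) set \<Rightarrow> bool" where
  "path_ideal Q I \<longleftrightarrow> I \<subseteq> path_algebra Q \<and> fam.subspace I \<and>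
     (\<forall>w\<in>path_algebra Q. \<forall>u\<in>I. path_mult Q w u \<in> I \<and> path_mult Q u w \<in> I)"

text \<open>The \<open>m\<close>-th power of the ideal generated by the arrows is spanned by the paths of length
  at least \<open>m\<close>.\<close>

definition arrow_ideal_power :: "'e quiver \<Rightarrow> nat \<Rightarrow> ('e path \<Rightarrow> 'k::field) set" where
  "arrow_ideal_power Q m =
     {w \<in> path_algebra Q. \<forall>t as s. w (t, as, s) \<noteq> 0 \<longrightarrow> m \<le> length as}"

definition admissible_ideal :: "'e quiver \<Rightarrow> ('e path \<Rightarrow> 'k::field) set \<Rightarrow> bool" where
  "admissible_ideal Q I \<longleftrightarrow> path_ideal Q I \<and>
     I \<subseteq> arrow_ideal_power Q 2 \<and> (\<exists>m\<ge>2. arrow_ideal_power Q m \<subseteq> I)"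

text \<open>A presentation of the algebra as a bound quiver algebra: an isomorphism from the quotient of
  the path algebra by \<open>I\<close>, given as a surjective algebra homomorphism \<open>\<phi>\<close> with kernel \<open>I\<close>.\<close>

definition bound_quiver_presentation ::
    "('k::field \<Rightarrow> 'a::ring_1 \<Rightarrow> 'a) \<Rightarrow> 'e quiver \<Rightarrow> ('e path \<Rightarrow> 'k) set \<Rightarrow>
     (('e path \<Rightarrow> 'k) \<Rightarrow> 'a) \<Rightarrow> bool" where
  "bound_quiver_presentation scl Q I \<phi> \<longleftrightarrow>
     finite_quiver Q \<and> admissible_ideal Q I \<and>
     (\<forall>w\<in>path_algebra Q. \<forall>u\<in>path_algebra Q. \<phi> (w + u) = \<phi> w + \<phi> u) \<and>
     (\<forall>c. \<forall>w\<in>path_algebra Q. \<phi> (fscale c w) = scl c (\<phi> w)) \<and>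
     (\<forall>w\<in>path_algebra Q. \<forall>u\<in>path_algebra Q. \<phi> (path_mult Q w u) = \<phi> w * \<phi> u) \<and>
     \<phi> (path_one Q) = 1 \<and>
     \<phi> ` path_algebra Q = UNIV \<and>
     I = {w \<in> path_algebra Q. \<phi> w = 0}"


section \<open>Affine spaces and irreducible components\<close>

text \<open>The affine space with coordinates indexed by \<open>J\<close> consists of the functions vanishing
  outside \<open>J\<close>.\<close>

definition affine_space :: "'j set \<Rightarrow> ('j \<Rightarrow> 'k::field) set" where
  "affine_space J = {x. \<forall>j. j \<notin> J \<longrightarrow> x j = 0}"

inductive_set polyfuns :: "'j set \<Rightarrow> (('j \<Rightarrow> 'k::field) \<Rightarrow> 'k) set" for J :: "'j set" where
  const: "(\<lambda>x. c) \<in> polyfuns J"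
| coord: "j \<in> J \<Longrightarrow> (\<lambda>x. x j) \<in> polyfuns J"
| add: "f \<in> polyfuns J \<Longrightarrow> g \<in> polyfuns J \<Longrightarrow> (\<lambda>x. f x + g x) \<in> polyfuns J"
| mult: "f \<in> polyfuns J \<Longrightarrow> g \<in> polyfuns J \<Longrightarrow> (\<lambda>x. f x * g x) \<in> polyfuns J"

definition zero_locus :: "'j set \<Rightarrow> (('j \<Rightarrow> 'k::field) \<Rightarrow> 'k) set \<Rightarrow> ('j \<Rightarrow> 'k) set" where
  "zero_locus J F = {x \<in> affine_space J. \<forall>f\<in>F. f x = 0}"

definition zariski :: "'j set \<Rightarrow> ('j \<Rightarrow> 'k::field) topology" where
  "zariski J = topology (\<lambda>U. \<exists>F \<subseteq> polyfuns J. U = affine_space J - zero_locus J F)"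

lemma istopology_zariski:
  "istopology (\<lambda>U. \<exists>F \<subseteq> polyfuns J. U = affine_space J - (zero_locus J F :: ('j \<Rightarrow> 'k::field) set))"
proof -
  have "\<exists>H \<subseteq> polyfuns J. U \<inter> V = affine_space J - zero_locus J H"
    if U: "U = affine_space J - zero_locus J F" and V: "V = affine_space J - zero_locus J G"
      and F: "F \<subseteq> polyfuns J" and G: "G \<subseteq> polyfuns J"
    for U V :: "('j \<Rightarrow> 'k) set" and F G
  proof (intro exI conjI)
    let ?H = "(\<lambda>(f, g) x. f x * g x) ` (F \<times> G)"
    show "?H \<subseteq> polyfuns J"
      using F G by (auto intro!: polyfuns.mult)
    show "U \<inter> V = affine_space J - zero_locus J ?H"
      unfolding U V zero_locus_def by fastforce
  qed
  moreover have "\<exists>H \<subseteq> polyfuns J. \<Union>\<K> = affine_space J - zero_locus J H"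
    if K: "\<forall>U\<in>\<K>. \<exists>F \<subseteq> polyfuns J. U = affine_space J - zero_locus J F"
    for \<K> :: "('j \<Rightarrow> 'k) set set"
  proof -
    from K obtain F where F: "\<And>U. U \<in> \<K> \<Longrightarrow> F U \<subseteq> polyfuns J"
      "\<And>U. U \<in> \<K> \<Longrightarrow> U = affine_space J - zero_locus J (F U)"
      by metis
    have "\<Union>\<K> = (\<Union>U\<in>\<K>. affine_space J - zero_locus J (F U))"
      using F(2) by auto
    also have "\<dots> = affine_space J - zero_locus J (\<Union>U\<in>\<K>. F U)"
      by (auto simp: zero_locus_def)
    finally show ?thesis
      using F(1) by (intro exI[of _ "\<Union>U\<in>\<K>. F U"]) auto
  qed
  ultimately show ?thesis
    unfolding istopology_def by blast
qed

lemma openin_zariski: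
  "openin (zariski J) U \<longleftrightarrow> (\<exists>F \<subseteq> polyfuns J. U = affine_space J - zero_locus J F)"
  unfolding zariski_def by (simp add: topology_inverse' istopology_zariski)

definition irreducible_in :: "'x topology \<Rightarrow> 'x set \<Rightarrow> bool" where
  "irreducible_in T S \<longleftrightarrow> S \<subseteq> topspace T \<and> S \<noteq> {} \<and>
     (\<forall>C D. closedin T C \<and> closedin T D \<and> S \<subseteq> C \<union> D \<longrightarrow> S \<subseteq> C \<or> S \<subseteq> D)"

definition irreducible_component_of :: "'x topology \<Rightarrow> 'x set \<Rightarrow> bool" where
  "irreducible_component_of T Z \<longleftrightarrow> irreducible_in T Z \<and>
     (\<forall>S. irreducible_in T S \<and> Z \<subseteq> S \<longrightarrow> S = Z)"


section \<open>Representation varieties\<close>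

text \<open>A representation of dimension vector \<open>d\<close> consists of a matrix of size
  \<open>d (tgt Q a) \<times> d (src Q a)\<close> for every arrow \<open>a\<close>; its \<open>(r, c)\<close> entry is the coordinate
  \<open>(a, r, c)\<close>.\<close>

definition rep_coords :: "'e quiver \<Rightarrow> (nat \<Rightarrow> nat) \<Rightarrow> ('e \<times> nat \<times> nat) set" where
  "rep_coords Q d = {(a, r, c). a \<in> arrows Q \<and> r < d (tgt Q a) \<and> c < d (src Q a)}"

text \<open>The total space, with basis indexed by the pairs \<open>(i, r)\<close> with \<open>i\<close> a vertex and
  \<open>r < d i\<close>.\<close>

definition total_space :: "'e quiver \<Rightarrow> (nat \<Rightarrow> nat) \<Rightarrow> 'k::field fam set" where
  "total_space Q d = {v. \<forall>i r. v (i, r) \<noteq> 0 \<longrightarrow> i < num_verts Q \<and> r < d i}"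

definition arrow_act ::
    "'e quiver \<Rightarrow> (nat \<Rightarrow> nat) \<Rightarrow> ('e \<times> nat \<times> nat \<Rightarrow> 'k::field) \<Rightarrow> 'e \<Rightarrow> 'k fam \<Rightarrow> 'k fam" where
  "arrow_act Q d x a v = (\<lambda>(i, r).
     if i = tgt Q a \<and> r < d i then \<Sum>c<d (src Q a). x (a, r, c) * v (src Q a, c) else 0)"

definition vertex_act :: "nat \<Rightarrow> 'k::field fam \<Rightarrow> 'k fam" where
  "vertex_act s v = (\<lambda>(i, r). if i = s then v (i, r) else 0)"

fun path_act ::
    "'e quiver \<Rightarrow> (nat \<Rightarrow> nat) \<Rightarrow> ('e \<times> nat \<times> nat \<Rightarrow> 'k::field) \<Rightarrow> 'e path \<Rightarrow> 'k fam \<Rightarrow> 'k fam" where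
  "path_act Q d x (t, as, s) v = foldr (arrow_act Q d x) as (vertex_act s v)"

definition path_algebra_act ::
    "'e quiver \<Rightarrow> (nat \<Rightarrow> nat) \<Rightarrow> ('e \<times> nat \<times> nat \<Rightarrow> 'k::field) \<Rightarrow> ('e path \<Rightarrow> 'k) \<Rightarrow> 'k fam \<Rightarrow> 'k fam" where
  "path_algebra_act Q d x w v = (\<Sum>p | w p \<noteq> 0. fscale (w p) (path_act Q d x p v))"

definition rep_points ::
    "'e quiver \<Rightarrow> ('e path \<Rightarrow> 'k::field) set \<Rightarrow> (nat \<Rightarrow> nat) \<Rightarrow> ('e \<times> nat \<times> nat \<Rightarrow> 'k) set" where
  "rep_points Q I d = {x \<in> affine_space (rep_coords Q d).
     \<forall>w\<in>I. \<forall>v\<in>total_space Q d. path_algebra_act Q d x w v = 0}"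

definition rep_variety ::
    "'e quiver \<Rightarrow> ('e path \<Rightarrow> 'k::field) set \<Rightarrow> (nat \<Rightarrow> nat) \<Rightarrow> ('e \<times> nat \<times> nat \<Rightarrow> 'k) topology" where
  "rep_variety Q I d = subtopology (zariski (rep_coords Q d)) (rep_points Q I d)"

definition irreducible_component ::
    "'e quiver \<Rightarrow> ('e path \<Rightarrow> 'k::field) set \<Rightarrow> (nat \<Rightarrow> nat) \<Rightarrow> ('e \<times> nat \<times> nat \<Rightarrow> 'k) set \<Rightarrow> bool" where
  "irreducible_component Q I d Z \<longleftrightarrow>
     (\<exists>i<num_verts Q. d i \<noteq> 0) \<and> irreducible_component_of (rep_variety Q I d) Z"

text \<open>The left module of a point \<open>x\<close>. An element of the algebra acts as any of its preimages in the
  path algebra; on \<open>rep_points\<close> this does not depend on the preimage.\<close>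

definition point_module ::
    "'e quiver \<Rightarrow> (('e path \<Rightarrow> 'k::field) \<Rightarrow> 'a::ring_1) \<Rightarrow> (nat \<Rightarrow> nat) \<Rightarrow>
     ('e \<times> nat \<times> nat \<Rightarrow> 'k) \<Rightarrow> ('a, 'k) lmodule" where
  "point_module Q \<phi> d x = \<lparr>mod_space = total_space Q d,
     mod_act = (\<lambda>a. path_algebra_act Q d x (inv_into (path_algebra Q) \<phi> a))\<rparr>"

text \<open>Elements of \<open>GL(d)\<close> are given as families \<open>g\<close> of square matrices together with the family
  \<open>h\<close> of their inverses. Such a pair sends \<open>x\<close> to the point with matrices
  \<open>g (tgt Q a) * x a * h (src Q a)\<close>.\<close>

definition GL_pair ::
    "'e quiver \<Rightarrow> (nat \<Rightarrow> nat) \<Rightarrow> (nat \<Rightarrow> nat \<Rightarrow> nat \<Rightarrow> 'k::field) \<Rightarrow> (nat \<Rightarrow> nat \<Rightarrow> nat \<Rightarrow> 'k) \<Rightarrow> bool" where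
  "GL_pair Q d g h \<longleftrightarrow> (\<forall>i<num_verts Q. \<forall>r<d i. \<forall>c<d i.
     (\<Sum>q<d i. g i r q * h i q c) = (if r = c then 1 else 0) \<and>
     (\<Sum>q<d i. h i r q * g i q c) = (if r = c then 1 else 0))"

definition conj_act ::
    "'e quiver \<Rightarrow> (nat \<Rightarrow> nat) \<Rightarrow> (nat \<Rightarrow> nat \<Rightarrow> nat \<Rightarrow> 'k::field) \<Rightarrow> (nat \<Rightarrow> nat \<Rightarrow> nat \<Rightarrow> 'k) \<Rightarrow>
     ('e \<times> nat \<times> nat \<Rightarrow> 'k) \<Rightarrow> 'e \<times> nat \<times> nat \<Rightarrow> 'k" where
  "conj_act Q d g h x = (\<lambda>(a, r, c). if (a, r, c) \<in> rep_coords Q d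
     then \<Sum>p<d (tgt Q a). \<Sum>q<d (src Q a). g (tgt Q a) r p * x (a, p, q) * h (src Q a) q c
     else 0)"

definition gl_orbit ::
    "'e quiver \<Rightarrow> (nat \<Rightarrow> nat) \<Rightarrow> ('e \<times> nat \<times> nat \<Rightarrow> 'k::field) \<Rightarrow> ('e \<times> nat \<times> nat \<Rightarrow> 'k) set" where
  "gl_orbit Q d x = {conj_act Q d g h x | g h. GL_pair Q d g h}"

definition has_dense_orbit ::
    "'e quiver \<Rightarrow> ('e path \<Rightarrow> 'k::field) set \<Rightarrow> (nat \<Rightarrow> nat) \<Rightarrow> ('e \<times> nat \<times> nat \<Rightarrow> 'k) set \<Rightarrow> bool" where
  "has_dense_orbit Q I d Z \<longleftrightarrow>
     (\<exists>x\<in>Z. gl_orbit Q d x \<subseteq> Z \<and> subtopology (rep_variety Q I d) Z closure_of gl_orbit Q d x = Z)"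

definition has_orthogonal_orbits ::
    "'e quiver \<Rightarrow> (('e path \<Rightarrow> 'k::field) \<Rightarrow> 'a::ring_1) \<Rightarrow> (nat \<Rightarrow> nat) \<Rightarrow>
     ('e \<times> nat \<times> nat \<Rightarrow> 'k) set \<Rightarrow> bool" where
  "has_orthogonal_orbits Q \<phi> d Z \<longleftrightarrow>
     (\<exists>x\<in>Z. \<exists>y\<in>Z. gl_orbit Q d x \<subseteq> Z \<and> gl_orbit Q d y \<subseteq> Z \<and>
        Hom (point_module Q \<phi> d x) (point_module Q \<phi> d y) = {0} \<and>
        Hom (point_module Q \<phi> d y) (point_module Q \<phi> d x) = {0})"

end

theory Submission
  imports Defs
begin

text \<open>Vanishing of \<open>Hom\<close> is an open condition in each argument, and a non-empty open subset of an
  irreducible set is dense. Hence if \<open>Hom X Y = 0\<close> with \<open>X, Y\<close> in a component with a dense orbit,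
  first \<open>Y\<close> and then \<open>X\<close> can be moved into that orbit, giving a non-zero module \<open>M\<close> with
  \<open>Hom M M = 0\<close>.

  If there are finitely many bricks in each dimension and \<open>Hom X Y = 0\<close>, then both the torsion class
  generated by \<open>X\<close> and the torsion-free class of all \<open>N\<close> with \<open>Hom X N = 0\<close> are open in the
  component: the former is cut out by finitely many bricks, because every non-zero module has a brick
  that is both a quotient and a submodule. The two sets meet in a non-zero module, which is absurd.

  Conversely, infinitely many bricks of one dimension give, since affine space is Noetherian,
  non-isomorphic bricks \<open>X, Y\<close> in one component. If \<open>Hom X N\<close> never vanished on it, then a
  neighbourhood of \<open>X\<close> would consist of copies of \<open>X\<close>, whence \<open>Hom N Y\<close> would never vanish either
  and a neighbourhood of \<open>Y\<close> would consist of copies of \<open>Y\<close>, contradicting irreducibility. By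
  symmetry the open sets \<open>Hom X N = 0\<close> and \<open>Hom N X = 0\<close> are both non-empty, and any \<open>N\<close> in their
  intersection is orthogonal to \<open>X\<close>.\<close>

section \<open>Polynomial functions\<close>

text \<open>Openness is always witnessed by a single polynomial function: a property spreads from a
  point to the set where some \<open>P\<close> that is non-zero at this point does not vanish.
  Irreducibility then says that two such functions have a common point of non-vanishing. The
  functions \<open>P\<close> come from elimination, as products of pivots, in the linear system for
  homomorphisms, whose coefficients are polynomial in the two points.

  The torsion class itself is never formed. A neighbourhood of \<open>X\<close> suffices on which
  \<open>Hom N B\<close> vanishes for the finitely many bricks \<open>B\<close>, of dimension at
  most that of \<open>X\<close>, with \<open>Hom X B = 0\<close>. If also
  \<open>Hom X N = 0\<close>, a brick \<open>B\<close> that is a quotient and a submodule of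
  \<open>N\<close> satisfies \<open>Hom X B = 0\<close> as a submodule, hence
  \<open>Hom N B = 0\<close>, which is absurd for a quotient.

  Copies of \<open>X\<close> fill a neighbourhood because the maps from a brick \<open>X\<close> to
  a nearby module are multiples of one map close to the identity. Orthogonality asks for whole
  orbits inside the component; this rests on the irreducibility of the general linear group.
  Algebraic closedness enters through eigenvalues and through the infinity of the field.\<close>

lemma polyfuns_sum:
  assumes "finite A" "\<And>i. i \<in> A \<Longrightarrow> f i \<in> polyfuns J"
  shows "(\<lambda>x. \<Sum>i\<in>A. f i x) \<in> polyfuns J"
  using assms by (induction A rule: finite_induct) (auto intro: polyfuns.intros)

lemma polyfuns_prod:
  assumes "finite A" "\<And>i. i \<in> A \<Longrightarrow> f i \<in> polyfuns J"
  shows "(\<lambda>x. \<Prod>i\<in>A. f i x) \<in> polyfuns J"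
  using assms by (induction A rule: finite_induct) (auto intro: polyfuns.intros)

lemma polyfuns_uminus: "f \<in> polyfuns J \<Longrightarrow> (\<lambda>x. - f x) \<in> polyfuns J"
  using polyfuns.mult[OF polyfuns.const[of "-1"]] by fastforce

lemma polyfuns_diff: "f \<in> polyfuns J \<Longrightarrow> g \<in> polyfuns J \<Longrightarrow> (\<lambda>x. f x - g x) \<in> polyfuns J"
  using polyfuns.add[OF _ polyfuns_uminus] by fastforce

lemmas polyfuns_intros =
  polyfuns.const polyfuns.add polyfuns.mult polyfuns_sum polyfuns_prod polyfuns_uminus polyfuns_diff

text \<open>Gaussian elimination with pivots that are invertible at \<open>x0\<close>; the variable \<open>s\<close> homogenises
  the right-hand side, so that the formula for \<open>g\<close> is also valid where \<open>M\<close> is a combination of columns.\<close>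

lemma polynomial_elimination:
  fixes L :: "'e \<Rightarrow> 'i \<Rightarrow> ('j \<Rightarrow> 'k::field) \<Rightarrow> 'k"
  assumes "finite K"
    and "\<And>e \<kappa>. e \<in> E \<Longrightarrow> \<kappa> \<in> K \<Longrightarrow> L e \<kappa> \<in> polyfuns J"
    and "\<And>e. e \<in> E \<Longrightarrow> M e \<in> polyfuns J"
    and "\<And>g. (\<forall>e\<in>E. (\<Sum>\<kappa>\<in>K. L e \<kappa> x0 * g \<kappa>) = 0) \<Longrightarrow> \<forall>\<kappa>\<in>K. g \<kappa> = 0"
  obtains P f where "P \<in> polyfuns J" "\<And>\<kappa>. \<kappa> \<in> K \<Longrightarrow> f \<kappa> \<in> polyfuns J" "P x0 \<noteq> 0"
    "\<And>x g s \<kappa>. \<forall>e\<in>E. (\<Sum>\<kappa>\<in>K. L e \<kappa> x * g \<kappa>) = s * M e x \<Longrightarrow> \<kappa> \<in> K \<Longrightarrow> P x * g \<kappa> = s * f \<kappa> x"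
proof -
  have "\<exists>P f. P \<in> polyfuns J \<and> (\<forall>\<kappa>\<in>K. f \<kappa> \<in> polyfuns J) \<and> P x0 \<noteq> 0 \<and>
    (\<forall>x g s. (\<forall>e\<in>E. (\<Sum>\<kappa>\<in>K. L e \<kappa> x * g \<kappa>) = s * M e x) \<longrightarrow> (\<forall>\<kappa>\<in>K. P x * g \<kappa> = s * f \<kappa> x))"
    using assms
  proof (induction K arbitrary: L M rule: finite_induct)
    case empty
    show ?case by (rule exI[of _ "\<lambda>_. 1"]) (auto intro: polyfuns.const)
  next
    case (insert \<kappa>0 K)
    have "\<exists>e0\<in>E. L e0 \<kappa>0 x0 \<noteq> 0"
    proof (rule ccontr)
      assume "\<not> ?thesis"
      then have "\<forall>e\<in>E. (\<Sum>\<kappa>\<in>insert \<kappa>0 K. L e \<kappa> x0 * (if \<kappa> = \<kappa>0 then 1 else 0)) = 0"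
        using insert.hyps by (auto intro!: sum.neutral)
      from insert.prems(3)[OF this] show False by simp
    qed
    then obtain e0 where e0: "e0 \<in> E" "L e0 \<kappa>0 x0 \<noteq> 0" by blast
    \<comment> \<open>Row \<open>e0\<close> is subtracted after cross-multiplication instead of
      division, so the coefficients of the reduced system stay polynomial.\<close>
    define L' where "L' e \<kappa> x = L e0 \<kappa>0 x * L e \<kappa> x - L e \<kappa>0 x * L e0 \<kappa> x" for e \<kappa> x
    define M' where "M' e x = L e0 \<kappa>0 x * M e x - L e \<kappa>0 x * M e0 x" for e x
    have sum_L': "(\<Sum>\<kappa>\<in>K. L' e \<kappa> x * g \<kappa>) =
        L e0 \<kappa>0 x * (\<Sum>\<kappa>\<in>K. L e \<kappa> x * g \<kappa>) - L e \<kappa>0 x * (\<Sum>\<kappa>\<in>K. L e0 \<kappa> x * g \<kappa>)" for e x g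
      by (simp add: L'_def sum_distrib_left sum_subtractf[symmetric] algebra_simps)
    have "\<forall>\<kappa>\<in>K. g \<kappa> = 0" if g: "\<forall>e\<in>E. (\<Sum>\<kappa>\<in>K. L' e \<kappa> x0 * g \<kappa>) = 0" for g
    proof -
      \<comment> \<open>The value at \<open>\<kappa>0\<close> is the one that solves the pivot row
        at \<open>x0\<close>. Thus a solution of the reduced system extends to one of the full
        system, which is trivial by assumption.\<close>
      define g' where "g' = g(\<kappa>0 := - (\<Sum>\<kappa>\<in>K. L e0 \<kappa> x0 * g \<kappa>) / L e0 \<kappa>0 x0)"
      have eq: "(\<Sum>\<kappa>\<in>K. L e \<kappa> x0 * g' \<kappa>) = (\<Sum>\<kappa>\<in>K. L e \<kappa> x0 * g \<kappa>)" for e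
        by (rule sum.cong) (use insert.hyps in \<open>auto simp: g'_def\<close>)
      have "\<forall>e\<in>E. (\<Sum>\<kappa>\<in>insert \<kappa>0 K. L e \<kappa> x0 * g' \<kappa>) = 0"
      proof
        fix e assume "e \<in> E"
        then have "L e0 \<kappa>0 x0 * (\<Sum>\<kappa>\<in>K. L e \<kappa> x0 * g \<kappa>) = L e \<kappa>0 x0 * (\<Sum>\<kappa>\<in>K. L e0 \<kappa> x0 * g \<kappa>)"
          using g sum_L'[of e x0 g] by simp
        then show "(\<Sum>\<kappa>\<in>insert \<kappa>0 K. L e \<kappa> x0 * g' \<kappa>) = 0"
          using insert.hyps e0 eq by (simp add: g'_def field_simps)
      qed
      from insert.prems(3)[OF this] have "\<forall>\<kappa>\<in>K. g' \<kappa> = 0" by simp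
      then show ?thesis
        using insert.hyps unfolding g'_def by (metis fun_upd_other)
    qed
    moreover have "L' e \<kappa> \<in> polyfuns J" if "e \<in> E" "\<kappa> \<in> K" for e \<kappa>
      using that e0 insert.prems(1) unfolding L'_def by (intro polyfuns_intros) auto
    moreover have "M' e \<in> polyfuns J" if "e \<in> E" for e
      using that e0 insert.prems(1,2) unfolding M'_def by (intro polyfuns_intros) auto
    ultimately obtain P f where P: "P \<in> polyfuns J" "\<forall>\<kappa>\<in>K. f \<kappa> \<in> polyfuns J" "P x0 \<noteq> 0" and
      sol: "\<And>x g s. \<forall>e\<in>E. (\<Sum>\<kappa>\<in>K. L' e \<kappa> x * g \<kappa>) = s * M' e x \<Longrightarrow> \<forall>\<kappa>\<in>K. P x * g \<kappa> = s * f \<kappa> x"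
      using insert.IH[of L' M'] by blast
    \<comment> \<open>Back substitution: \<open>P\<close> times the new pivot is the common
      denominator, and the entry at \<open>\<kappa>0\<close> is read off from the pivot row.\<close>
    define f' where "f' = (\<lambda>\<kappa> x. L e0 \<kappa>0 x * f \<kappa> x)
      (\<kappa>0 := \<lambda>x. P x * M e0 x - (\<Sum>\<kappa>\<in>K. L e0 \<kappa> x * f \<kappa> x))"
    have L_poly: "L e0 \<kappa> \<in> polyfuns J" if "\<kappa> \<in> insert \<kappa>0 K" for \<kappa>
      using insert.prems(1) e0 that by blast
    show ?case
    proof (intro exI[of _ "\<lambda>x. P x * L e0 \<kappa>0 x"] exI[of _ f'] conjI allI impI ballI)
      show "(\<lambda>x. P x * L e0 \<kappa>0 x) \<in> polyfuns J"
        using P L_poly by (intro polyfuns_intros) auto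
      show "P x0 * L e0 \<kappa>0 x0 \<noteq> 0" using P e0 by simp
      fix \<kappa> assume \<kappa>: "\<kappa> \<in> insert \<kappa>0 K"
      have "(\<lambda>x. P x * M e0 x - (\<Sum>\<kappa>\<in>K. L e0 \<kappa> x * f \<kappa> x)) \<in> polyfuns J"
        using P L_poly insert.prems(2) e0 insert.hyps by (intro polyfuns_intros) auto
      moreover have "(\<lambda>x. L e0 \<kappa>0 x * f \<kappa> x) \<in> polyfuns J" if "\<kappa> \<in> K"
        using P L_poly that by (intro polyfuns_intros) auto
      ultimately show "f' \<kappa> \<in> polyfuns J" using \<kappa> by (auto simp: f'_def)
    next
      fix x g s \<kappa>
      assume g: "\<forall>e\<in>E. (\<Sum>\<kappa>\<in>insert \<kappa>0 K. L e \<kappa> x * g \<kappa>) = s * M e x" and \<kappa>: "\<kappa> \<in> insert \<kappa>0 K"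
      then have row: "L e \<kappa>0 x * g \<kappa>0 + (\<Sum>\<kappa>\<in>K. L e \<kappa> x * g \<kappa>) = s * M e x" if "e \<in> E" for e
        using that insert.hyps by simp
      have "\<forall>e\<in>E. (\<Sum>\<kappa>\<in>K. L' e \<kappa> x * g \<kappa>) = s * M' e x"
      proof
        fix e assume e: "e \<in> E"
        have val: "(\<Sum>\<kappa>\<in>K. L e \<kappa> x * g \<kappa>) = s * M e x - L e \<kappa>0 x * g \<kappa>0" if "e \<in> E" for e
          using row[OF that] by (simp add: algebra_simps)
        show "(\<Sum>\<kappa>\<in>K. L' e \<kappa> x * g \<kappa>) = s * M' e x"
          unfolding sum_L' val[OF e] val[OF e0(1)] by (simp add: M'_def algebra_simps)
      qed
      from sol[OF this] have IH: "\<And>\<kappa>. \<kappa> \<in> K \<Longrightarrow> P x * g \<kappa> = s * f \<kappa> x" by blast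
      show "P x * L e0 \<kappa>0 x * g \<kappa> = s * f' \<kappa> x"
      proof (cases "\<kappa> = \<kappa>0")
        case True
        have "P x * (\<Sum>\<kappa>\<in>K. L e0 \<kappa> x * g \<kappa>) = (\<Sum>\<kappa>\<in>K. L e0 \<kappa> x * (P x * g \<kappa>))"
          by (simp add: sum_distrib_left ac_simps)
        also have "\<dots> = s * (\<Sum>\<kappa>\<in>K. L e0 \<kappa> x * f \<kappa> x)"
          using IH by (simp add: sum_distrib_left ac_simps)
        finally have *: "P x * (\<Sum>\<kappa>\<in>K. L e0 \<kappa> x * g \<kappa>) = s * (\<Sum>\<kappa>\<in>K. L e0 \<kappa> x * f \<kappa> x)" .
        have "L e0 \<kappa>0 x * g \<kappa>0 = s * M e0 x - (\<Sum>\<kappa>\<in>K. L e0 \<kappa> x * g \<kappa>)"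
          using row[OF e0(1)] by (simp add: eq_diff_eq)
        then have "P x * L e0 \<kappa>0 x * g \<kappa>0 = P x * (s * M e0 x) - P x * (\<Sum>\<kappa>\<in>K. L e0 \<kappa> x * g \<kappa>)"
          by (simp add: mult.assoc right_diff_distrib)
        then show ?thesis
          unfolding True * by (simp add: f'_def right_diff_distrib mult.left_commute)
      next
        case False
        then show ?thesis using IH[of \<kappa>] \<kappa> by (simp add: f'_def algebra_simps)
      qed
    qed
  qed
  then obtain P f where "P \<in> polyfuns J" "\<forall>\<kappa>\<in>K. f \<kappa> \<in> polyfuns J" "P x0 \<noteq> 0"
    and "\<forall>x g s. (\<forall>e\<in>E. (\<Sum>\<kappa>\<in>K. L e \<kappa> x * g \<kappa>) = s * M e x) \<longrightarrow> (\<forall>\<kappa>\<in>K. P x * g \<kappa> = s * f \<kappa> x)"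
    by (elim exE conjE) rule
  then show ?thesis by (intro that[of P f]) blast+
qed

text \<open>Full column rank at \<open>x0\<close> persists near \<open>x0\<close>; the product of
  the pivots takes the part of a non-vanishing minor.\<close>

corollary polynomial_elimination_homogeneous:
  fixes L :: "'e \<Rightarrow> 'i \<Rightarrow> ('j \<Rightarrow> 'k::field) \<Rightarrow> 'k"
  assumes "finite K"
    and "\<And>e \<kappa>. e \<in> E \<Longrightarrow> \<kappa> \<in> K \<Longrightarrow> L e \<kappa> \<in> polyfuns J"
    and "\<And>g. (\<forall>e\<in>E. (\<Sum>\<kappa>\<in>K. L e \<kappa> x0 * g \<kappa>) = 0) \<Longrightarrow> \<forall>\<kappa>\<in>K. g \<kappa> = 0"
  obtains P where "P \<in> polyfuns J" "P x0 \<noteq> 0"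
    "\<And>x g \<kappa>. P x \<noteq> 0 \<Longrightarrow> \<forall>e\<in>E. (\<Sum>\<kappa>\<in>K. L e \<kappa> x * g \<kappa>) = 0 \<Longrightarrow> \<kappa> \<in> K \<Longrightarrow> g \<kappa> = 0"
proof (rule polynomial_elimination[where M = "\<lambda>_ _. 0", OF assms(1,2) polyfuns.const assms(3)])
  fix P :: "('j \<Rightarrow> 'k) \<Rightarrow> 'k" and f :: "'i \<Rightarrow> ('j \<Rightarrow> 'k) \<Rightarrow> 'k"
  assume P: "P \<in> polyfuns J" "P x0 \<noteq> 0" and
    sol: "\<And>x g s \<kappa>. \<forall>e\<in>E. (\<Sum>\<kappa>\<in>K. L e \<kappa> x * g \<kappa>) = s * 0 \<Longrightarrow> \<kappa> \<in> K \<Longrightarrow> P x * g \<kappa> = s * f \<kappa> x"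
  show ?thesis
    by (rule that[OF P]) (use sol[where s = 0] in fastforce)
qed

section \<open>Hilbert's basis theorem\<close>

text \<open>Rings are subsets of an ambient ring because the rings \<open>polyfuns J\<close>, for
  different \<open>J\<close>, consist of functions on the same type and are compared by
  inclusion.\<close>

definition subring_closed :: "'r::comm_ring_1 set \<Rightarrow> bool" where
  "subring_closed R \<longleftrightarrow> 0 \<in> R \<and> 1 \<in> R \<and> (\<forall>a\<in>R. \<forall>b\<in>R. a + b \<in> R \<and> a * b \<in> R) \<and> (\<forall>a\<in>R. - a \<in> R)"

definition ideal_upto :: "'r::comm_ring_1 set \<Rightarrow> (nat \<Rightarrow> 'r) \<Rightarrow> nat \<Rightarrow> 'r set" where
  "ideal_upto R f n = {\<Sum>i<n. c i * f i | c. \<forall>i. c i \<in> R}"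

text \<open>The ascending chain condition for sequences: the ideals generated by initial segments
  cannot grow at every step.\<close>

definition noetherian_subring :: "'r::comm_ring_1 set \<Rightarrow> bool" where
  "noetherian_subring R \<longleftrightarrow> (\<forall>f. (\<forall>i. f i \<in> R) \<longrightarrow> (\<exists>n. f n \<in> ideal_upto R f n))"

definition polys_over :: "'r::comm_ring_1 set \<Rightarrow> 'r poly set" where
  "polys_over R = {p. \<forall>i. coeff p i \<in> R}"

lemma subring_closedD:
  assumes "subring_closed R"
  shows "0 \<in> R" "1 \<in> R" "a \<in> R \<Longrightarrow> b \<in> R \<Longrightarrow> a + b \<in> R" "a \<in> R \<Longrightarrow> b \<in> R \<Longrightarrow> a * b \<in> R"
    "a \<in> R \<Longrightarrow> - a \<in> R" "a \<in> R \<Longrightarrow> b \<in> R \<Longrightarrow> a - b \<in> R"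
proof -
  show "a \<in> R \<Longrightarrow> b \<in> R \<Longrightarrow> a - b \<in> R"
    using assms unfolding subring_closed_def by (metis diff_conv_add_uminus)
qed (use assms in \<open>auto simp: subring_closed_def\<close>)

lemma subring_closed_sum:
  assumes "subring_closed R" "\<And>i. i \<in> A \<Longrightarrow> f i \<in> R"
  shows "sum f A \<in> R"
  using assms(2) by (induction A rule: infinite_finite_induct) (auto simp: subring_closedD[OF assms(1)])

lemma subring_closed_polys_over:
  assumes R: "subring_closed R"
  shows "subring_closed (polys_over R)"
  using subring_closedD[OF R]
  by (auto simp: subring_closed_def polys_over_def coeff_mult coeff_1 intro!: subring_closed_sum[OF R])

lemma subring_closed_image_poly:
  assumes R: "subring_closed R"
  shows "subring_closed ((\<lambda>p. poly p x) ` polys_over R)"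
proof -
  note PR = subring_closed_polys_over[OF R]
  have "\<exists>p\<in>polys_over R. poly p x = 0" "\<exists>p\<in>polys_over R. poly p x = 1"
    using subring_closedD(1,2)[OF PR] by force+
  then have "0 \<in> (\<lambda>p. poly p x) ` polys_over R" "1 \<in> (\<lambda>p. poly p x) ` polys_over R"
    by (metis imageI)+
  moreover have "poly p x + poly q x \<in> (\<lambda>p. poly p x) ` polys_over R"
    "poly p x * poly q x \<in> (\<lambda>p. poly p x) ` polys_over R" "- poly p x \<in> (\<lambda>p. poly p x) ` polys_over R"
    if "p \<in> polys_over R" "q \<in> polys_over R" for p q
    unfolding poly_add[symmetric] poly_mult[symmetric] poly_minus[symmetric]
    using subring_closedD(3-5)[OF PR] that by blast+
  ultimately show ?thesis
    unfolding subring_closed_def by blast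
qed

lemma ideal_upto_zero: "subring_closed R \<Longrightarrow> 0 \<in> ideal_upto R f n"
  unfolding ideal_upto_def by (rule CollectI, rule exI[of _ "\<lambda>_. 0"]) (auto simp: subring_closedD)

lemma ideal_upto_add:
  assumes R: "subring_closed R" and "a \<in> ideal_upto R f n" "b \<in> ideal_upto R f n"
  shows "a + b \<in> ideal_upto R f n"
proof -
  obtain c d where "a = (\<Sum>i<n. c i * f i)" "b = (\<Sum>i<n. d i * f i)" "\<forall>i. c i \<in> R" "\<forall>i. d i \<in> R"
    using assms by (auto simp: ideal_upto_def)
  then show ?thesis
    unfolding ideal_upto_def
    by (intro CollectI exI[of _ "\<lambda>i. c i + d i"]) (auto simp: subring_closedD[OF R] algebra_simps sum.distrib)
qed

lemma ideal_upto_mult: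
  assumes R: "subring_closed R" and "a \<in> ideal_upto R f n" "b \<in> R"
  shows "b * a \<in> ideal_upto R f n"
proof -
  obtain c where "a = (\<Sum>i<n. c i * f i)" "\<forall>i. c i \<in> R"
    using assms by (auto simp: ideal_upto_def)
  then show ?thesis
    using assms(3) unfolding ideal_upto_def
    by (intro CollectI exI[of _ "\<lambda>i. b * c i"]) (auto simp: subring_closedD[OF R] algebra_simps sum_distrib_left)
qed

lemma ideal_upto_sum:
  assumes R: "subring_closed R" and "\<And>i. i \<in> A \<Longrightarrow> g i \<in> ideal_upto R f n"
  shows "sum g A \<in> ideal_upto R f n"
  using assms(2)
  by (induction A rule: infinite_finite_induct) (auto simp: ideal_upto_zero[OF R] ideal_upto_add[OF R])

lemma ideal_upto_base:
  assumes R: "subring_closed R" and "i < n"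
  shows "f i \<in> ideal_upto R f n"
  unfolding ideal_upto_def
  by (rule CollectI, rule exI[of _ "\<lambda>j. if j = i then 1 else 0"])
    (use \<open>i < n\<close> in \<open>auto simp: subring_closedD[OF R] if_distrib[of "\<lambda>a. a * _"] cong: if_cong\<close>)

lemma ideal_upto_mono:
  assumes R: "subring_closed R" and "m \<le> n"
  shows "ideal_upto R f m \<subseteq> ideal_upto R f n"
  using assms unfolding ideal_upto_def[of R f m]
  by (auto intro!: ideal_upto_sum ideal_upto_mult ideal_upto_base)

text \<open>The classical argument with leading coefficients, run in the ring generated by
  \<open>R\<close> and an element \<open>x\<close> that may satisfy algebraic relations over
  \<open>R\<close>. Elements are represented by polynomials, and degrees are minimised over all
  representatives.\<close>

theorem Hilbert_basis:
  fixes R :: "'r::comm_ring_1 set"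
  assumes R: "subring_closed R" and noeth: "noetherian_subring R"
  shows "noetherian_subring ((\<lambda>p. poly p x) ` polys_over R)"
proof (rule ccontr)
  let ?S = "(\<lambda>p. poly p x) ` polys_over R"
  assume "\<not> noetherian_subring ?S"
  then obtain f where f: "\<And>i. f i \<in> ?S" "\<And>n. f n \<notin> ideal_upto ?S f n"
    unfolding noetherian_subring_def by blast
  note S = subring_closed_image_poly[OF R, of x] and PR = subring_closed_polys_over[OF R]
  \<comment> \<open>The ideal generated by the whole bad sequence \<open>f\<close>; no initial
    segment of \<open>f\<close> generates it.\<close>
  define I where "I = (\<Union>n. ideal_upto ?S f n)"
  have I_upto: "\<exists>N. \<forall>i<n. g i \<in> ideal_upto ?S f N" if "\<forall>i<n. g i \<in> I" for g :: "nat \<Rightarrow> 'r" and n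
    using that
  proof (induction n)
    case (Suc n)
    then obtain N N' where "\<forall>i<n. g i \<in> ideal_upto ?S f N" "g n \<in> ideal_upto ?S f N'"
      by (auto simp: I_def)
    then show ?case
      using ideal_upto_mono[OF S, of N "max N N'" f] ideal_upto_mono[OF S, of N' "max N N'" f]
      by (intro exI[of _ "max N N'"]) (auto simp: less_Suc_eq)
  qed simp
  have I_comb: "(\<Sum>i<n. c i * g i) \<in> I" if g: "\<forall>i<n. g i \<in> I" and c: "\<forall>i<n. c i \<in> ?S"
    for c g :: "nat \<Rightarrow> 'r" and n
  proof -
    obtain N where "\<forall>i<n. g i \<in> ideal_upto ?S f N" using I_upto[OF g] by blast
    then have "(\<Sum>i<n. c i * g i) \<in> ideal_upto ?S f N"
      using c by (intro ideal_upto_sum[OF S] ideal_upto_mult[OF S]) auto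
    then show ?thesis by (auto simp: I_def)
  qed
  define cand where
    "cand p n q \<longleftrightarrow> q \<in> polys_over R \<and> poly q x \<in> I \<and> poly q x \<notin> ideal_upto ?S (\<lambda>i. poly (p i) x) n"
    for p :: "nat \<Rightarrow> 'r poly" and n q
  \<comment> \<open>The degree is least among all polynomials whose value lies in \<open>I\<close>
    but not in the ideal of the earlier values. The contradiction will be a polynomial of smaller
    degree with the same property.\<close>
  define \<Phi> where "\<Phi> p n q \<longleftrightarrow> cand p n q \<and> (\<forall>q'. cand p n q' \<longrightarrow> degree q \<le> degree q')"
    for p :: "nat \<Rightarrow> 'r poly" and n q
  have "\<exists>p. \<forall>n. \<Phi> p n (p n)"
  proof (rule dependent_wellorder_choice)
    fix r :: "'r poly" and p p' :: "nat \<Rightarrow> 'r poly" and n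
    assume "\<And>i. i < n \<Longrightarrow> p i = p' i"
    then have "ideal_upto ?S (\<lambda>i. poly (p i) x) n = ideal_upto ?S (\<lambda>i. poly (p' i) x) n"
      by (auto simp: ideal_upto_def)
    then show "\<Phi> p n r = \<Phi> p' n r" by (simp add: \<Phi>_def cand_def)
  next
    fix n and p :: "nat \<Rightarrow> 'r poly"
    assume "\<And>i. i < n \<Longrightarrow> \<Phi> p i (p i)"
    then have "\<forall>i<n. poly (p i) x \<in> I" by (simp add: \<Phi>_def cand_def)
    from I_upto[OF this] obtain N where N: "\<forall>i<n. poly (p i) x \<in> ideal_upto ?S f N" by blast
    have "ideal_upto ?S (\<lambda>i. poly (p i) x) n \<subseteq> ideal_upto ?S f N"
      using N unfolding ideal_upto_def[of _ "\<lambda>i. poly (p i) x"]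
      by (auto intro!: ideal_upto_sum[OF S] ideal_upto_mult[OF S])
    then have "f N \<notin> ideal_upto ?S (\<lambda>i. poly (p i) x) n" using f(2) by blast
    moreover obtain q where "q \<in> polys_over R" "f N = poly q x" using f(1)[of N] by blast
    moreover have "f N \<in> I" using ideal_upto_base[OF S, of N "Suc N" f] by (auto simp: I_def)
    ultimately have "cand p n q" unfolding cand_def by simp
    from ex_has_least_nat[of "cand p n", OF this, of degree] show "\<exists>q. \<Phi> p n q"
      unfolding \<Phi>_def .
  qed
  then obtain p where p: "\<And>n. \<Phi> p n (p n)" by blast
  then have cand: "cand p n (p n)" and min: "cand p n q \<Longrightarrow> degree (p n) \<le> degree q" for n q
    by (auto simp: \<Phi>_def)
  have "\<forall>i. lead_coeff (p i) \<in> R" using cand by (auto simp: cand_def polys_over_def)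
  then obtain n where "lead_coeff (p n) \<in> ideal_upto R (\<lambda>i. lead_coeff (p i)) n"
    using noeth[unfolded noetherian_subring_def, THEN spec, of "\<lambda>i. lead_coeff (p i)"] by blast
  then obtain c where c: "\<And>i. c i \<in> R" "lead_coeff (p n) = (\<Sum>i<n. c i * lead_coeff (p i))"
    by (auto simp: ideal_upto_def)
  \<comment> \<open>The monomials lift the earlier polynomials to the degree of \<open>p n\<close>,
    so that the leading coefficients cancel in \<open>q\<close>.\<close>
  define h where "h i = monom (c i) (degree (p n) - degree (p i))" for i
  define q where "q = p n - (\<Sum>i<n. h i * p i)"
  have h: "h i \<in> polys_over R" for i
    using c subring_closedD(1)[OF R] by (auto simp: h_def polys_over_def)
  have deg: "degree (p i) \<le> degree (p n)" if "i < n" for i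
  proof (rule min)
    show "cand p i (p n)"
      using cand[of n] ideal_upto_mono[OF S, of i n] that by (auto simp: cand_def)
  qed
  have p_in: "p i \<in> polys_over R" for i using cand by (simp add: cand_def)
  have q_in: "q \<in> polys_over R"
    unfolding q_def by (intro subring_closedD[OF PR] subring_closed_sum[OF PR] h p_in)
  have poly_q: "poly q x = poly (p n) x - (\<Sum>i<n. poly (h i) x * poly (p i) x)"
    by (simp add: q_def poly_sum)
  let ?id = "ideal_upto ?S (\<lambda>i. poly (p i) x) n"
  have sum_in: "(\<Sum>i<n. poly (h i) x * poly (p i) x) \<in> ?id"
    using h by (auto simp: ideal_upto_def)
  have "poly q x \<notin> ?id"
  proof
    assume "poly q x \<in> ?id"
    from ideal_upto_add[OF S this sum_in] have "poly (p n) x \<in> ?id" by (simp add: poly_q)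
    then show False using cand[of n] by (simp add: cand_def)
  qed
  moreover have "poly q x \<in> I"
  proof -
    have "(\<Sum>i<Suc n. (if i = n then 1 else - poly (h i) x) * poly (p i) x) \<in> I"
    proof (rule I_comb)
      show "\<forall>i<Suc n. poly (p i) x \<in> I" using cand by (simp add: cand_def)
      show "\<forall>i<Suc n. (if i = n then 1 else - poly (h i) x) \<in> ?S"
        using subring_closedD(2,5)[OF S] h by auto
    qed
    then show ?thesis by (simp add: poly_q sum_negf)
  qed
  ultimately have cand_q: "cand p n q" using q_in by (simp add: cand_def)
  have "coeff q (degree (p n)) = 0"
    using deg by (simp add: q_def coeff_sum h_def coeff_monom_mult c(2)) (rule sum.cong, auto)
  moreover have "degree q \<le> degree (p n)"
    unfolding q_def
  proof (intro degree_diff_le degree_sum_le)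
    fix i assume "i \<in> {..<n}"
    then show "degree (h i * p i) \<le> degree (p n)"
      using degree_mult_le[of "h i" "p i"] degree_monom_le[of "c i" "degree (p n) - degree (p i)"] deg[of i]
      by (simp add: h_def)
  qed auto
  \<comment> \<open>If \<open>p n\<close> is constant, cancelling its top coefficient leaves only
    \<open>q = 0\<close>; this case is excluded because 0 lies in every ideal.\<close>
  ultimately have "q = 0 \<or> degree q < degree (p n)"
    by (metis leading_coeff_0_iff order_le_less)
  moreover have "q \<noteq> 0"
    using \<open>poly q x \<notin> ?id\<close> ideal_upto_zero[OF S] by auto
  ultimately show False using min[OF cand_q] by simp
qed

section \<open>The Noetherian property of rings of polynomial functions\<close>

lemma subring_closed_polyfuns: "subring_closed (polyfuns J :: (('j \<Rightarrow> 'k::field) \<Rightarrow> 'k) set)"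
proof -
  have "(0 :: ('j \<Rightarrow> 'k) \<Rightarrow> 'k) \<in> polyfuns J" "(1 :: ('j \<Rightarrow> 'k) \<Rightarrow> 'k) \<in> polyfuns J"
    unfolding zero_fun_def one_fun_def by (rule polyfuns.const)+
  moreover have "f + g \<in> polyfuns J" "f * g \<in> polyfuns J" "- f \<in> polyfuns J"
    if "f \<in> polyfuns J" "g \<in> polyfuns J" for f g :: "('j \<Rightarrow> 'k) \<Rightarrow> 'k"
    using that polyfuns_intros(2,3,6) by (auto simp: plus_fun_def times_fun_def fun_Compl_def)
  ultimately show ?thesis by (simp add: subring_closed_def)
qed

lemma polyfuns_insert:
  "polyfuns (insert j J) \<subseteq> (\<lambda>p. poly p (\<lambda>x. x j)) ` polys_over (polyfuns J :: (('j \<Rightarrow> 'k::field) \<Rightarrow> 'k) set)"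
    (is "_ \<subseteq> ?S")
proof
  have R: "subring_closed (polyfuns J :: (('j \<Rightarrow> 'k) \<Rightarrow> 'k) set)" by (rule subring_closed_polyfuns)
  note S = subring_closed_image_poly[OF R, of "\<lambda>x. x j"]
  have const_in: "f \<in> ?S" if "f \<in> polyfuns J" for f
    by (rule image_eqI[of _ _ "[:f:]"])
      (use that subring_closedD(1)[OF R] in \<open>auto simp: polys_over_def coeff_pCons split: nat.splits\<close>)
  fix f :: "('j \<Rightarrow> 'k) \<Rightarrow> 'k" assume "f \<in> polyfuns (insert j J)"
  then show "f \<in> ?S"
  proof induction
    case (const c)
    show ?case by (rule const_in) (rule polyfuns.const)
  next
    case (coord i)
    show ?case
    proof (cases "i = j")
      case True
      have "[:0, 1:] \<in> polys_over (polyfuns J :: (('j \<Rightarrow> 'k) \<Rightarrow> 'k) set)"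
        using subring_closedD(1,2)[OF R] by (auto simp: polys_over_def coeff_pCons split: nat.splits)
      then show ?thesis using True by (force intro!: image_eqI[of _ _ "[:0, 1:]"])
    next
      case False
      then show ?thesis using coord by (intro const_in polyfuns.coord) auto
    qed
  next
    case (add f g)
    then have "f + g \<in> ?S" using subring_closedD(3)[OF S] by blast
    then show ?case by (simp add: plus_fun_def)
  next
    case (mult f g)
    then have "f * g \<in> ?S" using subring_closedD(4)[OF S] by blast
    then show ?case by (simp add: times_fun_def)
  qed
qed

lemma polyfuns_mono: "J \<subseteq> J' \<Longrightarrow> polyfuns J \<subseteq> polyfuns J'"
proof
  fix f assume "J \<subseteq> J'" "f \<in> polyfuns J"
  from this(2,1) show "f \<in> polyfuns J'" by induction (auto intro: polyfuns.intros)
qed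

lemma polyfuns_insert_eq:
  "polyfuns (insert j J) = (\<lambda>p. poly p (\<lambda>x. x j)) ` polys_over (polyfuns J :: (('j \<Rightarrow> 'k::field) \<Rightarrow> 'k) set)"
proof (intro antisym polyfuns_insert subsetI)
  have R: "subring_closed (polyfuns (insert j J) :: (('j \<Rightarrow> 'k) \<Rightarrow> 'k) set)"
    by (rule subring_closed_polyfuns)
  fix f assume "f \<in> (\<lambda>p. poly p (\<lambda>x. x j)) ` polys_over (polyfuns J :: (('j \<Rightarrow> 'k) \<Rightarrow> 'k) set)"
  then obtain p where p: "f = poly p (\<lambda>x. x j)" "p \<in> polys_over (polyfuns J)" by blast
  have coord: "(\<lambda>x::'j \<Rightarrow> 'k. x j) \<in> polyfuns (insert j J)" by (rule polyfuns.coord) simp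
  have "(\<lambda>x::'j \<Rightarrow> 'k. x j) ^ i \<in> polyfuns (insert j J)" for i
    by (induction i) (simp_all only: power_0 power_Suc coord subring_closedD[OF R])
  moreover have "coeff p i \<in> polyfuns (insert j J)" for i
    using p polyfuns_mono[of J "insert j J"] by (auto simp: polys_over_def)
  ultimately show "f \<in> polyfuns (insert j J)"
    unfolding p(1) poly_altdef by (intro subring_closed_sum[OF R] subring_closedD[OF R])
qed

lemma polyfuns_empty: "polyfuns {} = range (\<lambda>c x. c)"
proof (intro antisym subsetI)
  show "f \<in> range (\<lambda>c x. c)" if "f \<in> polyfuns {}" for f
    using that by induction auto
qed (auto intro: polyfuns.const)

theorem noetherian_polyfuns:
  assumes "finite J"
  shows "noetherian_subring (polyfuns J :: (('j \<Rightarrow> 'k::field) \<Rightarrow> 'k) set)"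
  using assms
proof (induction J rule: finite_induct)
  case empty
  show ?case
    unfolding noetherian_subring_def
  proof (intro allI impI)
    fix f :: "nat \<Rightarrow> ('j \<Rightarrow> 'k) \<Rightarrow> 'k" assume f: "\<forall>i. f i \<in> polyfuns {}"
    \<comment> \<open>Over a field two terms decide: either \<open>f 0\<close> is zero, or it is a
      unit and \<open>f 1\<close> is a multiple of it.\<close>
    obtain a where a: "f 0 = (\<lambda>x. a)" using f unfolding polyfuns_empty by blast
    obtain b where b: "f 1 = (\<lambda>x. b)" using f unfolding polyfuns_empty by blast
    show "\<exists>n. f n \<in> ideal_upto (polyfuns {}) f n"
    proof (cases "a = 0")
      case True
      then have "f 0 = 0" using a by (simp add: zero_fun_def)
      then show ?thesis using ideal_upto_zero[OF subring_closed_polyfuns] by metis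
    next
      case False
      then have "f 1 = (\<lambda>x. b / a) * f 0" using a b by (auto simp: fun_eq_iff)
      moreover have "(\<lambda>x. b / a) * f 0 \<in> ideal_upto (polyfuns {}) f 1"
        by (intro ideal_upto_mult[OF subring_closed_polyfuns] ideal_upto_base[OF subring_closed_polyfuns]
            polyfuns.const) simp
      ultimately show ?thesis by metis
    qed
  qed
next
  case (insert j J)
  show ?case
    unfolding polyfuns_insert_eq by (rule Hilbert_basis[OF subring_closed_polyfuns insert.IH])
qed

section \<open>Irreducible sets\<close>

text \<open>Irreducibility tested on basic open sets only: two of them that meet \<open>Z\<close>
  meet inside \<open>Z\<close>. All later arguments use this form, which speaks of polynomial
  functions rather than of closed sets.\<close>

definition poly_irreducible :: "'j set \<Rightarrow> ('j \<Rightarrow> 'k::field) set \<Rightarrow> bool" where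
  "poly_irreducible J Z \<longleftrightarrow> Z \<noteq> {} \<and> (\<forall>P\<in>polyfuns J. \<forall>R\<in>polyfuns J.
     (\<exists>x\<in>Z. P x \<noteq> 0) \<longrightarrow> (\<exists>x\<in>Z. R x \<noteq> 0) \<longrightarrow> (\<exists>x\<in>Z. P x \<noteq> 0 \<and> R x \<noteq> 0))"

lemma poly_irreducibleD:
  assumes "poly_irreducible J Z" "P \<in> polyfuns J" "R \<in> polyfuns J" "x \<in> Z" "P x \<noteq> 0" "y \<in> Z" "R y \<noteq> 0"
  obtains z where "z \<in> Z" "P z \<noteq> 0" "R z \<noteq> 0"
  using assms unfolding poly_irreducible_def by blast

lemma topspace_zariski: "topspace (zariski J) = (affine_space J :: ('j \<Rightarrow> 'k::field) set)"
proof
  show "topspace (zariski J) \<subseteq> (affine_space J :: ('j \<Rightarrow> 'k) set)"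
    unfolding topspace_def by (auto simp: openin_zariski)
  have "openin (zariski J) (affine_space J :: ('j \<Rightarrow> 'k) set)"
    unfolding openin_zariski
    by (rule exI[of _ "{\<lambda>_. 1}"]) (auto simp: zero_locus_def intro: polyfuns.const)
  then show "affine_space J \<subseteq> topspace (zariski J :: ('j \<Rightarrow> 'k) topology)"
    by (rule openin_subset)
qed

lemma closedin_zariski: "closedin (zariski J) C \<longleftrightarrow> (\<exists>F \<subseteq> polyfuns J. C = zero_locus J F)"
proof -
  have "zero_locus J F \<subseteq> affine_space J" for F :: "(('a \<Rightarrow> 'b) \<Rightarrow> 'b) set"
    by (auto simp: zero_locus_def)
  then show ?thesis
    unfolding closedin_def topspace_zariski openin_zariski by (metis double_diff order_refl)
qed

text \<open>A closed set is an intersection of zero sets of single functions, so a point outside it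
  is already separated from it by one polynomial function.\<close>

lemma irreducible_in_zariski_iff:
  assumes X: "X \<subseteq> affine_space J"
  shows "irreducible_in (subtopology (zariski J) X) Z \<longleftrightarrow> Z \<subseteq> X \<and> poly_irreducible J Z"
proof -
  have top: "topspace (subtopology (zariski J) X) = X"
    using X by (auto simp: topspace_subtopology topspace_zariski)
  show ?thesis
  proof (intro iffI conjI)
    assume irr: "irreducible_in (subtopology (zariski J) X) Z"
    then show ZX: "Z \<subseteq> X" by (simp add: irreducible_in_def top)
    show "poly_irreducible J Z"
      unfolding poly_irreducible_def
    proof (intro conjI ballI impI)
      show "Z \<noteq> {}" using irr by (simp add: irreducible_in_def)
      fix P R assume P: "P \<in> polyfuns J" "R \<in> polyfuns J" and ex: "\<exists>x\<in>Z. P x \<noteq> 0" "\<exists>x\<in>Z. R x \<noteq> 0"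
      have cl: "closedin (subtopology (zariski J) X) (zero_locus J {F} \<inter> X)" if "F \<in> polyfuns J" for F
        unfolding closedin_subtopology closedin_zariski using that by (intro exI conjI refl) auto
      show "\<exists>x\<in>Z. P x \<noteq> 0 \<and> R x \<noteq> 0"
      proof (rule ccontr)
        assume "\<not> ?thesis"
        then have "Z \<subseteq> (zero_locus J {P} \<inter> X) \<union> (zero_locus J {R} \<inter> X)"
          using ZX X by (auto simp: zero_locus_def)
        then have "Z \<subseteq> zero_locus J {P} \<inter> X \<or> Z \<subseteq> zero_locus J {R} \<inter> X"
          using irr cl[OF P(1)] cl[OF P(2)] unfolding irreducible_in_def by blast
        then show False using ex by (auto simp: zero_locus_def)
      qed
    qed
  next
    assume Z: "Z \<subseteq> X \<and> poly_irreducible J Z"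
    show "irreducible_in (subtopology (zariski J) X) Z"
      unfolding irreducible_in_def top
    proof (intro conjI allI impI)
      show "Z \<subseteq> X" using Z by simp
      show "Z \<noteq> {}" using Z by (simp add: poly_irreducible_def)
      fix C D assume CD: "closedin (subtopology (zariski J) X) C \<and> closedin (subtopology (zariski J) X) D \<and> Z \<subseteq> C \<union> D"
      then obtain F G where F: "F \<subseteq> polyfuns J" "C = zero_locus J F \<inter> X"
        and G: "G \<subseteq> polyfuns J" "D = zero_locus J G \<inter> X"
        unfolding closedin_subtopology closedin_zariski by blast
      show "Z \<subseteq> C \<or> Z \<subseteq> D"
      proof (rule ccontr)
        assume "\<not> (Z \<subseteq> C \<or> Z \<subseteq> D)"
        then obtain x y where "x \<in> Z" "x \<notin> C" "y \<in> Z" "y \<notin> D" by blast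
        then obtain P R where "P \<in> F" "P x \<noteq> 0" "R \<in> G" "R y \<noteq> 0"
          using Z X F(2) G(2) unfolding zero_locus_def by blast
        obtain z where "z \<in> Z" "P z \<noteq> 0" "R z \<noteq> 0"
          by (rule poly_irreducibleD[of J Z P R x y])
            (use Z F(1) G(1) \<open>x \<in> Z\<close> \<open>y \<in> Z\<close> \<open>P \<in> F\<close> \<open>R \<in> G\<close> \<open>P x \<noteq> 0\<close> \<open>R y \<noteq> 0\<close> in auto)
        then have "z \<notin> C" "z \<notin> D" using F G \<open>P \<in> F\<close> \<open>R \<in> G\<close> by (auto simp: zero_locus_def)
        then show False using CD \<open>z \<in> Z\<close> by blast
      qed
    qed
  qed
qed

lemma irreducible_component_of_zariski:
  assumes X: "X \<subseteq> affine_space J" and Z: "irreducible_component_of (subtopology (zariski J) X) Z"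
  shows "Z \<subseteq> X" "poly_irreducible J Z" "S \<subseteq> X \<Longrightarrow> poly_irreducible J S \<Longrightarrow> Z \<subseteq> S \<Longrightarrow> S = Z"
  using Z unfolding irreducible_component_of_def irreducible_in_zariski_iff[OF X] by blast+

text \<open>Zorn's lemma. The union of a chain of irreducible sets is irreducible because the two
  points at which \<open>P\<close> and \<open>R\<close> do not vanish lie in one member of the
  chain.\<close>

lemma irreducible_component_exists:
  assumes X: "X \<subseteq> affine_space J" and S: "S \<subseteq> X" "poly_irreducible J S"
  obtains Z where "irreducible_component_of (subtopology (zariski J) X) Z" "S \<subseteq> Z"
proof -
  define \<A> where "\<A> = {Z. S \<subseteq> Z \<and> Z \<subseteq> X \<and> poly_irreducible J Z}"
  have "\<exists>Z\<in>\<A>. \<forall>Y\<in>\<A>. Z \<subseteq> Y \<longrightarrow> Y = Z"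
  proof (rule subset_Zorn_nonempty)
    show "\<A> \<noteq> {}" using S by (auto simp: \<A>_def)
    fix \<C> assume \<C>: "\<C> \<noteq> {}" "subset.chain \<A> \<C>"
    then have A: "\<C> \<subseteq> \<A>" and chain: "\<And>U V. U \<in> \<C> \<Longrightarrow> V \<in> \<C> \<Longrightarrow> U \<subseteq> V \<or> V \<subseteq> U"
      by (auto simp: subset_chain_def)
    have "poly_irreducible J (\<Union>\<C>)"
      unfolding poly_irreducible_def
    proof (intro conjI ballI impI)
      obtain U where "U \<in> \<C>" using \<C>(1) by blast
      moreover have "U \<noteq> {}" using A \<open>U \<in> \<C>\<close> by (auto simp: \<A>_def poly_irreducible_def)
      ultimately show "\<Union>\<C> \<noteq> {}" by blast
      fix P R assume PR: "P \<in> polyfuns J" "R \<in> polyfuns J" and "\<exists>x\<in>\<Union>\<C>. P x \<noteq> 0" "\<exists>x\<in>\<Union>\<C>. R x \<noteq> 0"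
      then obtain U V x y where U: "U \<in> \<C>" "x \<in> U" "P x \<noteq> 0" and V: "V \<in> \<C>" "y \<in> V" "R y \<noteq> 0" by blast
      define W where "W = (if U \<subseteq> V then V else U)"
      have W: "W \<in> \<C>" "x \<in> W" "y \<in> W" using U V chain[of U V] by (auto simp: W_def)
      then have "poly_irreducible J W" using A by (auto simp: \<A>_def)
      from poly_irreducibleD[OF this PR W(2) U(3) W(3) V(3)] show "\<exists>x\<in>\<Union>\<C>. P x \<noteq> 0 \<and> R x \<noteq> 0"
        using W(1) by blast
    qed
    then show "\<Union>\<C> \<in> \<A>" using \<C>(1) A by (auto simp: \<A>_def)
  qed
  then obtain Z where Z: "Z \<in> \<A>" and max: "\<And>Y. Y \<in> \<A> \<Longrightarrow> Z \<subseteq> Y \<Longrightarrow> Y = Z" by blast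
  show ?thesis
  proof (rule that)
    show "irreducible_component_of (subtopology (zariski J) X) Z"
      unfolding irreducible_component_of_def irreducible_in_zariski_iff[OF X]
      using Z max order_trans[of S Z] unfolding \<A>_def by blast
    show "S \<subseteq> Z" using Z by (simp add: \<A>_def)
  qed
qed

text \<open>Otherwise the zero set of \<open>P\<close> in \<open>Z\<close> would be closed in
  \<open>Z\<close> and contain \<open>B\<close> but not \<open>x\<close>.\<close>

lemma dense_subset_nonvanishing:
  assumes X: "X \<subseteq> affine_space J" "Z \<subseteq> X" and B: "B \<subseteq> Z"
    and dense: "subtopology (subtopology (zariski J) X) Z closure_of B = Z"
    and P: "P \<in> polyfuns J" "x \<in> Z" "P x \<noteq> 0"
  obtains y where "y \<in> B" "P y \<noteq> 0"
proof (rule ccontr)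
  assume "\<not> thesis"
  then have B_sub: "B \<subseteq> zero_locus J {P} \<inter> (X \<inter> Z)"
    using that B X by (auto simp: zero_locus_def)
  have "closedin (subtopology (subtopology (zariski J) X) Z) (zero_locus J {P} \<inter> (X \<inter> Z))"
    unfolding subtopology_subtopology closedin_subtopology closedin_zariski
    using P by (intro exI conjI refl) auto
  from closure_of_minimal[OF B_sub this] show False
    using dense P by (auto simp: zero_locus_def)
qed

text \<open>An infinite set \<open>S\<close> without infinite irreducible subset could be cut down for ever by polynomial
  functions \<open>f 0, f 1, \<dots>\<close>, where \<open>f n\<close> does not vanish on the common zeros of its predecessors.\<close>

lemma infinite_irreducible_subset:
  assumes J: "finite J" and E: "infinite E"
  obtains S where "S \<subseteq> E" "infinite S" "poly_irreducible J (S :: ('j \<Rightarrow> 'k::field) set)"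
proof (rule ccontr)
  assume "\<not> thesis"
  then have nirr: "\<not> poly_irreducible J S" if "S \<subseteq> E" "infinite S" for S
    using that \<open>\<And>S. S \<subseteq> E \<Longrightarrow> infinite S \<Longrightarrow> poly_irreducible J S \<Longrightarrow> thesis\<close> by blast
  have "\<exists>f\<in>polyfuns J. (\<exists>x\<in>S. f x \<noteq> 0) \<and> infinite {x \<in> S. f x = 0}" if S: "S \<subseteq> E" "infinite S" for S
  proof -
    obtain P R where PR: "P \<in> polyfuns J" "R \<in> polyfuns J" "\<exists>x\<in>S. P x \<noteq> 0" "\<exists>x\<in>S. R x \<noteq> 0"
      and zero: "\<And>x. x \<in> S \<Longrightarrow> P x = 0 \<or> R x = 0"
      using nirr[OF S] S(2) unfolding poly_irreducible_def by auto
    have "S = {x \<in> S. P x = 0} \<union> {x \<in> S. R x = 0}" using zero by blast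
    then have "infinite {x \<in> S. P x = 0} \<or> infinite {x \<in> S. R x = 0}"
      using S(2) finite_UnI[of "{x \<in> S. P x = 0}" "{x \<in> S. R x = 0}"] by auto
    then show ?thesis using PR by blast
  qed
  then have "\<forall>S\<in>{S. S \<subseteq> E \<and> infinite S}.
      \<exists>f. f \<in> polyfuns J \<and> (\<exists>x\<in>S. f x \<noteq> 0) \<and> infinite {x \<in> S. f x = 0}"
    by blast
  from bchoice[OF this] obtain F where F: "\<And>S. S \<subseteq> E \<Longrightarrow> infinite S \<Longrightarrow>
      F S \<in> polyfuns J \<and> (\<exists>x\<in>S. F S x \<noteq> 0) \<and> infinite {x \<in> S. F S x = 0}"
    by blast
  define S where "S = rec_nat E (\<lambda>_ S. {x \<in> S. F S x = 0})"
  define f where "f n = F (S n)" for n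
  have S: "S n \<subseteq> E \<and> infinite (S n)" for n
    by (induction n) (use E F in \<open>auto simp: S_def\<close>)
  have S_Suc: "S (Suc n) = {x \<in> S n. f n x = 0}" for n by (simp add: S_def f_def)
  have f: "f n \<in> polyfuns J" "\<exists>x\<in>S n. f n x \<noteq> 0" for n using F S by (simp_all add: f_def)
  have vanish: "i < n \<Longrightarrow> x \<in> S n \<Longrightarrow> f i x = 0" for i n x
    by (induction n) (auto simp: S_Suc less_Suc_eq)
  obtain n where "f n \<in> ideal_upto (polyfuns J) f n"
    using noetherian_polyfuns[OF J, unfolded noetherian_subring_def, THEN spec, of f] f(1) by blast
  then obtain c where "f n = (\<Sum>i<n. c i * f i)" by (auto simp: ideal_upto_def)
  moreover have "(\<Sum>i\<in>A. h i) x = (\<Sum>i\<in>A. h i x)" for A and h :: "nat \<Rightarrow> ('j \<Rightarrow> 'k) \<Rightarrow> 'k" and x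
    by (induction A rule: infinite_finite_induct) auto
  ultimately have "f n x = (\<Sum>i<n. c i x * f i x)" for x by simp
  then have "f n x = 0" if "x \<in> S n" for x using vanish[OF _ that] by simp
  then show False using f(2) by blast
qed

text \<open>If the field were finite, the product of all \<open>X - a\<close>, plus 1, would be a
  non-constant polynomial without roots.\<close>

lemma infinite_alg_closed_field: "infinite (UNIV :: 'k::alg_closed_field set)"
proof
  assume fin: "finite (UNIV :: 'k set)"
  define p where "p = (\<Prod>a\<in>(UNIV :: 'k set). [:- a, 1:]) + 1"
  have "degree (\<Prod>a\<in>(UNIV :: 'k set). [:- a, 1:]) = card (UNIV :: 'k set)"
    by (subst degree_prod_eq_sum_degree) auto
  moreover have "card (UNIV :: 'k set) > 0" using fin by (simp add: card_gt_0_iff)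
  ultimately have "degree p > 0"
    unfolding p_def by (subst degree_add_eq_left) auto
  then obtain x where "poly p x = 0" using alg_closed_imp_poly_has_root by blast
  moreover have "poly (\<Prod>a\<in>(UNIV :: 'k set). [:- a, 1:]) x = 0"
    using fin by (simp add: poly_prod)
  ultimately show False by (simp add: p_def)
qed

text \<open>Irreducibility of affine space: on the line through \<open>x\<close> and
  \<open>y\<close> both functions become non-zero polynomials in one variable, and their product has
  finitely many roots in an infinite field.\<close>

lemma polyfuns_common_nonzero:
  fixes P R :: "('j \<Rightarrow> 'k::alg_closed_field) \<Rightarrow> 'k"
  assumes P: "P \<in> polyfuns J" "P x \<noteq> 0" and R: "R \<in> polyfuns J" "R y \<noteq> 0"
  obtains z where "P z \<noteq> 0" "R z \<noteq> 0"
proof -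
  define l where "l t = (\<lambda>j. (1 - t) * x j + t * y j)" for t :: 'k
  have line: "\<exists>p. \<forall>t. poly p t = f (l t)" if "f \<in> polyfuns J" for f
    using that
  proof induction
    case (const c) then show ?case by (intro exI[of _ "[:c:]"]) simp
  next
    case (coord j) then show ?case
      by (intro exI[of _ "[:x j, y j - x j:]"]) (simp add: l_def algebra_simps)
  next
    case (add f g) then show ?case by (metis poly_add)
  next
    case (mult f g) then show ?case by (metis poly_mult)
  qed
  obtain p where p: "\<And>t. poly p t = P (l t)" using line[OF P(1)] by blast
  obtain r where r: "\<And>t. poly r t = R (l t)" using line[OF R(1)] by blast
  have "poly p 0 \<noteq> 0" "poly r 1 \<noteq> 0" using P(2) R(2) by (simp_all add: p r l_def)
  then have "p * r \<noteq> 0" by auto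
  then have "finite {t. poly (p * r) t = 0}" by (rule poly_roots_finite)
  then obtain t where "poly (p * r) t \<noteq> 0"
    using infinite_alg_closed_field[where 'k = 'k] by (metis (mono_tags, lifting) Collect_cong UNIV_def mem_Collect_eq)
  then show ?thesis by (intro that[of "l t"]) (auto simp: p r)
qed

section \<open>Linear maps on subspaces\<close>

interpretation fam_pair: vector_space_pair "fscale :: 'k::field \<Rightarrow> ('i \<Rightarrow> 'k) \<Rightarrow> _" "fscale :: 'k \<Rightarrow> ('j \<Rightarrow> 'k) \<Rightarrow> _"
  by unfold_locales

text \<open>Linearity is relative to a set because elements of \<open>Hom\<close> are extended by
  zero outside their source and are not linear on the whole function space.\<close>

definition linear_on :: "('i \<Rightarrow> 'k::field) set \<Rightarrow> (('i \<Rightarrow> 'k) \<Rightarrow> 'j \<Rightarrow> 'k) \<Rightarrow> bool" where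
  "linear_on W f \<longleftrightarrow> (\<forall>v\<in>W. \<forall>w\<in>W. f (v + w) = f v + f w) \<and> (\<forall>c. \<forall>v\<in>W. f (fscale c v) = fscale c (f v))"

definition finite_dim :: "('i \<Rightarrow> 'k::field) set \<Rightarrow> bool" where
  "finite_dim W \<longleftrightarrow> (\<exists>S. finite S \<and> W \<subseteq> fam.span S)"

lemma linear_on_subset: "linear_on W f \<Longrightarrow> V \<subseteq> W \<Longrightarrow> linear_on V f"
  unfolding linear_on_def by blast

lemma finite_dim_subset: "finite_dim W \<Longrightarrow> V \<subseteq> W \<Longrightarrow> finite_dim V"
  unfolding finite_dim_def by blast

lemma linear_on_zero:
  assumes "fam.subspace W" "linear_on W f"
  shows "f 0 = 0"
  using assms fam.subspace_0[OF assms(1)] unfolding linear_on_def by (metis fam.scale_zero_left)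

lemma linear_on_sum:
  assumes "fam.subspace W" "linear_on W f" "\<And>i. i \<in> A \<Longrightarrow> v i \<in> W"
  shows "f (\<Sum>i\<in>A. v i) = (\<Sum>i\<in>A. f (v i))"
  using assms(3)
proof (induction A rule: infinite_finite_induct)
  case (insert i A)
  then have "f (v i + sum v A) = f (v i) + f (sum v A)"
    using assms(2) fam.subspace_sum[OF assms(1), of A v] unfolding linear_on_def by blast
  then show ?case using insert by (simp del: plus_fun_apply)
qed (simp_all add: linear_on_zero[OF assms(1,2)] del: zero_fun_apply)

text \<open>Makes the theory of globally defined linear maps available for maps that are linear only
  on \<open>W\<close>.\<close>

lemma linear_on_extend:
  assumes W: "fam.subspace W" and f: "linear_on W f"
  obtains g where "Vector_Spaces.linear fscale fscale g" "\<And>v. v \<in> W \<Longrightarrow> g v = f v"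
proof -
  obtain B where B: "B \<subseteq> W" "fam.independent B" "W \<subseteq> fam.span B"
    using fam.maximal_independent_subset by blast
  obtain g where g: "Vector_Spaces.linear fscale fscale g" "\<forall>b\<in>B. g b = f b"
    using fam_pair.linear_independent_extend[OF B(2), of f] by blast
  interpret g: Vector_Spaces.linear fscale fscale g by (rule g(1))
  have "v \<in> W \<and> g v = f v" if "v \<in> fam.span B" for v
    using that
  proof (induction rule: fam.span_induct_alt)
    case base
    then show ?case using linear_on_zero[OF W f] fam.subspace_0[OF W] by (simp add: g.zero del: zero_fun_apply)
  next
    case (step c b v)
    then show ?case
      using f B(1) g(2) fam.subspace_add[OF W] fam.subspace_scale[OF W]
      unfolding linear_on_def by (auto simp: g.add g.scale simp del: plus_fun_apply)
  qed
  then show ?thesis using that[OF g(1)] B(3) by blast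
qed

lemma finite_independent_subset:
  assumes "finite_dim W" "fam.independent B" "B \<subseteq> W"
  shows "finite B"
  using assms fam.independent_span_bound unfolding finite_dim_def by (meson order_trans)

lemma independent_card_le:
  assumes "finite_dim W" "fam.independent B" "B \<subseteq> W"
  shows "card B \<le> fam.dim W"
proof -
  obtain C where C: "C \<subseteq> W" "fam.independent C" "W \<subseteq> fam.span C" "card C = fam.dim W"
    using fam.basis_exists by blast
  show ?thesis
    using fam.independent_span_bound[OF finite_independent_subset[OF assms(1) C(2,1)] assms(2)] assms(3) C(3,4)
    by auto
qed

lemma subspace_linear_on_image:
  assumes "fam.subspace W" "linear_on W f"
  shows "fam.subspace (f ` W)"
proof -
  obtain g where g: "Vector_Spaces.linear fscale fscale g" "\<And>v. v \<in> W \<Longrightarrow> g v = f v"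
    using linear_on_extend[OF assms(1,2)] by blast
  interpret g: Vector_Spaces.linear fscale fscale g by (rule g(1))
  show ?thesis using g.subspace_image[OF assms(1)] g(2) by (metis image_cong)
qed

lemma dim_image_le:
  assumes W: "fam.subspace W" "finite_dim W" and f: "linear_on W f"
  shows "fam.dim (f ` W) \<le> fam.dim W"
proof -
  obtain g where g: "Vector_Spaces.linear fscale fscale g" "\<And>v. v \<in> W \<Longrightarrow> g v = f v"
    using linear_on_extend[OF W(1) f] by blast
  interpret g: Vector_Spaces.linear fscale fscale g by (rule g(1))
  obtain B where B: "B \<subseteq> W" "fam.independent B" "W \<subseteq> fam.span B" "card B = fam.dim W"
    using fam.basis_exists by blast
  have "finite B" using finite_independent_subset[OF W(2) B(2,1)] .
  moreover have "f ` W \<subseteq> fam.span (g ` B)"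
    using g.spans_image[OF B(3)] g(2) by (metis image_cong)
  ultimately have "fam.dim (f ` W) \<le> card (g ` B)" by (intro fam.dim_le_card) auto
  then show ?thesis using card_image_le[OF \<open>finite B\<close>, of g] B(4) by linarith
qed

text \<open>A basis of \<open>W\<close> that contains \<open>v\<close> spans the image already
  without \<open>v\<close>.\<close>

lemma dim_image_less:
  assumes W: "fam.subspace W" "finite_dim W" and f: "linear_on W f"
    and v: "v \<in> W" "v \<noteq> 0" "f v = 0"
  shows "fam.dim (f ` W) < fam.dim W"
proof -
  obtain g where g: "Vector_Spaces.linear fscale fscale g" "\<And>v. v \<in> W \<Longrightarrow> g v = f v"
    using linear_on_extend[OF W(1) f] by blast
  interpret g: Vector_Spaces.linear fscale fscale g by (rule g(1))
  have "fam.independent {v}" using v by simp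
  then obtain B where B: "{v} \<subseteq> B" "B \<subseteq> W" "fam.independent B" "W \<subseteq> fam.span B"
    using fam.maximal_independent_subset_extend[of "{v}" W] v by blast
  have fin: "finite B" using finite_independent_subset[OF W(2) B(3,2)] .
  have card: "card B = fam.dim W" using fam.basis_card_eq_dim[OF B(2,4,3)] .
  have "f ` W \<subseteq> fam.span (g ` B)"
    using g.spans_image[OF B(4)] g(2) by (metis image_cong)
  also have "g ` B = insert 0 (g ` (B - {v}))"
    using B(1) v g(2)[OF v(1)] by (metis image_insert insert_Diff insert_subset)
  finally have "f ` W \<subseteq> fam.span (g ` (B - {v}))" by simp
  then have "fam.dim (f ` W) \<le> card (g ` (B - {v}))" using fin by (intro fam.dim_le_card) auto
  also have "\<dots> \<le> card (B - {v})" using fin by (intro card_image_le) auto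
  also have "\<dots> < card B" using fin B(1) by (intro card_Diff1_less) auto
  finally show ?thesis using card by simp
qed

text \<open>A vector outside the image, added to the image of a basis, would give an independent
  subset of \<open>W\<close> with more than \<open>fam.dim W\<close> elements.\<close>

lemma injective_endo_surjective:
  assumes W: "fam.subspace W" "finite_dim W" and f: "linear_on W f" "f ` W \<subseteq> W"
    and inj: "\<And>v. v \<in> W \<Longrightarrow> f v = 0 \<Longrightarrow> v = 0"
  shows "f ` W = W"
proof (rule ccontr)
  assume "f ` W \<noteq> W"
  then obtain w where w: "w \<in> W" "w \<notin> f ` W" using f(2) by blast
  obtain g where g: "Vector_Spaces.linear fscale fscale g" "\<And>v. v \<in> W \<Longrightarrow> g v = f v"
    using linear_on_extend[OF W(1) f(1)] by blast
  interpret g: Vector_Spaces.linear fscale fscale g by (rule g(1))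
  obtain B where B: "B \<subseteq> W" "fam.independent B" "W \<subseteq> fam.span B" "card B = fam.dim W"
    using fam.basis_exists by blast
  have fin: "finite B" using finite_independent_subset[OF W(2) B(2,1)] .
  have span: "fam.span B = W" using fam.span_subspace[OF B(1,3) W(1)] .
  have "inj_on g W"
    using g.inj_on_iff_eq_0[OF W(1)] inj g(2) by metis
  then have ind: "fam.independent (g ` B)" and card: "card (g ` B) = card B"
    using g.independent_injective_image[OF B(2)] span inj_on_subset[OF _ B(1)] card_image by auto
  have "fam.span (g ` B) = f ` W"
    using g.span_image[of B] span g(2) by (metis image_cong)
  then have "fam.independent (insert w (g ` B))" "w \<notin> g ` B"
    using w(2) ind fam.independent_insertI[of w "g ` B"] fam.span_base[of w "g ` B"] by auto
  moreover have "insert w (g ` B) \<subseteq> W" using w(1) f(2) B(1) g(2) by auto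
  ultimately have "card (insert w (g ` B)) \<le> fam.dim W"
    using independent_card_le[OF W(2)] by blast
  then show False using \<open>w \<notin> g ` B\<close> card B(4) fin by simp
qed

text \<open>A non-zero polynomial of least degree that annihilates \<open>v\<close> under
  \<open>g\<close> has a root \<open>a\<close>. After dividing by \<open>X - a\<close>, the cofactor
  sends \<open>v\<close> to a non-zero vector, by minimality, and this is an eigenvector for
  \<open>a\<close>.\<close>

lemma eigenvector_exists:
  fixes W :: "('i \<Rightarrow> 'k::alg_closed_field) set"
  assumes W: "fam.subspace W" "finite_dim W" "W \<noteq> {0}" and g: "linear_on W g" "g ` W \<subseteq> W"
  obtains c v where "v \<in> W" "v \<noteq> 0" "g v = fscale c v"
proof -
  obtain v where v: "v \<in> W" "v \<noteq> 0" using W(3) fam.subspace_0[OF W(1)] by blast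
  \<comment> \<open>This is the polynomial \<open>p\<close> evaluated at \<open>g\<close> and
    applied to the fixed vector \<open>v\<close>.\<close>
  define op where "op p = (\<Sum>i\<le>degree p. fscale (coeff p i) ((g ^^ i) v))" for p :: "'k poly"
  have pow: "(g ^^ i) v \<in> W" for i by (induction i) (use v g in auto)
  have op_eq: "op p = (\<Sum>i\<le>n. fscale (coeff p i) ((g ^^ i) v))" if "degree p \<le> n" for p n
    unfolding op_def using that by (intro sum.mono_neutral_left) (auto simp: coeff_eq_0)
  have op_W: "op p \<in> W" for p
    unfolding op_def by (intro fam.subspace_sum[OF W(1)] fam.subspace_scale[OF W(1)] pow)
  have op_linear: "op ([:- a, 1:] * q) = g (op q) - fscale a (op q)" for a q
  proof -
    define n where "n = degree q"
    have "g (op q) = (\<Sum>i\<le>n. g (fscale (coeff q i) ((g ^^ i) v)))"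
      unfolding op_def n_def using pow
      by (intro linear_on_sum[OF W(1) g(1)] fam.subspace_scale[OF W(1)])
    also have "\<dots> = (\<Sum>i\<le>n. fscale (coeff q i) ((g ^^ Suc i) v))"
      using g(1) pow by (simp add: linear_on_def)
    also have "\<dots> = (\<Sum>i\<le>Suc n. fscale (coeff (pCons 0 q) i) ((g ^^ i) v))"
      by (subst sum.atMost_Suc_shift) simp
    finally have 1: "g (op q) = \<dots>" .
    have 2: "fscale a (op q) = (\<Sum>i\<le>Suc n. fscale (a * coeff q i) ((g ^^ i) v))"
      using op_eq[of q "Suc n"] by (simp add: n_def fam.scale_sum_right fam.scale_right_distrib)
    have "degree ([:- a, 1:] * q) \<le> Suc n"
      using degree_mult_le[of "[:- a, 1:]" q] by (simp add: n_def)
    moreover have "[:- a, 1:] * q = pCons 0 q - smult a q" by simp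
    ultimately show ?thesis
      using op_eq[of "[:- a, 1:] * q" "Suc n"] unfolding 1 2 sum_subtractf[symmetric]
      by (simp add: fam.scale_left_diff_distrib)
  qed
  \<comment> \<open>The first \<open>card S + 1\<close> iterates of \<open>v\<close> lie in the span
    of \<open>card S\<close> vectors, so they cannot be independent.\<close>
  have "\<exists>p. p \<noteq> 0 \<and> op p = 0"
  proof (rule ccontr)
    assume "\<not> ?thesis"
    then have op_inj: "p = 0" if "op p = 0" for p using that by blast
    obtain S where S: "finite S" "W \<subseteq> fam.span S" using W(2) by (auto simp: finite_dim_def)
    have op_sum: "op (\<Sum>i\<le>N. monom (c i) i) = (\<Sum>i\<le>N. fscale (c i) ((g ^^ i) v))" for c N
    proof -
      have "degree (\<Sum>i\<le>N. monom (c i) i) \<le> N"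
        by (intro degree_sum_le) (auto intro: order_trans[OF degree_monom_le])
      from op_eq[OF this] show ?thesis by (simp add: coeff_sum)
    qed
    have coeffs: "c i = 0" if "(\<Sum>i\<le>N. fscale (c i) ((g ^^ i) v)) = 0" "i \<le> N" for c i N
    proof -
      have "(\<Sum>i\<le>N. monom (c i) i) = 0" using op_inj op_sum that(1) by metis
      then have "coeff (\<Sum>i\<le>N. monom (c i) i) i = 0" by simp
      then show ?thesis using that(2) by (simp add: coeff_sum)
    qed
    let ?N = "card S" let ?b = "\<lambda>i. (g ^^ i) v"
    \<comment> \<open>Independence is a property of sets, so coincidences among the iterates are
      excluded first: two equal iterates would give the relation with coefficients 1 and -1.\<close>
    have inj: "inj_on ?b {..?N}"
    proof (rule inj_onI, rule ccontr)
      fix i j assume ij: "i \<in> {..?N}" "j \<in> {..?N}" "?b i = ?b j" "i \<noteq> j"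
      define c :: "nat \<Rightarrow> 'k" where "c l = (if l = i then 1 else if l = j then - 1 else 0)" for l
      have "(\<Sum>l\<le>?N. fscale (c l) (?b l)) = (\<Sum>l\<in>{i, j}. fscale (c l) (?b l))"
        using ij by (intro sum.mono_neutral_right) (auto simp: c_def)
      also have "\<dots> = 0" using ij by (simp add: c_def)
      finally have "c i = 0" using coeffs ij by blast
      then show False by (simp add: c_def)
    qed
    have "fam.independent (?b ` {..?N})"
    proof
      assume "fam.dependent (?b ` {..?N})"
      then obtain u where u: "\<exists>w\<in>?b ` {..?N}. u w \<noteq> 0" "(\<Sum>w\<in>?b ` {..?N}. fscale (u w) w) = 0"
        using fam.dependent_finite[of "?b ` {..?N}"] by blast
      from u(2) have "(\<Sum>i\<le>?N. fscale (u (?b i)) (?b i)) = 0"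
        by (simp add: sum.reindex[OF inj])
      from coeffs[OF this] show False using u(1) by blast
    qed
    moreover have "?b ` {..?N} \<subseteq> fam.span S" using pow S(2) by blast
    ultimately have "card (?b ` {..?N}) \<le> ?N" using fam.independent_span_bound[OF S(1)] by blast
    then show False by (simp add: card_image[OF inj])
  qed
  then obtain p where p: "p \<noteq> 0" "op p = 0" and min: "\<And>q. q \<noteq> 0 \<Longrightarrow> op q = 0 \<Longrightarrow> degree p \<le> degree q"
    using ex_has_least_nat[of "\<lambda>p. p \<noteq> 0 \<and> op p = 0" _ degree] by blast
  have "degree p > 0"
  proof (rule ccontr)
    assume "\<not> degree p > 0"
    then obtain a where a: "p = [:a:]" "a \<noteq> 0" using p(1) by (metis degree_eq_zeroE neq0_conv pCons_eq_0_iff)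
    then have "op p = fscale a v" by (simp add: op_def)
    then show False using p(2) a v by simp
  qed
  then obtain a where "poly p a = 0" using alg_closed_imp_poly_has_root by blast
  then obtain q where q: "p = [:- a, 1:] * q" unfolding poly_eq_0_iff_dvd by blast
  have "q \<noteq> 0" using p(1) q by auto
  then have "degree p = Suc (degree q)" unfolding q by (subst degree_mult_eq) auto
  then have "op q \<noteq> 0" using min[OF \<open>q \<noteq> 0\<close>] by auto
  moreover have "g (op q) = fscale a (op q)" using p(2) op_linear[of a q] q by simp
  ultimately show ?thesis using that[OF op_W] by blast
qed

section \<open>Homomorphisms and bricks\<close>

lemma left_moduleD:
  assumes "left_module scl M"
  shows "fam.subspace (mod_space M)" "v \<in> mod_space M \<Longrightarrow> mod_act M a v \<in> mod_space M"
    "v \<in> mod_space M \<Longrightarrow> w \<in> mod_space M \<Longrightarrow> mod_act M a (v + w) = mod_act M a v + mod_act M a w"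
    "v \<in> mod_space M \<Longrightarrow> mod_act M (a + b) v = mod_act M a v + mod_act M b v"
    "v \<in> mod_space M \<Longrightarrow> mod_act M (a * b) v = mod_act M a (mod_act M b v)"
    "v \<in> mod_space M \<Longrightarrow> mod_act M 1 v = v"
    "v \<in> mod_space M \<Longrightarrow> mod_act M (scl c 1) v = fscale c v"
  using assms unfolding left_module_def by auto

lemma HomD:
  assumes "f \<in> Hom M N"
  shows "v \<in> mod_space M \<Longrightarrow> f v \<in> mod_space N" "v \<notin> mod_space M \<Longrightarrow> f v = 0"
    "v \<in> mod_space M \<Longrightarrow> w \<in> mod_space M \<Longrightarrow> f (v + w) = f v + f w"
    "v \<in> mod_space M \<Longrightarrow> f (mod_act M a v) = mod_act N a (f v)"
  using assms unfolding Hom_def by auto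

lemma HomI:
  assumes "\<And>v. v \<in> mod_space M \<Longrightarrow> f v \<in> mod_space N" "\<And>v. v \<notin> mod_space M \<Longrightarrow> f v = 0"
    "\<And>v w. v \<in> mod_space M \<Longrightarrow> w \<in> mod_space M \<Longrightarrow> f (v + w) = f v + f w"
    "\<And>a v. v \<in> mod_space M \<Longrightarrow> f (mod_act M a v) = mod_act N a (f v)"
  shows "f \<in> Hom M N"
  using assms unfolding Hom_def by auto

lemma Hom_linear_on:
  assumes M: "left_module scl M" and N: "left_module scl N" and f: "f \<in> Hom M N"
  shows "linear_on (mod_space M) f"
  unfolding linear_on_def
proof (intro conjI ballI allI)
  fix c v assume v: "v \<in> mod_space M"
  have "f (mod_act M (scl c 1) v) = mod_act N (scl c 1) (f v)" using HomD(4)[OF f v] .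
  then show "f (fscale c v) = fscale c (f v)"
    using left_moduleD(7)[OF M v] left_moduleD(7)[OF N HomD(1)[OF f v]] by simp
qed (use HomD(3)[OF f] in blast)

text \<open>A scalar acts through \<open>scl c 1\<close>, and this element is central in the
  algebra.\<close>

lemma act_linear_on:
  assumes M: "left_module scl M" and alg: "k_algebra scl"
  shows "linear_on (mod_space M) (mod_act M a)"
  unfolding linear_on_def
proof (intro conjI ballI allI)
  interpret k_algebra scl by (rule alg)
  fix c v assume v: "v \<in> mod_space M"
  have "mod_act M (a * scl c 1) v = mod_act M (scl c 1 * a) v"
    by (simp add: scl_mult_left scl_mult_right)
  then show "mod_act M a (fscale c v) = fscale c (mod_act M a v)"
    using left_moduleD(2,5,7)[OF M] v by metis
qed (use left_moduleD(3)[OF M] in blast)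

lemma act_scl:
  assumes M: "left_module scl M" and alg: "k_algebra scl" and v: "v \<in> mod_space M"
  shows "mod_act M (scl c a) v = fscale c (mod_act M a v)"
proof -
  interpret k_algebra scl by (rule alg)
  have "scl c a = scl c 1 * a" by (simp add: scl_mult_left)
  then show ?thesis using left_moduleD(2,5,7)[OF M] v by metis
qed

lemma zero_in_Hom:
  fixes M N :: "('a::ring_1, 'k::field) lmodule"
  assumes "left_module scl M" "left_module scl N"
  shows "0 \<in> Hom M N"
proof (rule HomI)
  have "mod_act N a 0 = 0" for a
    using left_moduleD(3)[OF assms(2), of 0 0 a] fam.subspace_0[OF left_moduleD(1)[OF assms(2)]] by simp
  then show "0 (mod_act M a v) = mod_act N a (0 v)" for a and v :: "'k fam" by simp
qed (use fam.subspace_0[OF left_moduleD(1)[OF assms(2)]] in auto)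

lemma Hom_eq_zero_iff:
  assumes "left_module scl M" "left_module scl N"
  shows "Hom M N = {0} \<longleftrightarrow> (\<forall>f\<in>Hom M N. f = 0)"
  using zero_in_Hom[OF assms] by blast

lemma Hom_comp:
  assumes M: "left_module scl M" and N: "left_module scl N" and P: "left_module scl P"
    and f: "f \<in> Hom M N" and g: "g \<in> Hom N P"
  shows "g \<circ> f \<in> Hom M P"
  using HomD[OF f] HomD[OF g] linear_on_zero[OF left_moduleD(1)[OF N] Hom_linear_on[OF N P g]]
  by (intro HomI) auto

lemma module_iso_refl: "left_module scl M \<Longrightarrow> module_iso M M"
  unfolding module_iso_def
  by (rule bexI[of _ "\<lambda>v. if v \<in> mod_space M then v else 0"])
    (auto intro!: HomI bij_betwI[where g = id] simp: left_moduleD fam.subspace_add)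

lemma module_iso_sym:
  assumes M: "left_module scl M" and N: "left_module scl N" and iso: "module_iso M N"
  shows "module_iso N M"
proof -
  obtain f where f: "f \<in> Hom M N" "bij_betw f (mod_space M) (mod_space N)"
    using iso by (auto simp: module_iso_def)
  define g where "g w = (if w \<in> mod_space N then inv_into (mod_space M) f w else 0)" for w
  have gf: "g (f v) = v" if "v \<in> mod_space M" for v
    using that f HomD(1)[OF f(1)] by (simp add: g_def bij_betw_def)
  have "\<exists>v\<in>mod_space M. w = f v" if "w \<in> mod_space N" for w
    using that f(2) by (auto simp: bij_betw_def)
  note N_cases = bexE[OF this]
  have "g \<in> Hom N M"
  proof (rule HomI)
    fix w assume "w \<in> mod_space N"
    then show "g w \<in> mod_space M" by (rule N_cases) (simp add: gf)
  next
    fix w w' assume "w \<in> mod_space N" "w' \<in> mod_space N"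
    then obtain v v' where v: "v \<in> mod_space M" "v' \<in> mod_space M" "w = f v" "w' = f v'"
      using N_cases by metis
    then have "g (f (v + v')) = v + v'" using gf fam.subspace_add[OF left_moduleD(1)[OF M]] by blast
    then show "g (w + w') = g w + g w'" using v gf HomD(3)[OF f(1)] by simp
  next
    fix a w assume "w \<in> mod_space N"
    then show "g (mod_act N a w) = mod_act M a (g w)"
      using gf HomD(4)[OF f(1)] left_moduleD(2)[OF M] N_cases by metis
  qed (simp add: g_def)
  moreover have "bij_betw g (mod_space N) (mod_space M)"
    by (rule bij_betw_byWitness[where f' = f])
      (use gf HomD(1)[OF f(1)] HomD(1)[OF \<open>g \<in> Hom N M\<close>] N_cases in \<open>auto, metis\<close>)
  ultimately show ?thesis by (auto simp: module_iso_def)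
qed

lemma module_iso_trans:
  assumes "left_module scl M" "left_module scl N" "left_module scl P"
    and "module_iso M N" "module_iso N P"
  shows "module_iso M P"
  using assms(4,5) Hom_comp[OF assms(1-3)] bij_betw_trans unfolding module_iso_def by blast

lemma Hom_zero_iso_left:
  assumes "left_module scl M" "left_module scl M'" "left_module scl N"
    and iso: "module_iso M M'" and zero: "Hom M N = {0}"
  shows "Hom M' N = {0}"
proof -
  obtain f where f: "f \<in> Hom M M'" "bij_betw f (mod_space M) (mod_space M')"
    using iso by (auto simp: module_iso_def)
  have "g = 0" if g: "g \<in> Hom M' N" for g
  proof
    have gf: "g \<circ> f = 0" using Hom_comp[OF assms(1-3) f(1) g] zero by blast
    fix w
    show "g w = 0 w"
    proof (cases "w \<in> mod_space M'")
      case True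
      then obtain v where "w = f v" using f(2) by (auto simp: bij_betw_def)
      then show ?thesis using fun_cong[OF gf, of v] by simp
    qed (simp add: HomD(2)[OF g])
  qed
  then show ?thesis using Hom_eq_zero_iff[OF assms(2,3)] by blast
qed

lemma Hom_zero_iso_right:
  assumes "left_module scl M" "left_module scl N" "left_module scl N'"
    and iso: "module_iso N N'" and zero: "Hom M N = {0}"
  shows "Hom M N' = {0}"
proof -
  obtain f where f: "f \<in> Hom N' N" "bij_betw f (mod_space N') (mod_space N)"
    using module_iso_sym[OF assms(2,3) iso] by (auto simp: module_iso_def)
  have f0: "f 0 = 0" using linear_on_zero[OF left_moduleD(1)[OF assms(3)] Hom_linear_on[OF assms(3,2) f(1)]] .
  have "g = 0" if g: "g \<in> Hom M N'" for g
  proof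
    have fg: "f \<circ> g = 0" using Hom_comp[OF assms(1,3,2) g f(1)] zero by blast
    fix w
    show "g w = 0 w"
    proof (cases "w \<in> mod_space M")
      case True
      then have "f (g w) = f 0" "g w \<in> mod_space N'" using fun_cong[OF fg, of w] HomD(1)[OF g] f0 by auto
      then have "g w = 0"
        using f(2) fam.subspace_0[OF left_moduleD(1)[OF assms(3)]] unfolding bij_betw_def inj_on_def by blast
      then show ?thesis by simp
    qed (simp add: HomD(2)[OF g])
  qed
  then show ?thesis using Hom_eq_zero_iff[OF assms(1,3)] by blast
qed

lemma iso_Hom_nonzero:
  assumes "left_module scl M" "left_module scl N" "mod_space M \<noteq> {0}" "module_iso M N"
  shows "Hom M N \<noteq> {0}"
proof
  assume zero: "Hom M N = {0}"
  obtain f where f: "f \<in> Hom M N" "bij_betw f (mod_space M) (mod_space N)"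
    using assms(4) by (auto simp: module_iso_def)
  have 0: "0 \<in> mod_space M" using fam.subspace_0[OF left_moduleD(1)[OF assms(1)]] .
  then obtain v where "v \<in> mod_space M" "v \<noteq> 0" using assms(3) by blast
  moreover have "f = 0" using f zero by blast
  ultimately show False using f(2) 0 unfolding bij_betw_def inj_on_def by (metis zero_fun_apply)
qed

section \<open>Finitely generated modules and bricks\<close>

lemma fg_module_left_module: "fg_module scl M \<Longrightarrow> left_module scl M"
  by (simp add: fg_module_def)

text \<open>The products of spanning elements of the algebra with module generators span the module.
  Conversely a basis over the field generates it, since scalars act through
  \<open>scl c 1\<close>.\<close>

lemma fg_module_iff:
  assumes alg: "finite_dimensional_algebra scl"
  shows "fg_module scl M \<longleftrightarrow> left_module scl M \<and> finite_dim (mod_space M)"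
proof (intro iffI conjI)
  obtain B where B: "finite B" "module.span scl B = UNIV" and k: "k_algebra scl"
    using alg by (auto simp: finite_dimensional_algebra_def)
  interpret k_algebra scl by (rule k)
  assume fg: "fg_module scl M"
  then show M: "left_module scl M" by (rule fg_module_left_module)
  obtain S where S: "finite S" "S \<subseteq> mod_space M" "\<And>v. v \<in> mod_space M \<Longrightarrow> \<exists>c. v = (\<Sum>s\<in>S. mod_act M (c s) s)"
    using fg by (auto simp: fg_module_def)
  define S' where "S' = (\<lambda>(b, s). mod_act M b s) ` (B \<times> S)"
  have act: "mod_act M a s \<in> fam.span S'" if s: "s \<in> S" for a s
  proof -
    have "a \<in> span B" using B(2) by simp
    then show ?thesis
    proof (induction rule: span_induct_alt)
      case base
      have "mod_act M (0 + 0) s = mod_act M 0 s + mod_act M 0 s"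
        using left_moduleD(4)[OF M] s S(2) by blast
      then have "mod_act M 0 s = 0" by simp
      then show ?case using fam.span_zero[of S'] by (simp del: zero_fun_apply)
    next
      case (step c b a)
      have "mod_act M (scl c b + a) s = fscale c (mod_act M b s) + mod_act M a s"
        using left_moduleD(4)[OF M] act_scl[OF M k] s S(2) by auto
      moreover have "mod_act M b s \<in> fam.span S'"
        using step(1) s by (intro fam.span_base) (auto simp: S'_def)
      ultimately show ?case using step(2) by (simp add: fam.span_add fam.span_scale del: plus_fun_apply)
    qed
  qed
  have "mod_space M \<subseteq> fam.span S'"
  proof
    fix v assume "v \<in> mod_space M"
    then obtain c where v: "v = (\<Sum>s\<in>S. mod_act M (c s) s)" using S(3) by blast
    show "v \<in> fam.span S'" unfolding v by (intro fam.span_sum act)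
  qed
  moreover have "finite S'" using B(1) S(1) by (simp add: S'_def)
  ultimately show "finite_dim (mod_space M)" unfolding finite_dim_def by blast
next
  assume M: "left_module scl M \<and> finite_dim (mod_space M)"
  obtain B where B: "B \<subseteq> mod_space M" "fam.independent B" "mod_space M \<subseteq> fam.span B"
    using fam.maximal_independent_subset by blast
  have fin: "finite B" using finite_independent_subset M B by blast
  have "\<exists>c. v = (\<Sum>s\<in>B. mod_act M (c s) s)" if "v \<in> mod_space M" for v
  proof -
    have "v \<in> range (\<lambda>u. \<Sum>b\<in>B. fscale (u b) b)"
      using subsetD[OF B(3) that] unfolding fam.span_finite[OF fin] .
    then obtain u where "v = (\<Sum>b\<in>B. fscale (u b) b)" by (rule rangeE)
    also have "\<dots> = (\<Sum>b\<in>B. mod_act M (scl (u b) 1) b)"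
      using M B(1) by (intro sum.cong refl) (metis left_moduleD(7) subsetD)
    finally show ?thesis by (intro exI[of _ "\<lambda>b. scl (u b) 1"])
  qed
  then show "fg_module scl M" using M fin B(1) unfolding fg_module_def by blast
qed

lemma submodule_left_module:
  assumes M: "left_module scl M" and U: "fam.subspace U" "U \<subseteq> mod_space M"
    and act: "\<And>a v. v \<in> U \<Longrightarrow> mod_act M a v \<in> U"
  shows "left_module scl (M\<lparr>mod_space := U\<rparr>)"
  using left_moduleD[OF M] U act unfolding left_module_def by (simp add: subset_iff)

text \<open>An isomorphism \<open>\<theta>\<close> that respects scalars must send \<open>c\<close>
  to multiplication by \<open>c\<close>. Its injectivity, applied to 0 and 1, says that the module
  is non-zero, and its surjectivity that every endomorphism is scalar.\<close>

lemma brick_iff: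
  assumes k: "k_algebra scl"
  shows "brick scl M \<longleftrightarrow> fg_module scl M \<and> mod_space M \<noteq> {0} \<and>
     (\<forall>f\<in>Hom M M. \<exists>c. \<forall>v\<in>mod_space M. f v = fscale c v)"
proof (intro iffI conjI ballI)
  assume br: "brick scl M"
  then show fg: "fg_module scl M" by (simp add: brick_def)
  note M = fg_module_left_module[OF fg]
  obtain \<theta> where \<theta>: "bij_betw \<theta> UNIV (Hom M M)" "\<theta> 1 = (\<lambda>v. if v \<in> mod_space M then v else 0)"
    "\<And>c a v. \<theta> (c * a) v = fscale c (\<theta> a v)"
    using br unfolding brick_def by blast
  have \<theta>_eq: "\<theta> c v = fscale c (if v \<in> mod_space M then v else 0)" for c v
    using \<theta>(3)[of c 1 v] \<theta>(2) by simp
  have "\<theta> 0 \<noteq> \<theta> 1" using \<theta>(1) unfolding bij_betw_def inj_on_def by (metis UNIV_I zero_neq_one)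
  then obtain v where "\<theta> 0 v \<noteq> \<theta> 1 v" by blast
  then have "v \<in> mod_space M" "v \<noteq> 0" by (auto simp: \<theta>_eq split: if_splits)
  then show "mod_space M \<noteq> {0}" by blast
  fix f assume "f \<in> Hom M M"
  then obtain c where "f = \<theta> c" using \<theta>(1) by (auto simp: bij_betw_def)
  then show "\<exists>c. \<forall>v\<in>mod_space M. f v = fscale c v" using \<theta>_eq by auto
next
  assume br: "fg_module scl M \<and> mod_space M \<noteq> {0} \<and> (\<forall>f\<in>Hom M M. \<exists>c. \<forall>v\<in>mod_space M. f v = fscale c v)"
  then have M: "left_module scl M" by (simp add: fg_module_left_module)
  note sub = left_moduleD(1)[OF M]
  obtain v where v: "v \<in> mod_space M" "v \<noteq> 0" using br fam.subspace_0[OF sub] by blast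
  define \<theta> where "\<theta> c v = (if v \<in> mod_space M then fscale c v else 0)" for c v
  have "bij_betw \<theta> UNIV (Hom M M)"
    unfolding bij_betw_def
  proof
    show "inj \<theta>"
    proof (rule injI)
      fix a b assume "\<theta> a = \<theta> b"
      then have "\<theta> a v = \<theta> b v" by simp
      then show "a = b" using v by (simp add: \<theta>_def)
    qed
    have "\<theta> c \<in> Hom M M" for c
    proof (rule HomI)
      fix a v assume v: "v \<in> mod_space M"
      have "mod_act M a (fscale c v) = fscale c (mod_act M a v)"
        using act_linear_on[OF M k, of a] v by (simp add: linear_on_def)
      then show "\<theta> c (mod_act M a v) = mod_act M a (\<theta> c v)"
        using v left_moduleD(2)[OF M] by (simp add: \<theta>_def)
    qed (use fam.subspace_scale[OF sub] fam.subspace_add[OF sub] in \<open>auto simp: \<theta>_def fam.scale_right_distrib\<close>)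
    moreover have "f \<in> range \<theta>" if f: "f \<in> Hom M M" for f
    proof -
      obtain c where "\<forall>v\<in>mod_space M. f v = fscale c v"
        using bspec[OF conjunct2[OF conjunct2[OF br]] f] by (rule exE)
      then have "f = \<theta> c" using HomD(2)[OF f] by (auto simp: \<theta>_def)
      then show ?thesis by blast
    qed
    ultimately show "range \<theta> = Hom M M" by blast
  qed
  then show "brick scl M"
    unfolding brick_def using br fam.subspace_scale[OF sub]
    by (intro conjI exI[of _ \<theta>]) (auto simp: \<theta>_def fun_eq_iff fam.scale_left_distrib)
qed

lemma Hom_into_submodule:
  assumes "mod_space B \<subseteq> mod_space M" "mod_act B = mod_act M" "f \<in> Hom X B"
  shows "f \<in> Hom X M"
  using HomD[OF assms(3)] assms(1,2) by (intro HomI) auto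

text \<open>The image of an endomorphism of minimal rank is a brick: an endomorphism of the image that is
  not a scalar becomes singular after subtracting an eigenvalue, and would lower the rank.\<close>

lemma brick_quotient_submodule:
  fixes scl :: "'k::alg_closed_field \<Rightarrow> 'a::ring_1 \<Rightarrow> 'a" and M :: "('a, 'k) lmodule"
  assumes alg: "finite_dimensional_algebra scl" and fg: "fg_module scl M" and nonzero: "mod_space M \<noteq> {0}"
  obtains B f where "brick scl B" "mod_space B \<subseteq> mod_space M" "mod_act B = mod_act M"
    "f \<in> Hom M B" "f \<noteq> 0" "fam.dim (mod_space B) \<le> fam.dim (mod_space M)"
proof -
  let ?V = "mod_space M"
  have k: "k_algebra scl" using alg by (simp add: finite_dimensional_algebra_def)
  have M: "left_module scl M" and fd: "finite_dim ?V" using fg fg_module_iff[OF alg] by auto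
  note sub = left_moduleD(1)[OF M]
  define i where "i v = (if v \<in> ?V then v else 0)" for v
  have "i \<in> Hom M M"
    by (rule HomI) (auto simp: i_def left_moduleD(2)[OF M] fam.subspace_add[OF sub])
  moreover have "i \<noteq> 0"
  proof -
    obtain v where "v \<in> ?V" "v \<noteq> 0" using nonzero fam.subspace_0[OF sub] by blast
    then have "i v \<noteq> 0 v" by (simp add: i_def)
    then show ?thesis by metis
  qed
  ultimately obtain f where f: "f \<in> Hom M M" "f \<noteq> 0"
    and min: "\<And>h. h \<in> Hom M M \<Longrightarrow> h \<noteq> 0 \<Longrightarrow> fam.dim (f ` ?V) \<le> fam.dim (h ` ?V)"
    using ex_has_least_nat[of "\<lambda>f. f \<in> Hom M M \<and> f \<noteq> 0" i "\<lambda>f. fam.dim (f ` ?V)"] by blast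
  note lin = Hom_linear_on[OF M M f(1)]
  define B where "B = M\<lparr>mod_space := f ` ?V\<rparr>"
  have B_space: "mod_space B = f ` ?V" and B_act: "mod_act B = mod_act M" by (simp_all add: B_def)
  have BV: "f ` ?V \<subseteq> ?V" using HomD(1)[OF f(1)] by blast
  have B: "left_module scl B"
    unfolding B_def
  proof (rule submodule_left_module[OF M subspace_linear_on_image[OF sub lin] BV])
    fix a v assume "v \<in> f ` ?V"
    then show "mod_act M a v \<in> f ` ?V"
      using HomD(4)[OF f(1)] left_moduleD(2)[OF M] by (metis imageE imageI)
  qed
  have fdB: "finite_dim (f ` ?V)" using finite_dim_subset[OF fd BV] .
  have fB: "f \<in> Hom M B"
    using HomD[OF f(1)] by (intro HomI) (auto simp: B_space B_act)
  obtain v where v: "f v \<noteq> 0" using f(2) by (metis ext zero_fun_apply)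
  then have vV: "v \<in> ?V" using HomD(2)[OF f(1)] by metis
  have B_nonzero: "f ` ?V \<noteq> {0}" using v vV by blast
  have "\<exists>c. \<forall>w\<in>mod_space B. g w = fscale c w" if g: "g \<in> Hom B B" for g
  proof -
    note glin = Hom_linear_on[OF B B g]
    have "g ` (f ` ?V) \<subseteq> f ` ?V" using HomD(1)[OF g] by (auto simp: B_space)
    then obtain c w where w: "w \<in> f ` ?V" "w \<noteq> 0" "g w = fscale c w"
      by (rule eigenvector_exists[OF subspace_linear_on_image[OF sub lin] fdB B_nonzero glin[unfolded B_space]])
    define h where "h u = (if u \<in> mod_space B then g u - fscale c u else 0)" for u
    note subB = left_moduleD(1)[OF B]
    have h: "h \<in> Hom B B"
    proof (rule HomI)
      show "h u \<in> mod_space B" if "u \<in> mod_space B" for u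
        using that HomD(1)[OF g] by (simp add: h_def fam.subspace_diff[OF subB] fam.subspace_scale[OF subB])
      show "h (u + u') = h u + h u'" if "u \<in> mod_space B" "u' \<in> mod_space B" for u u'
        using that HomD(3)[OF g] fam.subspace_add[OF subB] by (simp add: h_def fam.scale_right_distrib)
      show "h (mod_act B a u) = mod_act B a (h u)" if u: "u \<in> mod_space B" for a u
      proof -
        have a: "linear_on (mod_space B) (mod_act B a)" by (rule act_linear_on[OF B k])
        have "g u + fscale (- c) u \<in> mod_space B"
          using u HomD(1)[OF g] fam.subspace_add[OF subB] fam.subspace_scale[OF subB] by blast
        have "mod_act B a (g u + fscale (- c) u) = mod_act B a (g u) + fscale (- c) (mod_act B a u)"
          using a u HomD(1)[OF g] fam.subspace_scale[OF subB] unfolding linear_on_def by metis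
        then show ?thesis using u HomD(4)[OF g] left_moduleD(2)[OF B] by (simp add: h_def)
      qed
    qed (simp add: h_def)
    note hlin = Hom_linear_on[OF B B h]
    have "h \<circ> f \<in> Hom M M"
      using Hom_comp[OF M B B fB h] Hom_into_submodule[of B M "h \<circ> f" M] BV B_space B_act by simp
    moreover have "fam.dim ((h \<circ> f) ` ?V) < fam.dim (f ` ?V)"
      using dim_image_less[OF subB _ hlin, of w] fdB w unfolding image_comp[symmetric] B_space
      by (simp add: h_def B_space)
    ultimately have zero: "h \<circ> f = 0" using min[of "h \<circ> f"] by linarith
    have "g u = fscale c u" if u: "u \<in> mod_space B" for u
    proof -
      obtain x where "x \<in> ?V" "u = f x" using u by (auto simp: B_space)
      then have "h u = 0" using fun_cong[OF zero, of x] by simp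
      then show ?thesis using u by (simp add: h_def)
    qed
    then show ?thesis by blast
  qed
  then have "brick scl B"
    unfolding brick_iff[OF k] fg_module_iff[OF alg] using B fdB B_nonzero by (simp add: B_space)
  moreover have "fam.dim (mod_space B) \<le> fam.dim ?V"
    unfolding B_space by (rule dim_image_le[OF sub fd lin])
  ultimately show ?thesis using that[OF _ _ B_act fB f(2)] BV by (simp add: B_space)
qed

section \<open>The action of the path algebra\<close>

text \<open>Serves both as a path regarded as an element of the path algebra and as a standard basis
  vector of the total space.\<close>

definition unit_fam :: "'j \<Rightarrow> 'j \<Rightarrow> 'k::field" where
  "unit_fam p = (\<lambda>q. if q = p then 1 else 0)"

lemma fam_sum_apply: "(\<Sum>i\<in>A. f i) j = (\<Sum>i\<in>A. f i j)" for f :: "'i \<Rightarrow> 'j \<Rightarrow> 'k::comm_monoid_add"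
  by (induction A rule: infinite_finite_induct) auto

lemma subspace_total_space: "fam.subspace (total_space Q d :: 'k::field fam set)"
  by (rule fam.subspaceI) (auto simp: total_space_def fscale_def, (metis add_0)+)

lemma linear_on_comp: "linear_on UNIV f \<Longrightarrow> linear_on UNIV g \<Longrightarrow> linear_on UNIV (\<lambda>v. f (g v))"
  by (simp add: linear_on_def)

lemma linear_on_vertex_act: "linear_on UNIV (vertex_act s)"
  by (auto simp: linear_on_def vertex_act_def fscale_def fun_eq_iff)

lemma linear_on_arrow_act: "linear_on UNIV (arrow_act Q d x a)"
  by (auto simp: linear_on_def arrow_act_def fscale_def fun_eq_iff algebra_simps sum.distrib sum_distrib_left)

lemma linear_on_foldr_arrow_act: "linear_on UNIV (foldr (arrow_act Q d x) as)"
proof (induction as)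
  case Nil
  show ?case by (simp add: linear_on_def)
next
  case (Cons a as)
  then show ?case using linear_on_comp[OF linear_on_arrow_act Cons.IH] by (simp add: comp_def)
qed

lemma linear_on_path_act: "linear_on UNIV (path_act Q d x p)"
proof -
  obtain t as s where p: "p = (t, as, s)" by (cases p)
  have "path_act Q d x p = (\<lambda>v. foldr (arrow_act Q d x) as (vertex_act s v))"
    by (simp add: p fun_eq_iff)
  then show ?thesis
    using linear_on_comp[OF linear_on_foldr_arrow_act linear_on_vertex_act, of Q d x as s] by simp
qed

lemma linear_on_UNIV_D:
  assumes "linear_on UNIV f"
  shows "f (v + w) = f v + f w" "f (fscale c v) = fscale c (f v)" "f 0 = 0"
  using assms linear_on_zero[OF fam.subspace_UNIV assms] by (auto simp: linear_on_def simp del: plus_fun_apply)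

lemma vertex_act_total_space: "v \<in> total_space Q d \<Longrightarrow> vertex_act s v \<in> total_space Q d"
  by (auto simp: total_space_def vertex_act_def split: if_splits)

lemma arrow_act_total_space:
  "finite_quiver Q \<Longrightarrow> a \<in> arrows Q \<Longrightarrow> arrow_act Q d x a v \<in> total_space Q d"
  by (auto simp: total_space_def arrow_act_def finite_quiver_def)

lemma path_act_total_space:
  assumes "finite_quiver Q" "is_path Q p" "v \<in> total_space Q d"
  shows "path_act Q d x p v \<in> total_space Q d"
proof -
  obtain t as s where p: "p = (t, as, s)" by (cases p)
  show ?thesis
    using assms(2) unfolding p
    by (induction as arbitrary: t) (auto simp: vertex_act_total_space[OF assms(3)] arrow_act_total_space[OF assms(1)])
qed

lemma vertex_act_arrow_act:
  "vertex_act j (arrow_act Q d x a v) = (if j = tgt Q a then arrow_act Q d x a v else 0)"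
  by (auto simp: vertex_act_def arrow_act_def fun_eq_iff)

lemma vertex_act_vertex_act: "vertex_act j (vertex_act s v) = (if j = s then vertex_act s v else 0)"
  by (auto simp: vertex_act_def fun_eq_iff)

lemma vertex_act_path_act:
  assumes "is_path Q (t, as, s)"
  shows "vertex_act j (path_act Q d x (t, as, s) v) = (if j = t then path_act Q d x (t, as, s) v else 0)"
  using assms by (cases as) (auto simp: vertex_act_arrow_act vertex_act_vertex_act)

text \<open>Every path acts through the projection to its source. On the output of the second path
  this projection is the identity if that path ends at \<open>j\<close>, and zero otherwise, which
  matches the product of paths.\<close>

lemma path_act_path_act:
  assumes "is_path Q (j', bs, s)"
  shows "path_act Q d x (t, as, j) (path_act Q d x (j', bs, s) v) =
    (if j = j' then path_act Q d x (t, as @ bs, s) v else 0)"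
  using vertex_act_path_act[OF assms, of j d x v] linear_on_UNIV_D(3)[OF linear_on_foldr_arrow_act]
  by (auto simp del: zero_fun_apply)

lemma is_path_append:
  "is_path Q (t, as, j) \<Longrightarrow> is_path Q (j, bs, s) \<Longrightarrow> is_path Q (t, as @ bs, s)"
  by (induction as arbitrary: t) auto

lemma path_algebra_act_eq:
  assumes "finite A" "{p. w p \<noteq> 0} \<subseteq> A"
  shows "path_algebra_act Q d x w v = (\<Sum>p\<in>A. fscale (w p) (path_act Q d x p v))"
  unfolding path_algebra_act_def using assms by (intro sum.mono_neutral_left) auto

lemma path_algebra_finite: "w \<in> path_algebra Q \<Longrightarrow> finite {p. w p \<noteq> 0}"
  by (simp add: path_algebra_def)

lemma path_algebra_is_path: "w \<in> path_algebra Q \<Longrightarrow> w p \<noteq> 0 \<Longrightarrow> is_path Q p"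
  unfolding path_algebra_def by blast

lemma subspace_path_algebra: "fam.subspace (path_algebra Q :: ('e path \<Rightarrow> 'k::field) set)"
proof (rule fam.subspaceI)
  fix u w :: "'e path \<Rightarrow> 'k" assume uw: "u \<in> path_algebra Q" "w \<in> path_algebra Q"
  have "finite {p. (u + w) p \<noteq> 0}"
    by (rule finite_subset[of _ "{p. u p \<noteq> 0} \<union> {p. w p \<noteq> 0}"])
      (use uw in \<open>auto simp: path_algebra_def\<close>)
  then show "u + w \<in> path_algebra Q"
    using uw by (auto simp: path_algebra_def) (metis add_0)
  fix c
  have "finite {p. fscale c u p \<noteq> 0}"
    by (rule finite_subset[of _ "{p. u p \<noteq> 0}"]) (use uw in \<open>auto simp: path_algebra_def fscale_def\<close>)
  then show "fscale c u \<in> path_algebra Q" using uw by (auto simp: path_algebra_def fscale_def)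
qed (simp add: path_algebra_def)

lemma unit_fam_in_path_algebra: "is_path Q p \<Longrightarrow> unit_fam p \<in> path_algebra Q"
  by (auto simp: path_algebra_def unit_fam_def)

lemma path_algebra_act_add:
  assumes "u \<in> path_algebra Q" "w \<in> path_algebra Q"
  shows "path_algebra_act Q d x (u + w) v = path_algebra_act Q d x u v + path_algebra_act Q d x w v"
proof -
  let ?A = "{p. u p \<noteq> 0} \<union> {p. w p \<noteq> 0}"
  have fin: "finite ?A" using assms by (simp add: path_algebra_finite)
  have "path_algebra_act Q d x (u + w) v = (\<Sum>p\<in>?A. fscale ((u + w) p) (path_act Q d x p v))"
    by (rule path_algebra_act_eq[OF fin]) auto
  also have "\<dots> = (\<Sum>p\<in>?A. fscale (u p) (path_act Q d x p v)) + (\<Sum>p\<in>?A. fscale (w p) (path_act Q d x p v))"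
    by (simp add: fam.scale_left_distrib sum.distrib)
  finally show ?thesis
    using path_algebra_act_eq[OF fin, of u] path_algebra_act_eq[OF fin, of w] by simp
qed

lemma path_algebra_act_scale:
  assumes "u \<in> path_algebra Q"
  shows "path_algebra_act Q d x (fscale c u) v = fscale c (path_algebra_act Q d x u v)"
proof -
  have "{p. fscale c u p \<noteq> 0} \<subseteq> {p. u p \<noteq> 0}" by (auto simp: fscale_def)
  then have "path_algebra_act Q d x (fscale c u) v =
      (\<Sum>p | u p \<noteq> 0. fscale (fscale c u p) (path_act Q d x p v))"
    by (rule path_algebra_act_eq[OF path_algebra_finite[OF assms]])
  then show ?thesis
    by (simp add: path_algebra_act_def fam.scale_sum_right) (simp add: fscale_def mult.assoc)
qed

lemma path_algebra_act_unit: "path_algebra_act Q d x (unit_fam p) v = path_act Q d x p v"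
  using path_algebra_act_eq[of "{p}" "unit_fam p" Q d x v]
  by (auto simp: unit_fam_def split: if_splits)

lemma path_algebra_act_zero: "path_algebra_act Q d x 0 v = 0"
  by (simp add: path_algebra_act_def)

lemma linear_on_path_algebra_act: "linear_on UNIV (path_algebra_act Q d x w)"
  unfolding linear_on_def path_algebra_act_def
  by (auto simp: linear_on_UNIV_D(1,2)[OF linear_on_path_act] fam.scale_right_distrib sum.distrib
      fam.scale_sum_right mult.commute simp del: plus_fun_apply)

lemma path_algebra_act_total_space:
  assumes "finite_quiver Q" "w \<in> path_algebra Q" "v \<in> total_space Q d"
  shows "path_algebra_act Q d x w v \<in> total_space Q d"
  unfolding path_algebra_act_def
  by (intro fam.subspace_sum[OF subspace_total_space] fam.subspace_scale[OF subspace_total_space]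
      path_act_total_space[OF assms(1) path_algebra_is_path[OF assms(2)] assms(3)]) simp

text \<open>Reduces statements that are linear in \<open>w\<close> to single paths.\<close>

lemma path_algebra_induct [consumes 1, case_names zero add]:
  assumes w: "w \<in> path_algebra Q"
    and zero: "P 0"
    and add: "\<And>c p w. is_path Q p \<Longrightarrow> w \<in> path_algebra Q \<Longrightarrow> P w \<Longrightarrow> P (fscale c (unit_fam p) + w)"
  shows "P (w :: 'e path \<Rightarrow> 'k::field)"
proof -
  have partial: "(\<Sum>p\<in>A. fscale (w p) (unit_fam p)) \<in> path_algebra Q \<and> P (\<Sum>p\<in>A. fscale (w p) (unit_fam p))"
    if "finite A" "A \<subseteq> {p. w p \<noteq> 0}" for A
    using that
  proof (induction A rule: finite_induct)
    case empty
    then show ?case using zero fam.subspace_0[OF subspace_path_algebra] by (simp del: zero_fun_apply)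
  next
    case (insert p A)
    then have "is_path Q p" using path_algebra_is_path[OF w] by blast
    then have "fscale (w p) (unit_fam p) \<in> path_algebra Q"
      by (intro fam.subspace_scale[OF subspace_path_algebra] unit_fam_in_path_algebra)
    then show ?case
      using insert add[OF \<open>is_path Q p\<close>]
      by (simp add: fam.subspace_add[OF subspace_path_algebra] del: plus_fun_apply)
  qed
  have "(\<Sum>p | w p \<noteq> 0. fscale (w p) (unit_fam p)) = w"
  proof
    fix q
    have "(\<Sum>p | w p \<noteq> 0. fscale (w p) (unit_fam p)) q = (\<Sum>p | w p \<noteq> 0. if p = q then w q else 0)"
      by (auto simp: fam_sum_apply fscale_def unit_fam_def intro!: sum.cong)
    then show "(\<Sum>p | w p \<noteq> 0. fscale (w p) (unit_fam p)) q = w q"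
      using path_algebra_finite[OF w] by simp
  qed
  then show ?thesis using partial[OF path_algebra_finite[OF w] order_refl] by simp
qed

section \<open>Products in the path algebra act by composition\<close>

lemma path_mult_add_left: "path_mult Q (w + w') u = path_mult Q w u + path_mult Q w' u"
  by (auto simp: path_mult_def fun_eq_iff algebra_simps sum.distrib)

lemma path_mult_add_right: "path_mult Q u (w + w') = path_mult Q u w + path_mult Q u w'"
  by (auto simp: path_mult_def fun_eq_iff algebra_simps sum.distrib)

lemma path_mult_scale_left: "path_mult Q (fscale c w) u = fscale c (path_mult Q w u)"
  by (auto simp: path_mult_def fscale_def fun_eq_iff algebra_simps sum_distrib_left)

lemma path_mult_scale_right: "path_mult Q u (fscale c w) = fscale c (path_mult Q u w)"
  by (auto simp: path_mult_def fscale_def fun_eq_iff algebra_simps sum_distrib_left)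

lemma path_mult_zero: "path_mult Q 0 u = 0" "path_mult Q u 0 = 0"
  by (auto simp: path_mult_def fun_eq_iff)

text \<open>In the double sum over the cuts of a path and the middle vertices, at most one term
  survives: the cut after \<open>as\<close> at the vertex \<open>j\<close>.\<close>

lemma path_mult_unit:
  assumes j: "j < num_verts Q"
  shows "path_mult Q (unit_fam (t, as, j)) (unit_fam (j', bs, s)) =
    (if j = j' then unit_fam (t, as @ bs, s) else (0 :: 'e path \<Rightarrow> 'k::field))"
proof
  fix q :: "'e path"
  obtain t' l s' where q: "q = (t', l, s')" by (cases q)
  let ?u = "unit_fam :: 'e path \<Rightarrow> 'e path \<Rightarrow> 'k"
  have term_eq: "?u (t, as, j) (t', take m l, i) * ?u (j', bs, s) (i, drop m l, s') =
      (if i = j then (if m = length as then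
         (if j = j' \<and> t' = t \<and> l = as @ bs \<and> s' = s then 1 else 0) else 0) else 0)"
    if "m \<le> length l" for m i
  proof -
    have "take m l = as \<and> drop m l = bs \<longleftrightarrow> m = length as \<and> l = as @ bs"
      using that by (metis append_eq_conv_conj append_take_drop_id length_take min.absorb2)
    moreover have "?u (t, as, j) (t', take m l, i) * ?u (j', bs, s) (i, drop m l, s') =
        (if t' = t \<and> i = j \<and> i = j' \<and> s' = s \<and> (take m l = as \<and> drop m l = bs) then 1 else 0)"
      by (simp add: unit_fam_def)
    ultimately show ?thesis by auto
  qed
  have "path_mult Q (?u (t, as, j)) (?u (j', bs, s)) q =
      (\<Sum>m\<le>length l. \<Sum>i<num_verts Q. if i = j then (if m = length as then
         (if j = j' \<and> t' = t \<and> l = as @ bs \<and> s' = s then 1 else 0) else 0) else 0)"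
    unfolding path_mult_def q prod.case
    by (intro sum.cong refl term_eq) auto
  also have "\<dots> = (if j = j' \<and> t' = t \<and> l = as @ bs \<and> s' = s then 1 else 0)"
    using j by (auto simp: sum.delta)
  also have "\<dots> = (if j = j' then ?u (t, as @ bs, s) else 0) q"
    by (simp add: unit_fam_def q)
  finally show "path_mult Q (?u (t, as, j)) (?u (j', bs, s)) q = (if j = j' then ?u (t, as @ bs, s) else 0) q" .
qed

lemma is_path_source: "finite_quiver Q \<Longrightarrow> is_path Q (t, as, s) \<Longrightarrow> s < num_verts Q"
  by (induction as arbitrary: t) auto

lemma is_path_target: "finite_quiver Q \<Longrightarrow> is_path Q (t, as, s) \<Longrightarrow> t < num_verts Q"
  by (cases as) (auto simp: finite_quiver_def)

lemma path_mult_act_unit: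
  assumes fq: "finite_quiver Q" and p: "is_path Q p" and q: "is_path Q q"
  shows "path_mult Q (unit_fam p) (unit_fam q) \<in> path_algebra Q"
    and "path_algebra_act Q d x (path_mult Q (unit_fam p) (unit_fam q)) v =
      path_act Q d x p (path_act Q d x q v)"
proof -
  obtain t as j where p_eq: "p = (t, as, j)" by (cases p)
  obtain j' bs s where q_eq: "q = (j', bs, s)" by (cases q)
  have j: "j < num_verts Q" using is_path_source[OF fq] p unfolding p_eq by blast
  show "path_mult Q (unit_fam p) (unit_fam q) \<in> path_algebra Q"
    using p q unfolding p_eq q_eq path_mult_unit[OF j]
    by (auto intro!: unit_fam_in_path_algebra is_path_append
        fam.subspace_0[OF subspace_path_algebra] simp del: is_path.simps)
  show "path_algebra_act Q d x (path_mult Q (unit_fam p) (unit_fam q)) v =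
      path_act Q d x p (path_act Q d x q v)"
    using path_act_path_act[of Q j' bs s d x t as j v] q unfolding p_eq q_eq path_mult_unit[OF j]
    by (auto simp: path_algebra_act_unit path_algebra_act_zero simp del: path_act.simps is_path.simps)
qed

text \<open>Bilinear extension of the case of two paths, first in \<open>u\<close> and then in
  \<open>w\<close>. Membership is carried along in the induction because additivity of the action is
  stated inside the path algebra.\<close>

lemma path_mult_act:
  assumes fq: "finite_quiver Q" and w: "w \<in> path_algebra Q" and u: "u \<in> path_algebra Q"
  shows "path_mult Q w u \<in> path_algebra Q"
    and "path_algebra_act Q d x (path_mult Q w u) v = path_algebra_act Q d x w (path_algebra_act Q d x u v)"
proof -
  note PA = subspace_path_algebra
  note lin = linear_on_UNIV_D[OF linear_on_path_act]
  have unit_left: "path_mult Q (unit_fam p) u \<in> path_algebra Q \<and>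
      path_algebra_act Q d x (path_mult Q (unit_fam p) u) v = path_act Q d x p (path_algebra_act Q d x u v)"
    if p: "is_path Q p" for p
    using u
  proof (induction rule: path_algebra_induct)
    case zero
    then show ?case
      using fam.subspace_0[OF PA] by (simp add: path_mult_zero path_algebra_act_zero lin del: zero_fun_apply)
  next
    case (add c q u)
    note unit = path_mult_act_unit[OF fq p add(1)]
    show ?case
      using add(2,3)
      by (simp add: unit unit_fam_in_path_algebra[OF add(1)] fam.subspace_add[OF PA] fam.subspace_scale[OF PA]
          path_mult_add_right path_mult_scale_right path_algebra_act_add path_algebra_act_scale
          path_algebra_act_unit lin del: plus_fun_apply)
  qed
  have "path_mult Q w u \<in> path_algebra Q \<and>
    path_algebra_act Q d x (path_mult Q w u) v = path_algebra_act Q d x w (path_algebra_act Q d x u v)"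
    using w
  proof (induction rule: path_algebra_induct)
    case zero
    then show ?case
      using fam.subspace_0[OF PA] by (simp add: path_mult_zero path_algebra_act_zero del: zero_fun_apply)
  next
    case (add c p w)
    show ?case
      using add(2,3) unit_left[OF add(1)]
      by (simp add: unit_fam_in_path_algebra[OF add(1)] fam.subspace_add[OF PA] fam.subspace_scale[OF PA]
          path_mult_add_left path_mult_scale_left path_algebra_act_add path_algebra_act_scale
          path_algebra_act_unit del: plus_fun_apply)
  qed
  then show "path_mult Q w u \<in> path_algebra Q"
    "path_algebra_act Q d x (path_mult Q w u) v = path_algebra_act Q d x w (path_algebra_act Q d x u v)"
    by blast+
qed

lemma path_one_eq: "(path_one Q :: 'e path \<Rightarrow> 'k::field) = (\<Sum>i<num_verts Q. unit_fam (i, [], i))"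
proof
  fix q :: "'e path"
  obtain t as s where q: "q = (t, as, s)" by (cases q)
  have "(\<Sum>i<num_verts Q. unit_fam (i, [], i) q) = (\<Sum>i<num_verts Q. if i = t then (if as = [] \<and> s = t then 1 else 0) else 0)"
    by (intro sum.cong) (auto simp: q unit_fam_def)
  then show "path_one Q q = (\<Sum>i<num_verts Q. unit_fam (i, [], i)) q"
    by (auto simp: fam_sum_apply path_one_def q)
qed

lemma path_one_in_path_algebra: "path_one Q \<in> path_algebra Q"
  unfolding path_one_eq
  by (intro fam.subspace_sum[OF subspace_path_algebra] unit_fam_in_path_algebra) auto

lemma sum_vertex_act:
  assumes "v \<in> total_space Q d"
  shows "(\<Sum>i<num_verts Q. vertex_act i v) = v"
proof
  fix q :: "nat \<times> nat"
  obtain i r where q: "q = (i, r)" by (cases q)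
  have "(\<Sum>l<num_verts Q. vertex_act l v q) = (\<Sum>l<num_verts Q. if l = i then v (i, r) else 0)"
    by (intro sum.cong) (auto simp: q vertex_act_def)
  then show "(\<Sum>i<num_verts Q. vertex_act i v) q = v q"
    using assms by (auto simp: fam_sum_apply q total_space_def)
qed

lemma path_algebra_act_sum:
  assumes "\<And>i. i \<in> A \<Longrightarrow> w i \<in> path_algebra Q"
  shows "path_algebra_act Q d x (\<Sum>i\<in>A. w i) v = (\<Sum>i\<in>A. path_algebra_act Q d x (w i) v)"
  using assms
proof (induction A rule: infinite_finite_induct)
  case (insert i A)
  have "sum w A \<in> path_algebra Q" using insert by (intro fam.subspace_sum[OF subspace_path_algebra]) auto
  then show ?case using insert by (simp add: path_algebra_act_add del: plus_fun_apply)
qed (simp_all add: path_algebra_act_zero del: zero_fun_apply)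

lemma path_algebra_act_one:
  assumes "v \<in> total_space Q d"
  shows "path_algebra_act Q d x (path_one Q) v = v"
proof -
  have "path_algebra_act Q d x (path_one Q) v = (\<Sum>i<num_verts Q. path_algebra_act Q d x (unit_fam (i, [], i)) v)"
    unfolding path_one_eq by (intro path_algebra_act_sum unit_fam_in_path_algebra) auto
  then show ?thesis using sum_vertex_act[OF assms] by (simp add: path_algebra_act_unit)
qed

section \<open>Modules of points\<close>

definition quiver_index :: "'e quiver \<Rightarrow> (nat \<Rightarrow> nat) \<Rightarrow> (nat \<times> nat) set" where
  "quiver_index Q d = {(i, r). i < num_verts Q \<and> r < d i}"

lemma finite_quiver_index: "finite (quiver_index Q d)"
proof -
  have "quiver_index Q d = (SIGMA i:{..<num_verts Q}. {..<d i})" by (auto simp: quiver_index_def)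
  then show ?thesis by simp
qed

lemma total_space_outside: "v \<in> total_space Q d \<Longrightarrow> p \<notin> quiver_index Q d \<Longrightarrow> v p = 0"
  by (cases p) (auto simp: total_space_def quiver_index_def)

lemma unit_fam_apply: "unit_fam p q = (if q = p then 1 else 0)"
  by (simp add: unit_fam_def)

lemma unit_fam_in_total_space: "p \<in> quiver_index Q d \<Longrightarrow> unit_fam p \<in> total_space Q d"
  by (cases p) (auto simp: total_space_def quiver_index_def unit_fam_def split: if_splits)

lemma total_space_expand:
  assumes "v \<in> total_space Q d"
  shows "v = (\<Sum>p\<in>quiver_index Q d. fscale (v p) (unit_fam p))"
proof
  fix q
  have "(\<Sum>p\<in>quiver_index Q d. fscale (v p) (unit_fam p) q) = (\<Sum>p\<in>quiver_index Q d. if p = q then v q else 0)"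
    by (intro sum.cong) (auto simp: fscale_def unit_fam_def)
  then show "v q = (\<Sum>p\<in>quiver_index Q d. fscale (v p) (unit_fam p)) q"
    using total_space_outside[OF assms, of q] by (auto simp: fam_sum_apply finite_quiver_index)
qed

lemma finite_dim_total_space: "finite_dim (total_space Q d :: 'k::field fam set)"
  unfolding finite_dim_def
proof (intro exI conjI subsetI)
  show "finite (unit_fam ` quiver_index Q d :: 'k fam set)" by (simp add: finite_quiver_index)
  fix v :: "'k fam" assume v: "v \<in> total_space Q d"
  show "v \<in> fam.span (unit_fam ` quiver_index Q d)"
    by (subst total_space_expand[OF v]) (intro fam.span_sum fam.span_scale fam.span_base imageI)
qed

lemma linear_on_total_space_eqI:
  fixes f g :: "'k::field fam \<Rightarrow> 'c \<Rightarrow> 'k"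
  assumes "linear_on (total_space Q d) f" "linear_on (total_space Q d) g"
    and eq: "\<And>p. p \<in> quiver_index Q d \<Longrightarrow> f (unit_fam p) = g (unit_fam p)"
    and v: "v \<in> total_space Q d"
  shows "f v = g v"
proof -
  have "h v = (\<Sum>p\<in>quiver_index Q d. fscale (v p) (h (unit_fam p)))" if h: "linear_on (total_space Q d) h" for h :: "'k fam \<Rightarrow> 'c \<Rightarrow> 'k"
  proof -
    have "h (\<Sum>p\<in>quiver_index Q d. fscale (v p) (unit_fam p)) =
        (\<Sum>p\<in>quiver_index Q d. h (fscale (v p) (unit_fam p)))"
      by (intro linear_on_sum[OF subspace_total_space h] fam.subspace_scale[OF subspace_total_space]
          unit_fam_in_total_space)
    also have "\<dots> = (\<Sum>p\<in>quiver_index Q d. fscale (v p) (h (unit_fam p)))"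
      using h by (intro sum.cong refl) (simp add: linear_on_def unit_fam_in_total_space)
    finally show ?thesis using total_space_expand[OF v] by simp
  qed
  from this[OF assms(1)] this[OF assms(2)] show ?thesis using eq by simp
qed

section \<open>Homomorphisms as families of matrices, one for each vertex\<close>

definition block_map :: "'e quiver \<Rightarrow> (nat \<Rightarrow> nat) \<Rightarrow> (nat \<Rightarrow> nat) \<Rightarrow> (nat \<times> nat \<times> nat \<Rightarrow> 'k::field) \<Rightarrow> 'k fam \<Rightarrow> 'k fam" where
  "block_map Q d d' F v = (\<lambda>(i, r). if i < num_verts Q \<and> r < d' i then \<Sum>c<d i. F (i, r, c) * v (i, c) else 0)"

text \<open>The commuting squares of a morphism of representations, entry by entry. For fixed
  \<open>x\<close> and \<open>y\<close> this is a homogeneous linear system in \<open>F\<close>, and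
  its coefficients are coordinates of the two points; elimination is applied to it in this
  form.\<close>

definition intertwiner :: "'e quiver \<Rightarrow> (nat \<Rightarrow> nat) \<Rightarrow> (nat \<Rightarrow> nat) \<Rightarrow>
    ('e \<times> nat \<times> nat \<Rightarrow> 'k::field) \<Rightarrow> ('e \<times> nat \<times> nat \<Rightarrow> 'k) \<Rightarrow> (nat \<times> nat \<times> nat \<Rightarrow> 'k) \<Rightarrow> bool" where
  "intertwiner Q d d' x y F \<longleftrightarrow> (\<forall>a\<in>arrows Q. \<forall>r<d' (tgt Q a). \<forall>c<d (src Q a).
     (\<Sum>q<d (tgt Q a). F (tgt Q a, r, q) * x (a, q, c)) = (\<Sum>q<d' (src Q a). y (a, r, q) * F (src Q a, q, c)))"

definition block_index :: "'e quiver \<Rightarrow> (nat \<Rightarrow> nat) \<Rightarrow> (nat \<Rightarrow> nat) \<Rightarrow> (nat \<times> nat \<times> nat) set" where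
  "block_index Q d d' = {(i, r, c). i < num_verts Q \<and> r < d' i \<and> c < d i}"

lemma linear_on_block_map: "linear_on UNIV (block_map Q d d' F)"
  by (auto simp: linear_on_def block_map_def fscale_def fun_eq_iff algebra_simps sum.distrib sum_distrib_left)

lemma block_map_total_space: "block_map Q d d' F v \<in> total_space Q d'"
  by (auto simp: block_map_def total_space_def split: if_splits)

lemma block_map_vertex_act: "block_map Q d d' F (vertex_act i v) = vertex_act i (block_map Q d d' F v)"
  by (auto simp: block_map_def vertex_act_def fun_eq_iff)

lemma block_map_arrow_act:
  assumes fq: "finite_quiver Q" and a: "a \<in> arrows Q" and F: "intertwiner Q d d' x y F"
  shows "block_map Q d d' F (arrow_act Q d x a v) = arrow_act Q d' y a (block_map Q d d' F v)"
proof
  fix p :: "nat \<times> nat"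
  obtain i r where p: "p = (i, r)" by (cases p)
  let ?s = "src Q a" and ?t = "tgt Q a"
  have st: "?s < num_verts Q" "?t < num_verts Q" using fq a by (auto simp: finite_quiver_def)
  show "block_map Q d d' F (arrow_act Q d x a v) p = arrow_act Q d' y a (block_map Q d d' F v) p"
  proof (cases "i = ?t \<and> r < d' ?t")
    case True
    have "block_map Q d d' F (arrow_act Q d x a v) p =
        (\<Sum>q<d ?t. F (?t, r, q) * (\<Sum>c<d ?s. x (a, q, c) * v (?s, c)))"
      using True st by (simp add: p block_map_def arrow_act_def)
    also have "\<dots> = (\<Sum>q<d ?t. \<Sum>c<d ?s. F (?t, r, q) * x (a, q, c) * v (?s, c))"
      by (simp add: sum_distrib_left mult.assoc)
    also have "\<dots> = (\<Sum>c<d ?s. (\<Sum>q<d ?t. F (?t, r, q) * x (a, q, c)) * v (?s, c))"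
      by (subst sum.swap) (simp add: sum_distrib_right)
    also have "\<dots> = (\<Sum>c<d ?s. (\<Sum>q<d' ?s. y (a, r, q) * F (?s, q, c)) * v (?s, c))"
      using F a True by (simp add: intertwiner_def)
    also have "\<dots> = (\<Sum>q<d' ?s. \<Sum>c<d ?s. y (a, r, q) * (F (?s, q, c) * v (?s, c)))"
      by (subst sum.swap) (simp add: sum_distrib_right mult.assoc)
    also have "\<dots> = arrow_act Q d' y a (block_map Q d d' F v) p"
      using True st by (simp add: p block_map_def arrow_act_def sum_distrib_left)
    finally show ?thesis .
  next
    case False
    then show ?thesis by (cases "i = ?t") (auto simp: p block_map_def arrow_act_def)
  qed
qed

lemma block_map_path_act:
  assumes fq: "finite_quiver Q" and F: "intertwiner Q d d' x y F" and p: "is_path Q p"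
  shows "block_map Q d d' F (path_act Q d x p v) = path_act Q d' y p (block_map Q d d' F v)"
proof -
  obtain t as s where p_eq: "p = (t, as, s)" by (cases p)
  show ?thesis
    using p unfolding p_eq
    by (induction as arbitrary: t) (auto simp: block_map_vertex_act block_map_arrow_act[OF fq _ F])
qed

lemma block_map_path_algebra_act:
  assumes fq: "finite_quiver Q" and F: "intertwiner Q d d' x y F" and w: "w \<in> path_algebra Q"
  shows "block_map Q d d' F (path_algebra_act Q d x w v) = path_algebra_act Q d' y w (block_map Q d d' F v)"
  unfolding path_algebra_act_def
  by (subst linear_on_sum[OF fam.subspace_UNIV linear_on_block_map])
    (auto simp: linear_on_UNIV_D(2)[OF linear_on_block_map] block_map_path_act[OF fq F path_algebra_is_path[OF w]]
      simp del: path_act.simps intro!: sum.cong)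

text \<open>Relations pass to quotients: an element of \<open>I\<close> acts as zero on the source
  and hence on everything hit by the intertwiner.\<close>

lemma block_map_in_rep_points:
  fixes x y :: "'e \<times> nat \<times> nat \<Rightarrow> 'k::field"
  assumes fq: "finite_quiver Q" and I: "I \<subseteq> path_algebra Q" and x: "x \<in> rep_points Q I d"
    and y: "y \<in> affine_space (rep_coords Q d')" and F: "intertwiner Q d d' x y F"
    and surj: "total_space Q d' \<subseteq> block_map Q d d' F ` total_space Q d"
  shows "y \<in> rep_points Q I d'"
  unfolding rep_points_def
proof (intro CollectI conjI y ballI)
  fix w and v :: "'k fam" assume w: "w \<in> I" and "v \<in> total_space Q d'"
  then obtain u where u: "u \<in> total_space Q d" "v = block_map Q d d' F u" using surj by blast
  have "path_algebra_act Q d x w u = 0" using x w u(1) by (simp add: rep_points_def)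
  then show "path_algebra_act Q d' y w v = 0"
    using block_map_path_algebra_act[OF fq F subsetD[OF I w], of u] u(2)
      linear_on_UNIV_D(3)[OF linear_on_block_map, of Q d d' F] by simp
qed

section \<open>Points as modules over a fixed presented algebra\<close>

locale bound_quiver_algebra =
  fixes scl :: "'k::alg_closed_field \<Rightarrow> 'a::ring_1 \<Rightarrow> 'a"
    and Q :: "'e quiver"
    and I :: "('e path \<Rightarrow> 'k) set"
    and \<phi> :: "('e path \<Rightarrow> 'k) \<Rightarrow> 'a"
  assumes alg: "finite_dimensional_algebra scl"
    and pres: "bound_quiver_presentation scl Q I \<phi>"
begin

abbreviation "pm \<equiv> point_module Q \<phi>"

lemma alg_k: "k_algebra scl"
  using alg by (simp add: finite_dimensional_algebra_def)

sublocale k_algebra scl by (rule alg_k)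

lemma fq: "finite_quiver Q"
  and phi_add: "w \<in> path_algebra Q \<Longrightarrow> u \<in> path_algebra Q \<Longrightarrow> \<phi> (w + u) = \<phi> w + \<phi> u"
  and phi_scale: "w \<in> path_algebra Q \<Longrightarrow> \<phi> (fscale c w) = scl c (\<phi> w)"
  and phi_mult: "w \<in> path_algebra Q \<Longrightarrow> u \<in> path_algebra Q \<Longrightarrow> \<phi> (path_mult Q w u) = \<phi> w * \<phi> u"
  and phi_one: "\<phi> (path_one Q) = 1"
  and phi_surj: "\<phi> ` path_algebra Q = UNIV"
  and ideal_eq: "I = {w \<in> path_algebra Q. \<phi> w = 0}"
  using pres unfolding bound_quiver_presentation_def by blast+

lemma ideal_subset: "I \<subseteq> path_algebra Q"
  using ideal_eq by blast

lemma phi_preimage: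
  obtains w where "w \<in> path_algebra Q" "a = \<phi> w"
  using phi_surj by (metis UNIV_I imageE)

text \<open>The chosen preimage and \<open>w\<close> differ by an element of \<open>I\<close>, and
  such elements act as zero at a point of \<open>rep_points\<close>.\<close>

lemma point_module_act:
  assumes x: "x \<in> rep_points Q I d" and w: "w \<in> path_algebra Q" and v: "v \<in> total_space Q d"
  shows "mod_act (pm d x) (\<phi> w) v = path_algebra_act Q d x w v"
proof -
  define w' where "w' = inv_into (path_algebra Q) \<phi> (\<phi> w)"
  have w': "w' \<in> path_algebra Q" "\<phi> w' = \<phi> w"
    using w by (auto simp: w'_def inv_into_into f_inv_into_f)
  have neg: "fscale (- 1) w \<in> path_algebra Q" by (rule fam.subspace_scale[OF subspace_path_algebra w])
  have "\<phi> (w' + fscale (- 1) w) = 0"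
    by (simp only: phi_add[OF w'(1) neg] phi_scale[OF w] w'(2) scale_minus_left scale_one right_minus)
  moreover have "w' + fscale (- 1) w \<in> path_algebra Q"
    by (rule fam.subspace_add[OF subspace_path_algebra w'(1) neg])
  ultimately have "w' + fscale (- 1) w \<in> I" unfolding ideal_eq by blast
  then have "path_algebra_act Q d x (w' + fscale (- 1) w) v = 0" using x v unfolding rep_points_def by blast
  then have "path_algebra_act Q d x w' v + fscale (- 1) (path_algebra_act Q d x w v) = 0"
    unfolding path_algebra_act_add[OF w'(1) neg] path_algebra_act_scale[OF w] .
  then have "path_algebra_act Q d x w' v = path_algebra_act Q d x w v" by simp
  then show ?thesis by (simp add: point_module_def w'_def)
qed

lemma mod_space_point_module: "mod_space (pm d x) = total_space Q d"
  by (simp add: point_module_def)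

lemma left_module_point_module:
  assumes x: "x \<in> rep_points Q I d"
  shows "left_module scl (pm d x)"
  unfolding left_module_def mod_space_point_module
proof (intro conjI allI ballI)
  show "fam.subspace (total_space Q d :: 'k fam set)" by (rule subspace_total_space)
  fix v :: "'k fam" assume v: "v \<in> total_space Q d"
  note act = point_module_act[OF x]
  fix a b :: 'a and c :: 'k
  obtain w where w: "w \<in> path_algebra Q" "a = \<phi> w" by (rule phi_preimage)
  obtain u where u: "u \<in> path_algebra Q" "b = \<phi> u" by (rule phi_preimage)
  have total: "path_algebra_act Q d x w v \<in> total_space Q d" if "w \<in> path_algebra Q" for w
    by (rule path_algebra_act_total_space[OF fq that v])
  show "mod_act (pm d x) a v \<in> total_space Q d"
    using w total by (simp add: act v)
  show "mod_act (pm d x) a (v + v') = mod_act (pm d x) a v + mod_act (pm d x) a v'"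
    if v': "v' \<in> total_space Q d" for v'
    using w v v' fam.subspace_add[OF subspace_total_space v v']
    by (simp add: act linear_on_UNIV_D(1)[OF linear_on_path_algebra_act])
  have "mod_act (pm d x) (\<phi> (w + u)) v = path_algebra_act Q d x w v + path_algebra_act Q d x u v"
    using w u v by (simp add: act path_algebra_act_add fam.subspace_add[OF subspace_path_algebra] del: plus_fun_apply)
  then show "mod_act (pm d x) (a + b) v = mod_act (pm d x) a v + mod_act (pm d x) b v"
    using w u v by (simp add: act phi_add)
  have "mod_act (pm d x) (\<phi> (path_mult Q w u)) v = path_algebra_act Q d x w (path_algebra_act Q d x u v)"
    using w u v by (simp add: act path_mult_act[OF fq])
  then show "mod_act (pm d x) (a * b) v = mod_act (pm d x) a (mod_act (pm d x) b v)"
    using w u v total by (simp add: act phi_mult)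
  show "mod_act (pm d x) 1 v = v"
    using act[OF path_one_in_path_algebra v] path_algebra_act_one[OF v] by (simp add: phi_one)
  have "mod_act (pm d x) (\<phi> (fscale c (path_one Q))) v = fscale c v"
    using act[OF fam.subspace_scale[OF subspace_path_algebra path_one_in_path_algebra] v]
    by (simp add: path_algebra_act_scale[OF path_one_in_path_algebra] path_algebra_act_one[OF v])
  then show "mod_act (pm d x) (scl c 1) v = fscale c v"
    by (simp add: phi_scale[OF path_one_in_path_algebra] phi_one)
qed

lemma fg_module_point_module:
  assumes x: "x \<in> rep_points Q I d"
  shows "fg_module scl (pm d x)"
  unfolding fg_module_iff[OF alg] mod_space_point_module
  using left_module_point_module[OF x] finite_dim_total_space by blast

lemma intertwiner_Hom:
  assumes x: "x \<in> rep_points Q I d" and y: "y \<in> rep_points Q I d'" and F: "intertwiner Q d d' x y F"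
  shows "(\<lambda>v. if v \<in> total_space Q d then block_map Q d d' F v else 0) \<in> Hom (pm d x) (pm d' y)"
proof (rule HomI, unfold mod_space_point_module)
  fix a and v :: "'k fam" assume v: "v \<in> total_space Q d"
  obtain w where w: "w \<in> path_algebra Q" "a = \<phi> w" by (rule phi_preimage)
  have "path_algebra_act Q d x w v \<in> total_space Q d" by (rule path_algebra_act_total_space[OF fq w(1) v])
  then show "(if mod_act (pm d x) a v \<in> total_space Q d then block_map Q d d' F (mod_act (pm d x) a v) else 0) =
      mod_act (pm d' y) a (if v \<in> total_space Q d then block_map Q d d' F v else 0)"
    using v w by (simp add: point_module_act[OF x] point_module_act[OF y] block_map_total_space
        block_map_path_algebra_act[OF fq F])
qed (simp_all add: block_map_total_space linear_on_UNIV_D(1)[OF linear_on_block_map]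
      fam.subspace_add[OF subspace_total_space] del: plus_fun_apply)

text \<open>Commuting with the trivial paths makes \<open>f\<close> block diagonal along the
  vertices; commuting with the arrows gives the equations for its blocks.\<close>

lemma Hom_intertwiner:
  assumes x: "x \<in> rep_points Q I d" and y: "y \<in> rep_points Q I d'" and f: "f \<in> Hom (pm d x) (pm d' y)"
  obtains F where "intertwiner Q d d' x y F" "\<And>v. v \<in> total_space Q d \<Longrightarrow> f v = block_map Q d d' F v"
proof -
  define F where "F = (\<lambda>(i, r, c). f (unit_fam (i, c)) (i, r))"
  note fD = HomD[OF f, unfolded mod_space_point_module]
  have comm: "f (path_act Q d x p v) = path_act Q d' y p (f v)" if p: "is_path Q p" and v: "v \<in> total_space Q d" for p v
    using fD(4)[OF v, of "\<phi> (unit_fam p)"] v fD(1)[OF v]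
    by (simp add: unit_fam_in_path_algebra[OF p] point_module_act[OF x] point_module_act[OF y] path_algebra_act_unit del: path_act.simps)
  have vertex: "f (vertex_act i v) = vertex_act i (f v)" if "i < num_verts Q" "v \<in> total_space Q d" for i v
    using comm[of "(i, [], i)" v] that by simp
  have arrow: "f (arrow_act Q d x a v) = arrow_act Q d' y a (f v)"
    if a: "a \<in> arrows Q" and v: "v \<in> total_space Q d" for a v
  proof -
    have s: "src Q a < num_verts Q" using fq a by (simp add: finite_quiver_def)
    \<comment> \<open>As a path, the arrow first projects to its source; the arrow reads only that
      component anyway.\<close>
    have *: "arrow_act Q d x a (vertex_act (src Q a) v) = arrow_act Q d x a v" for d x and v :: "'k fam"
      by (auto simp: arrow_act_def vertex_act_def fun_eq_iff)
    show ?thesis using comm[of "(tgt Q a, [a], src Q a)" v] a v s by (simp add: *)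
  qed
  have lin: "linear_on (total_space Q d) f"
    using Hom_linear_on[OF left_module_point_module[OF x] left_module_point_module[OF y] f]
    by (simp add: mod_space_point_module)
  have "f (unit_fam p) = block_map Q d d' F (unit_fam p)" if p: "p \<in> quiver_index Q d" for p
  proof
    fix q :: "nat \<times> nat"
    obtain i c where p_eq: "p = (i, c)" by (cases p)
    obtain j r where q_eq: "q = (j, r)" by (cases q)
    have ic: "i < num_verts Q" "c < d i" using p by (auto simp: quiver_index_def p_eq)
    note u = unit_fam_in_total_space[OF p]
    have "vertex_act i (unit_fam p) = (unit_fam p :: 'k fam)"
      by (auto simp: vertex_act_def unit_fam_def p_eq fun_eq_iff)
    then have "f (unit_fam p) (j, r) = vertex_act i (f (unit_fam p)) (j, r)" using vertex[OF ic(1) u] by simp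
    then have zero: "f (unit_fam p) (j, r) = 0" if "j \<noteq> i" using that by (simp add: vertex_act_def)
    have "block_map Q d d' F (unit_fam p) (j, r) =
        (if j < num_verts Q \<and> r < d' j \<and> j = i then f (unit_fam p) (j, r) else 0)"
      using ic(2) by (auto simp: block_map_def F_def unit_fam_apply p_eq if_distrib[of "times _"] cong: if_cong)
    also have "\<dots> = f (unit_fam p) (j, r)"
      using zero ic total_space_outside[OF fD(1)[OF u], of "(j, r)"] by (auto simp: quiver_index_def)
    finally show "f (unit_fam p) q = block_map Q d d' F (unit_fam p) q" by (simp add: q_eq)
  qed
  from linear_on_total_space_eqI[OF lin linear_on_subset[OF linear_on_block_map subset_UNIV] this]
  have f_eq: "f v = block_map Q d d' F v" if "v \<in> total_space Q d" for v using that by blast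
  have "intertwiner Q d d' x y F"
    unfolding intertwiner_def
  proof (intro ballI allI impI)
    fix a r c assume a: "a \<in> arrows Q" and r: "r < d' (tgt Q a)" and c: "c < d (src Q a)"
    let ?s = "src Q a" and ?t = "tgt Q a"
    have st: "?s < num_verts Q" "?t < num_verts Q" using fq a by (auto simp: finite_quiver_def)
    have u: "unit_fam (?s, c) \<in> total_space Q d"
      by (rule unit_fam_in_total_space) (use st c in \<open>simp add: quiver_index_def\<close>)
    have val: "arrow_act Q d x a (unit_fam (?s, c)) (?t, q) = x (a, q, c)" if "q < d ?t" for q
      using that c by (simp add: arrow_act_def unit_fam_apply if_distrib[of "times _"] cong: if_cong)
    have "f (arrow_act Q d x a (unit_fam (?s, c))) (?t, r) = (\<Sum>q<d ?t. F (?t, r, q) * x (a, q, c))"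
      using st r val by (simp add: f_eq arrow_act_total_space[OF fq a] block_map_def)
    moreover have "arrow_act Q d' y a (f (unit_fam (?s, c))) (?t, r) = (\<Sum>q<d' ?s. y (a, r, q) * F (?s, q, c))"
      using r by (simp add: arrow_act_def F_def)
    ultimately show "(\<Sum>q<d ?t. F (?t, r, q) * x (a, q, c)) = (\<Sum>q<d' ?s. y (a, r, q) * F (?s, q, c))"
      using arrow[OF a u] by simp
  qed
  then show ?thesis by (rule that[OF _ f_eq])
qed

text \<open>Values of \<open>F\<close> outside \<open>block_index\<close> are arbitrary and do not
  influence the map, so vanishing has to be tested on this index set.\<close>

lemma block_map_zero_iff:
  fixes F :: "nat \<times> nat \<times> nat \<Rightarrow> 'k"
  shows "(\<forall>v\<in>total_space Q d. block_map Q d d' F v = 0) \<longleftrightarrow> (\<forall>\<kappa>\<in>block_index Q d d'. F \<kappa> = 0)"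
proof (intro iffI ballI)
  fix \<kappa> assume zero: "\<forall>v\<in>total_space Q d. block_map Q d d' F v = 0" and "\<kappa> \<in> block_index Q d d'"
  then obtain i r c where \<kappa>: "\<kappa> = (i, r, c)" "i < num_verts Q" "r < d' i" "c < d i"
    by (auto simp: block_index_def)
  have "(unit_fam (i, c) :: 'k fam) \<in> total_space Q d"
    by (rule unit_fam_in_total_space) (use \<kappa> in \<open>simp add: quiver_index_def\<close>)
  then have "block_map Q d d' F (unit_fam (i, c)) (i, r) = 0" using zero by simp
  moreover have "block_map Q d d' F (unit_fam (i, c)) (i, r) = F (i, r, c)"
    using \<kappa> by (simp add: block_map_def unit_fam_apply if_distrib[of "times _"] cong: if_cong)
  ultimately show "F \<kappa> = 0" using \<kappa> by simp
next
  fix v :: "'k fam" assume "\<forall>\<kappa>\<in>block_index Q d d'. F \<kappa> = 0"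
  then show "block_map Q d d' F v = 0"
    by (auto simp: block_map_def block_index_def fun_eq_iff intro!: sum.neutral)
qed

lemma Hom_point_module_zero_iff:
  assumes x: "x \<in> rep_points Q I d" and y: "y \<in> rep_points Q I d'"
  shows "Hom (pm d x) (pm d' y) = {0} \<longleftrightarrow> (\<forall>F. intertwiner Q d d' x y F \<longrightarrow> (\<forall>\<kappa>\<in>block_index Q d d'. F \<kappa> = 0))"
proof (intro iffI allI impI)
  fix F assume Hom: "Hom (pm d x) (pm d' y) = {0}" and "intertwiner Q d d' x y F"
  then have eq: "(\<lambda>v. if v \<in> total_space Q d then block_map Q d d' F v else 0) = 0"
    using intertwiner_Hom[OF x y] by blast
  then have "block_map Q d d' F v = 0" if "v \<in> total_space Q d" for v
    using fun_cong[OF eq, of v] that by simp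
  then have "\<forall>v\<in>total_space Q d. block_map Q d d' F v = 0" by blast
  then show "\<forall>\<kappa>\<in>block_index Q d d'. F \<kappa> = 0" by (simp add: block_map_zero_iff)
next
  assume zero: "\<forall>F. intertwiner Q d d' x y F \<longrightarrow> (\<forall>\<kappa>\<in>block_index Q d d'. F \<kappa> = 0)"
  have "f = 0" if f: "f \<in> Hom (pm d x) (pm d' y)" for f
  proof
    fix v
    obtain F where F: "intertwiner Q d d' x y F" "\<And>v. v \<in> total_space Q d \<Longrightarrow> f v = block_map Q d d' F v"
      by (rule Hom_intertwiner[OF x y f]) blast
    then have "\<forall>v\<in>total_space Q d. block_map Q d d' F v = 0" using zero by (simp add: block_map_zero_iff)
    then show "f v = 0 v"
      using F(2) HomD(2)[OF f] by (cases "v \<in> total_space Q d") (auto simp: mod_space_point_module)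
  qed
  then show "Hom (pm d x) (pm d' y) = {0}"
    using Hom_eq_zero_iff[OF left_module_point_module[OF x] left_module_point_module[OF y]] by blast
qed

text \<open>Source and target have the same finite dimensional total space, so injectivity already
  gives bijectivity.\<close>

lemma intertwiner_iso:
  assumes x: "x \<in> rep_points Q I d" and y: "y \<in> rep_points Q I d" and F: "intertwiner Q d d x y F"
    and inj: "\<And>v. v \<in> total_space Q d \<Longrightarrow> block_map Q d d F v = 0 \<Longrightarrow> v = 0"
  shows "module_iso (pm d x) (pm d y)"
proof -
  let ?V = "total_space Q d :: 'k fam set" and ?f = "block_map Q d d F"
  have lin: "linear_on ?V ?f" using linear_on_subset[OF linear_on_block_map subset_UNIV] .
  have surj: "?f ` ?V = ?V"
    by (rule injective_endo_surjective[OF subspace_total_space finite_dim_total_space lin _ inj])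
      (auto simp: block_map_total_space)
  have "inj_on ?f ?V"
  proof (rule inj_onI)
    fix v w assume v: "v \<in> ?V" "w \<in> ?V" "?f v = ?f w"
    have "v + fscale (- 1) w \<in> ?V"
      using v fam.subspace_add[OF subspace_total_space] fam.subspace_scale[OF subspace_total_space] by blast
    moreover have "?f (v + fscale (- 1) w) = 0"
      unfolding linear_on_UNIV_D(1,2)[OF linear_on_block_map] v(3) by simp
    ultimately have "v + fscale (- 1) w = 0" using inj by blast
    then show "v = w" by simp
  qed
  then have "bij_betw (\<lambda>v. if v \<in> ?V then ?f v else 0) ?V ?V"
    using surj by (simp add: bij_betw_def inj_on_def image_def)
  then show ?thesis
    using intertwiner_Hom[OF x y F] unfolding module_iso_def mod_space_point_module by blast
qed

end

section \<open>Every finitely generated module comes from a point\<close>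

context bound_quiver_algebra
begin

lemma phi_zero: "\<phi> 0 = 0"
proof -
  have "\<phi> (0 + 0) = \<phi> 0 + \<phi> 0"
    using fam.subspace_0[OF subspace_path_algebra] by (intro phi_add) blast+
  then show ?thesis by simp
qed

lemma phi_sum:
  assumes "\<And>i. i \<in> A \<Longrightarrow> w i \<in> path_algebra Q"
  shows "\<phi> (\<Sum>i\<in>A. w i) = (\<Sum>i\<in>A. \<phi> (w i))"
  using assms
proof (induction A rule: infinite_finite_induct)
  case (insert i A)
  have "sum w A \<in> path_algebra Q" using insert by (intro fam.subspace_sum[OF subspace_path_algebra]) auto
  then show ?case using insert by (simp add: phi_add del: plus_fun_apply)
qed (simp_all add: phi_zero del: zero_fun_apply)

text \<open>A module \<open>M\<close> decomposes as the direct sum of the spaces \<open>M\<^sub>i = e\<^sub>i M\<close>, where \<open>e\<^sub>i\<close> is the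
  trivial path at \<open>i\<close>. The matrices of the arrows in bases of these spaces form the point.\<close>

lemma module_iso_point_module:
  fixes M :: "('a, 'k) lmodule"
  assumes fg: "fg_module scl M"
  obtains d x where "x \<in> rep_points Q I d" "module_iso (pm d x) M"
    "\<And>i. num_verts Q \<le> i \<Longrightarrow> d i = 0" "\<And>i. d i \<le> fam.dim (mod_space M)"
proof -
  let ?V = "mod_space M" and ?n = "num_verts Q"
  have M: "left_module scl M" and fd: "finite_dim ?V" using fg fg_module_iff[OF alg] by auto
  note sub = left_moduleD(1)[OF M]
  define A where "A p = mod_act M (\<phi> (unit_fam p))" for p :: "'e path"
  define e where "e i = A (i, [], i)" for i
  note lin = act_linear_on[OF M alg_k]
  have act_zero: "mod_act M 0 v = 0" if "v \<in> ?V" for v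
    using act_scl[OF M alg_k that, of 0 0] by simp
  have A_V: "A p v \<in> ?V" if "v \<in> ?V" for p v using that left_moduleD(2)[OF M] by (simp add: A_def)
  have A_lin: "linear_on ?V (A p)" for p unfolding A_def by (rule lin)
  have A_comp: "A (t, as, j) (A (j', bs, s) v) = (if j = j' then A (t, as @ bs, s) v else 0)"
    if "v \<in> ?V" "is_path Q (t, as, j)" "is_path Q (j', bs, s)" for t as j j' bs s v
  proof -
    have j: "j < ?n" using is_path_source[OF fq that(2)] .
    have "A (t, as, j) (A (j', bs, s) v) = mod_act M (\<phi> (path_mult Q (unit_fam (t, as, j)) (unit_fam (j', bs, s)))) v"
      using left_moduleD(5)[OF M that(1)]
      by (simp add: A_def phi_mult[OF unit_fam_in_path_algebra[OF that(2)] unit_fam_in_path_algebra[OF that(3)]])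
    then show ?thesis
      unfolding path_mult_unit[OF j] using act_zero[OF that(1)] by (simp add: A_def phi_zero)
  qed
  have e_V: "e i v \<in> ?V" if "v \<in> ?V" for i v using that A_V by (simp add: e_def)
  have e_e: "e i (e j v) = (if i = j then e i v else 0)" if "v \<in> ?V" "i < ?n" "j < ?n" for i j v
    using A_comp[OF that(1), of i "[]" i j "[]" j] that by (simp add: e_def)
  have e_lin: "linear_on ?V (e i)" for i unfolding e_def by (rule A_lin)
  have sum_e: "(\<Sum>i<?n. e i v) = v" if v: "v \<in> ?V" for v
  proof -
    have act_sum: "mod_act M (\<Sum>i\<in>J. a i) v = (\<Sum>i\<in>J. mod_act M (a i) v)" for J :: "nat set" and a
      by (induction J rule: infinite_finite_induct)
        (auto simp: act_zero[OF v] left_moduleD(4)[OF M v] simp del: zero_fun_apply plus_fun_apply)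
    have "1 = (\<Sum>i<?n. \<phi> (unit_fam (i, [], i)))"
      using phi_one unfolding path_one_eq by (subst (asm) phi_sum) (auto intro: unit_fam_in_path_algebra)
    then show ?thesis using left_moduleD(6)[OF M v] act_sum[of "\<lambda>i. \<phi> (unit_fam (i, [], i))" "{..<?n}"] by (simp add: e_def A_def)
  qed
  \<comment> \<open>As \<open>e i\<close> is idempotent, its image is the set of its fixed
    vectors.\<close>
  define Ms where "Ms i = {v \<in> ?V. e i v = v}" for i
  have Ms_V: "Ms i \<subseteq> ?V" for i by (auto simp: Ms_def)
  have e_Ms: "e i v \<in> Ms i" if "v \<in> ?V" "i < ?n" for i v
    using that e_V e_e by (simp add: Ms_def)
  have e_Ms': "e i v = (if i = j then v else 0)" if "v \<in> Ms j" "i < ?n" "j < ?n" for i j v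
    using that e_e[of v i j] by (auto simp: Ms_def)
  define B where "B i = (SOME B. B \<subseteq> Ms i \<and> fam.independent B \<and> Ms i \<subseteq> fam.span B)" for i
  have B: "B i \<subseteq> Ms i" "fam.independent (B i)" "Ms i \<subseteq> fam.span (B i)" for i
  proof -
    have "\<exists>B. B \<subseteq> Ms i \<and> fam.independent B \<and> Ms i \<subseteq> fam.span B"
      using fam.maximal_independent_subset[of "Ms i"] by metis
    from someI_ex[OF this] show "B i \<subseteq> Ms i" "fam.independent (B i)" "Ms i \<subseteq> fam.span (B i)"
      unfolding B_def by auto
  qed
  have B_V: "B i \<subseteq> ?V" for i using B(1) Ms_V by blast
  have fin: "finite (B i)" for i by (rule finite_independent_subset[OF fd B(2) B_V])
  \<comment> \<open>The value 0 beyond the vertices leaves only finitely many dimension vectors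
    below a given bound, as the later pigeonhole argument requires.\<close>
  define d where "d i = (if i < ?n then card (B i) else 0)" for i
  obtain b where b: "\<And>i. bij_betw (b i) {0..<card (B i)} (B i)"
    using ex_bij_betw_nat_finite[OF fin] by metis
  have b_bij: "bij_betw (b i) {..<d i} (B i)" if "i < ?n" for i
    using b[of i] that by (simp add: d_def atLeast0LessThan)
  have b_Ms: "b i r \<in> Ms i" if "(i, r) \<in> quiver_index Q d" for i r
    using b_bij[of i] that B(1)[of i] by (auto simp: quiver_index_def bij_betw_def)
  then have b_V: "b i r \<in> ?V" if "(i, r) \<in> quiver_index Q d" for i r
    using that Ms_V by blast
  define co where "co i v r = fam.representation (B i) v (b i r)" for i v r
  have expand: "(\<Sum>r<d i. fscale (co i v r) (b i r)) = v" if "v \<in> Ms i" "i < ?n" for i v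
  proof -
    have "(\<Sum>r<d i. fscale (co i v r) (b i r)) = (\<Sum>w\<in>B i. fscale (fam.representation (B i) v w) w)"
      unfolding co_def by (rule sum.reindex_bij_betw[OF b_bij[OF that(2)]])
    also have "\<dots> = v"
      by (rule fam.sum_representation_eq[OF B(2) _ fin order_refl]) (use that B(3) in blast)
    finally show ?thesis .
  qed
  have independent: "c r = 0" if zero: "(\<Sum>r<d i. fscale (c r) (b i r)) = 0" and i: "i < ?n" and r: "r < d i" for c i r
  proof -
    let ?inv = "the_inv_into {..<d i} (b i)"
    have inj: "inj_on (b i) {..<d i}" using b_bij[OF i] by (simp add: bij_betw_def)
    have inv: "?inv (b i r) = r" if "r < d i" for r using the_inv_into_f_f[OF inj] that by simp
    have "(\<Sum>w\<in>B i. fscale (c (?inv w)) w) = (\<Sum>r<d i. fscale (c (?inv (b i r))) (b i r))"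
      by (rule sum.reindex_bij_betw[OF b_bij[OF i], symmetric])
    also have "\<dots> = 0" using zero inv by simp
    finally have "c (?inv (b i r)) = 0"
      using fam.independentD[OF B(2) fin order_refl, where u = "\<lambda>w. c (?inv w)" and v = "b i r"] b_bij[OF i] r
      by (auto simp: bij_betw_def)
    then show ?thesis using inv r by simp
  qed
  \<comment> \<open>The map from coordinates back to \<open>M\<close>: the entries at vertex
    \<open>i\<close> become coefficients in the basis of the component at \<open>i\<close>.\<close>
  define \<psi>i where "\<psi>i i v = (\<Sum>r<d i. fscale (v (i, r)) (b i r))" for i and v :: "'k fam"
  define \<psi> where "\<psi> v = (\<Sum>i<?n. \<psi>i i v)" for v
  have \<psi>i_lin: "linear_on UNIV (\<psi>i i)" for i
    by (auto simp: linear_on_def \<psi>i_def fam.scale_left_distrib sum.distrib fam.scale_sum_right)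
      (simp add: fscale_def mult.assoc)
  have \<psi>_lin: "linear_on UNIV \<psi>"
    using \<psi>i_lin unfolding linear_on_def \<psi>_def by (simp add: sum.distrib fam.scale_sum_right)
  have \<psi>i_Ms: "\<psi>i i v \<in> Ms i" if i: "i < ?n" for i v
  proof -
    have bV: "b i r \<in> ?V" "e i (b i r) = b i r" if "r < d i" for r
      using b_Ms[of i r] that i by (auto simp: Ms_def quiver_index_def)
    have "e i (\<psi>i i v) = (\<Sum>r<d i. e i (fscale (v (i, r)) (b i r)))"
      unfolding \<psi>i_def using bV by (intro linear_on_sum[OF sub e_lin] fam.subspace_scale[OF sub]) auto
    also have "\<dots> = \<psi>i i v"
      unfolding \<psi>i_def using bV e_lin[of i] by (intro sum.cong refl) (simp add: linear_on_def)
    finally have "e i (\<psi>i i v) = \<psi>i i v" .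
    moreover have "\<psi>i i v \<in> ?V"
      unfolding \<psi>i_def using bV by (intro fam.subspace_sum[OF sub] fam.subspace_scale[OF sub]) auto
    ultimately show ?thesis by (simp add: Ms_def)
  qed
  have \<psi>i_V: "\<psi>i i v \<in> ?V" if "i < ?n" for i v using \<psi>i_Ms[OF that] Ms_V by blast
  have \<psi>_V: "\<psi> v \<in> ?V" for v
    unfolding \<psi>_def by (rule fam.subspace_sum[OF sub]) (simp add: \<psi>i_V)
  have e_\<psi>: "e i (\<psi> v) = \<psi>i i v" if i: "i < ?n" for i v
  proof -
    have "e i (\<psi> v) = (\<Sum>j<?n. e i (\<psi>i j v))"
      unfolding \<psi>_def by (rule linear_on_sum[OF sub e_lin]) (simp add: \<psi>i_V)
    also have "\<dots> = (\<Sum>j<?n. if j = i then \<psi>i i v else 0)"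
      using e_Ms'[OF \<psi>i_Ms i] by (intro sum.cong refl) auto
    finally show ?thesis using i by simp
  qed
  define x where "x = (\<lambda>(a, r, c). if (a, r, c) \<in> rep_coords Q d
    then co (tgt Q a) (A (tgt Q a, [a], src Q a) (b (src Q a) c)) r else 0)"
  have x_affine: "x \<in> affine_space (rep_coords Q d)"
    by (auto simp: affine_space_def x_def)
  have \<psi>_vertex: "\<psi> (vertex_act i v) = e i (\<psi> v)" if i: "i < ?n" for i v
  proof -
    have "\<psi>i j (vertex_act i v) = (if j = i then \<psi>i i v else 0)" for j
      by (simp add: \<psi>i_def vertex_act_def)
    then show ?thesis using e_\<psi>[OF i] i by (simp add: \<psi>_def)
  qed
  have \<psi>_arrow: "\<psi> (arrow_act Q d x a v) = A (tgt Q a, [a], src Q a) (\<psi> v)" if a: "a \<in> arrows Q" for a v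
  proof -
    let ?s = "src Q a" and ?t = "tgt Q a"
    let ?A = "A (?t, [a], ?s)"
    have st: "?s < ?n" "?t < ?n" using fq a by (auto simp: finite_quiver_def)
    have paths: "is_path Q (?t, [a], ?s)" "is_path Q (?s, [], ?s)" "is_path Q (?t, [], ?t)" using a st by auto
    have A_e: "?A (e ?s v) = ?A v" "e ?t (?A v) = ?A v" if "v \<in> ?V" for v
      using A_comp[OF that paths(1,2)] A_comp[OF that paths(3,1)] by (simp_all add: e_def)
    have b_s: "b ?s c \<in> ?V" if "c < d ?s" for c using b_V[of ?s c] that st by (simp add: quiver_index_def)
    have Ab: "?A (b ?s c) \<in> Ms ?t" if "c < d ?s" for c
      using A_e(2)[OF b_s[OF that]] A_V[OF b_s[OF that]] by (simp add: Ms_def)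
    have "\<psi>i j (arrow_act Q d x a v) = (if j = ?t then \<psi>i ?t (arrow_act Q d x a v) else 0)" for j
      by (auto simp: \<psi>i_def arrow_act_def intro!: sum.neutral)
    then have "\<psi> (arrow_act Q d x a v) = (\<Sum>j<?n. if j = ?t then \<psi>i ?t (arrow_act Q d x a v) else 0)"
      unfolding \<psi>_def by (intro sum.cong refl)
    also have "\<dots> = \<psi>i ?t (arrow_act Q d x a v)" using st by simp
    also have "\<dots> = (\<Sum>r<d ?t. \<Sum>c<d ?s. fscale (v (?s, c)) (fscale (co ?t (?A (b ?s c)) r) (b ?t r)))"
      unfolding \<psi>i_def
    proof (intro sum.cong refl)
      fix r assume "r \<in> {..<d ?t}"
      then have "arrow_act Q d x a v (?t, r) = (\<Sum>c<d ?s. co ?t (?A (b ?s c)) r * v (?s, c))"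
        using a by (simp add: arrow_act_def x_def rep_coords_def)
      then show "fscale (arrow_act Q d x a v (?t, r)) (b ?t r) =
          (\<Sum>c<d ?s. fscale (v (?s, c)) (fscale (co ?t (?A (b ?s c)) r) (b ?t r)))"
        by (simp add: fam.scale_sum_left mult.commute)
    qed
    also have "\<dots> = (\<Sum>c<d ?s. fscale (v (?s, c)) (\<Sum>r<d ?t. fscale (co ?t (?A (b ?s c)) r) (b ?t r)))"
      by (subst sum.swap) (simp add: fam.scale_sum_right)
    also have "\<dots> = (\<Sum>c<d ?s. ?A (fscale (v (?s, c)) (b ?s c)))"
      using expand[OF Ab st(2)] A_lin[of "(?t, [a], ?s)"] b_s by (simp add: linear_on_def)
    also have "\<dots> = ?A (\<psi>i ?s v)"
      unfolding \<psi>i_def using b_s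
      by (intro linear_on_sum[OF sub A_lin, symmetric] fam.subspace_scale[OF sub]) auto
    also have "\<dots> = ?A (\<psi> v)" using A_e(1)[OF \<psi>_V] e_\<psi>[OF st(1)] by simp
    finally show ?thesis .
  qed
  have \<psi>_path: "\<psi> (path_act Q d x p v) = A p (\<psi> v)" if "is_path Q p" for p v
  proof -
    obtain t as s where p: "p = (t, as, s)" by (cases p)
    show ?thesis
      using that unfolding p
    proof (induction as arbitrary: t)
      case Nil
      then show ?case using \<psi>_vertex[of s v] by (simp add: e_def)
    next
      case (Cons a as)
      then have a: "a \<in> arrows Q" "tgt Q a = t" "is_path Q (src Q a, as, s)" by auto
      have "A (t, [a], src Q a) (A (src Q a, as, s) (\<psi> v)) = A (t, [a] @ as, s) (\<psi> v)"
        using A_comp[OF \<psi>_V _ a(3), of t "[a]" "src Q a" v] a is_path_target[OF fq a(3)] by simp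
      then show ?case using Cons.IH[OF a(3)] \<psi>_arrow[OF a(1)] a(2) by simp
    qed
  qed
  have \<psi>_act: "\<psi> (path_algebra_act Q d x w v) = mod_act M (\<phi> w) (\<psi> v)" if "w \<in> path_algebra Q" for w v
    using that
  proof (induction rule: path_algebra_induct)
    case zero
    then show ?case
      using act_zero[OF \<psi>_V] linear_on_UNIV_D(3)[OF \<psi>_lin]
      by (simp add: path_algebra_act_zero phi_zero del: zero_fun_apply)
  next
    case (add c p w)
    note p = unit_fam_in_path_algebra[OF add(1)]
    show ?case
      using add(2,3) \<psi>_path[OF add(1)]
      by (simp add: p phi_add phi_scale fam.subspace_scale[OF subspace_path_algebra] path_algebra_act_add
          path_algebra_act_scale path_algebra_act_unit linear_on_UNIV_D[OF \<psi>_lin] left_moduleD(4)[OF M \<psi>_V]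
          act_scl[OF M alg_k \<psi>_V] A_def del: plus_fun_apply path_act.simps)
  qed
  have \<psi>_inj: "v = 0" if v: "v \<in> total_space Q d" and zero: "\<psi> v = 0" for v
  proof
    fix q :: "nat \<times> nat"
    obtain i r where q: "q = (i, r)" by (cases q)
    show "v q = 0 q"
    proof (cases "q \<in> quiver_index Q d")
      case True
      then have i: "i < ?n" "r < d i" by (auto simp: quiver_index_def q)
      have "\<psi>i i v = 0" using e_\<psi>[OF i(1), of v] zero linear_on_zero[OF sub e_lin] by simp
      then show ?thesis using independent[of "\<lambda>r. v (i, r)" i r] i by (simp add: \<psi>i_def q)
    qed (simp add: total_space_outside[OF v])
  qed
  have \<psi>_surj: "\<exists>v\<in>total_space Q d. m = \<psi> v" if m: "m \<in> ?V" for m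
  proof
    define v where "v = (\<lambda>(i, r). if (i, r) \<in> quiver_index Q d then co i (e i m) r else 0)"
    show "v \<in> total_space Q d" by (auto simp: total_space_def v_def quiver_index_def)
    have "\<psi>i i v = e i m" if i: "i < ?n" for i
    proof -
      have "\<psi>i i v = (\<Sum>r<d i. fscale (co i (e i m) r) (b i r))"
        unfolding \<psi>i_def using i by (intro sum.cong refl) (simp add: v_def quiver_index_def)
      then show ?thesis using expand[OF e_Ms[OF m i] i] by simp
    qed
    then show "m = \<psi> v" using sum_e[OF m] by (simp add: \<psi>_def)
  qed
  \<comment> \<open>The relations hold in \<open>M\<close>, and \<open>\<psi>\<close> is injective
    and compatible with the actions, so they hold at \<open>x\<close>.\<close>
  have x: "x \<in> rep_points Q I d"
    unfolding rep_points_def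
  proof (intro CollectI conjI x_affine ballI)
    fix w and v :: "'k fam" assume w: "w \<in> I" and v: "v \<in> total_space Q d"
    have wP: "w \<in> path_algebra Q" "\<phi> w = 0" using w ideal_eq by auto
    have "\<psi> (path_algebra_act Q d x w v) = 0" using \<psi>_act[OF wP(1)] act_zero[OF \<psi>_V] wP(2) by simp
    then show "path_algebra_act Q d x w v = 0"
      by (rule \<psi>_inj[OF path_algebra_act_total_space[OF fq wP(1) v]])
  qed
  have "module_iso (pm d x) M"
    unfolding module_iso_def mod_space_point_module
  proof
    define f where "f v = (if v \<in> total_space Q d then \<psi> v else 0)" for v
    show "f \<in> Hom (pm d x) M"
    proof (rule HomI, unfold mod_space_point_module)
      fix a and v :: "'k fam" assume v: "v \<in> total_space Q d"
      obtain w where w: "w \<in> path_algebra Q" "a = \<phi> w" by (rule phi_preimage)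
      show "f (mod_act (pm d x) a v) = mod_act M a (f v)"
        using w v path_algebra_act_total_space[OF fq w(1) v, of x]
        by (simp add: point_module_act[OF x] f_def \<psi>_act)
    qed (auto simp: f_def \<psi>_V linear_on_UNIV_D(1)[OF \<psi>_lin] fam.subspace_add[OF subspace_total_space] simp del: plus_fun_apply)
    have "inj_on \<psi> (total_space Q d)"
    proof (rule inj_onI)
      fix v w assume v: "v \<in> total_space Q d" "w \<in> total_space Q d" "\<psi> v = \<psi> w"
      have "v + fscale (- 1) w \<in> total_space Q d"
        using v fam.subspace_add[OF subspace_total_space] fam.subspace_scale[OF subspace_total_space] by blast
      moreover have "\<psi> (v + fscale (- 1) w) = 0"
        unfolding linear_on_UNIV_D(1,2)[OF \<psi>_lin] v(3) by simp
      ultimately have "v + fscale (- 1) w = 0" by (rule \<psi>_inj)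
      then show "v = w" by simp
    qed
    then have "bij_betw \<psi> (total_space Q d) ?V"
      unfolding bij_betw_def using \<psi>_V \<psi>_surj by blast
    moreover have "f v = \<psi> v" if "v \<in> total_space Q d" for v using that by (simp add: f_def)
    ultimately show "bij_betw f (total_space Q d) ?V" using bij_betw_cong by blast
  qed
  moreover have "d i \<le> fam.dim ?V" for i
    using independent_card_le[OF fd B(2) B_V] by (simp add: d_def)
  ultimately show ?thesis using that[OF x] by (simp add: d_def)
qed

end

section \<open>Semicontinuity\<close>

text \<open>The coefficient of the unknown \<open>F (i, p, q)\<close> in the \<open>(r, c)\<close> entry of the commutation
  relation of the arrow \<open>a\<close>.\<close>

definition hom_coeff :: "'e quiver \<Rightarrow> ('e \<times> nat \<times> nat \<Rightarrow> 'k::field) \<Rightarrow> ('e \<times> nat \<times> nat \<Rightarrow> 'k) \<Rightarrow>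
    'e \<times> nat \<times> nat \<Rightarrow> nat \<times> nat \<times> nat \<Rightarrow> 'k" where
  "hom_coeff Q x y = (\<lambda>(a, r, c) (i, p, q).
     (if i = tgt Q a \<and> p = r then x (a, q, c) else 0) - (if i = src Q a \<and> q = c then y (a, r, p) else 0))"

definition hom_eqs :: "'e quiver \<Rightarrow> (nat \<Rightarrow> nat) \<Rightarrow> (nat \<Rightarrow> nat) \<Rightarrow> ('e \<times> nat \<times> nat) set" where
  "hom_eqs Q d d' = {(a, r, c). a \<in> arrows Q \<and> r < d' (tgt Q a) \<and> c < d (src Q a)}"

lemma finite_block_index: "finite (block_index Q d d')"
proof -
  have "block_index Q d d' = (SIGMA i:{..<num_verts Q}. {..<d' i} \<times> {..<d i})" by (auto simp: block_index_def)
  then show ?thesis by simp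
qed

text \<open>For a loop one unknown can occur on both sides of the commutation relation. The two
  conditions in \<open>hom_coeff\<close> are therefore summed separately and subtracted.\<close>

lemma sum_hom_coeff:
  assumes fq: "finite_quiver Q" and e: "(a, r, c) \<in> hom_eqs Q d d'"
  shows "(\<Sum>\<kappa>\<in>block_index Q d d'. hom_coeff Q x y (a, r, c) \<kappa> * F \<kappa>) =
    (\<Sum>q<d (tgt Q a). F (tgt Q a, r, q) * x (a, q, c)) - (\<Sum>q<d' (src Q a). y (a, r, q) * F (src Q a, q, c))"
proof -
  let ?K = "block_index Q d d'" and ?s = "src Q a" and ?t = "tgt Q a"
  have st: "?s < num_verts Q" "?t < num_verts Q" "r < d' ?t" "c < d ?s"
    using fq e by (auto simp: finite_quiver_def hom_eqs_def)
  have "(\<Sum>\<kappa>\<in>?K. hom_coeff Q x y (a, r, c) \<kappa> * F \<kappa>) =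
      (\<Sum>(i, p, q)\<in>?K. if i = ?t \<and> p = r then F (?t, r, q) * x (a, q, c) else 0) -
      (\<Sum>(i, p, q)\<in>?K. if i = ?s \<and> q = c then y (a, r, p) * F (?s, p, c) else 0)"
    by (auto simp: hom_coeff_def sum_subtractf[symmetric] algebra_simps intro!: sum.cong)
  also have "(\<Sum>(i, p, q)\<in>?K. if i = ?t \<and> p = r then F (?t, r, q) * x (a, q, c) else 0) =
      (\<Sum>(i, p, q)\<in>(\<lambda>q. (?t, r, q)) ` {..<d ?t}. F (?t, r, q) * x (a, q, c))"
    by (intro sum.mono_neutral_cong_right finite_block_index) (use st in \<open>auto simp: block_index_def image_iff\<close>)
  also have "\<dots> = (\<Sum>q<d ?t. F (?t, r, q) * x (a, q, c))"
    by (subst sum.reindex) (auto simp: inj_on_def)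
  also have "(\<Sum>(i, p, q)\<in>?K. if i = ?s \<and> q = c then y (a, r, p) * F (?s, p, c) else 0) =
      (\<Sum>(i, p, q)\<in>(\<lambda>p. (?s, p, c)) ` {..<d' ?s}. y (a, r, p) * F (?s, p, c))"
    by (intro sum.mono_neutral_cong_right finite_block_index) (use st in \<open>auto simp: block_index_def image_iff\<close>)
  also have "\<dots> = (\<Sum>p<d' ?s. y (a, r, p) * F (?s, p, c))"
    by (subst sum.reindex) (auto simp: inj_on_def)
  finally show ?thesis .
qed

lemma intertwiner_iff_system:
  assumes "finite_quiver Q"
  shows "intertwiner Q d d' x y F \<longleftrightarrow>
    (\<forall>e\<in>hom_eqs Q d d'. (\<Sum>\<kappa>\<in>block_index Q d d'. hom_coeff Q x y e \<kappa> * F \<kappa>) = 0)"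
proof -
  have "(\<forall>e\<in>hom_eqs Q d d'. (\<Sum>\<kappa>\<in>block_index Q d d'. hom_coeff Q x y e \<kappa> * F \<kappa>) = 0) \<longleftrightarrow>
      (\<forall>(a, r, c)\<in>hom_eqs Q d d'. (\<Sum>q<d (tgt Q a). F (tgt Q a, r, q) * x (a, q, c)) =
        (\<Sum>q<d' (src Q a). y (a, r, q) * F (src Q a, q, c)))"
    by (intro ball_cong refl) (auto simp: sum_hom_coeff[OF assms])
  also have "\<dots> \<longleftrightarrow> intertwiner Q d d' x y F"
    by (auto simp: intertwiner_def hom_eqs_def)
  finally show ?thesis ..
qed

lemma polyfuns_hom_coeff:
  assumes x: "\<And>j. j \<in> rep_coords Q d \<Longrightarrow> (\<lambda>t. x t j) \<in> polyfuns J"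
    and y: "\<And>j. j \<in> rep_coords Q d' \<Longrightarrow> (\<lambda>t. y t j) \<in> polyfuns J"
    and e: "e \<in> hom_eqs Q d d'" and \<kappa>: "\<kappa> \<in> block_index Q d d'"
  shows "(\<lambda>t. hom_coeff Q (x t) (y t) e \<kappa>) \<in> polyfuns J"
proof -
  obtain a r c where e_eq: "e = (a, r, c)" by (cases e)
  obtain i p q where \<kappa>_eq: "\<kappa> = (i, p, q)" by (cases \<kappa>)
  have "(\<lambda>t. if i = tgt Q a \<and> p = r then x t (a, q, c) else 0) \<in> polyfuns J"
    by (cases "i = tgt Q a \<and> p = r")
      (use e \<kappa> in \<open>auto simp: e_eq \<kappa>_eq hom_eqs_def block_index_def rep_coords_def intro!: x polyfuns.const\<close>)
  moreover have "(\<lambda>t. if i = src Q a \<and> q = c then y t (a, r, p) else 0) \<in> polyfuns J"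
    by (cases "i = src Q a \<and> q = c")
      (use e \<kappa> in \<open>auto simp: e_eq \<kappa>_eq hom_eqs_def block_index_def rep_coords_def intro!: y polyfuns.const\<close>)
  ultimately show ?thesis
    unfolding hom_coeff_def e_eq \<kappa>_eq prod.case by (rule polyfuns_diff)
qed

text \<open>Both points depend polynomially on a parameter \<open>t\<close>, so that one statement
  covers a moving source as well as a moving target. Having only the trivial solution is an open
  condition on \<open>t\<close>, by elimination.\<close>

lemma intertwiner_zero_open:
  assumes fq: "finite_quiver Q"
    and x: "\<And>j. j \<in> rep_coords Q d \<Longrightarrow> (\<lambda>t. x t j) \<in> polyfuns J"
    and y: "\<And>j. j \<in> rep_coords Q d' \<Longrightarrow> (\<lambda>t. y t j) \<in> polyfuns J"
    and zero: "\<And>F. intertwiner Q d d' (x t0) (y t0) F \<Longrightarrow> \<forall>\<kappa>\<in>block_index Q d d'. F \<kappa> = 0"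
  obtains P where "P \<in> polyfuns J" "P t0 \<noteq> 0"
    "\<And>t F. P t \<noteq> 0 \<Longrightarrow> intertwiner Q d d' (x t) (y t) F \<Longrightarrow> \<forall>\<kappa>\<in>block_index Q d d'. F \<kappa> = 0"
proof (rule polynomial_elimination_homogeneous[where L = "\<lambda>e \<kappa> t. hom_coeff Q (x t) (y t) e \<kappa>"
      and K = "block_index Q d d'" and E = "hom_eqs Q d d'" and ?x0.0 = t0 and J = J])
  show "finite (block_index Q d d')" by (rule finite_block_index)
  show "(\<lambda>t. hom_coeff Q (x t) (y t) e \<kappa>) \<in> polyfuns J"
    if "e \<in> hom_eqs Q d d'" "\<kappa> \<in> block_index Q d d'" for e \<kappa>
    by (rule polyfuns_hom_coeff[OF x y that])
  show "\<forall>\<kappa>\<in>block_index Q d d'. g \<kappa> = 0"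
    if "\<forall>e\<in>hom_eqs Q d d'. (\<Sum>\<kappa>\<in>block_index Q d d'. hom_coeff Q (x t0) (y t0) e \<kappa> * g \<kappa>) = 0" for g
    by (rule zero) (use that in \<open>simp add: intertwiner_iff_system[OF fq]\<close>)
qed (use that in \<open>unfold intertwiner_iff_system[OF fq], blast\<close>)

section \<open>Intertwiners near a point with scalar endomorphisms\<close>

lemma block_map_as_sum:
  assumes "i < num_verts Q" "r < d i"
  shows "block_map Q d d F v (i, r) = (\<Sum>(j, c)\<in>quiver_index Q d. (if j = i then F (i, r, c) else 0) * v (j, c))"
proof -
  have "(\<Sum>(j, c)\<in>quiver_index Q d. (if j = i then F (i, r, c) else 0) * v (j, c)) =
      (\<Sum>(j, c)\<in>Pair i ` {..<d i}. F (i, r, c) * v (i, c))"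
    by (intro sum.mono_neutral_cong_right finite_quiver_index) (use assms in \<open>auto simp: quiver_index_def\<close>)
  also have "\<dots> = (\<Sum>c<d i. F (i, r, c) * v (i, c))"
    by (subst sum.reindex) (auto simp: inj_on_def)
  finally show ?thesis using assms by (simp add: block_map_def)
qed

text \<open>If the endomorphisms of the point at \<open>t0\<close> are scalar, elimination of all entries but one gives
  a polynomial formula for the intertwiners at \<open>t\<close>, which specialises to a non-zero scalar at \<open>t0\<close>.\<close>

lemma intertwiner_injective_open:
  fixes x y :: "('j \<Rightarrow> 'k::field) \<Rightarrow> 'e \<times> nat \<times> nat \<Rightarrow> 'k"
  assumes fq: "finite_quiver Q" and i0: "i0 < num_verts Q" "d i0 \<noteq> 0"
    and x: "\<And>j. j \<in> rep_coords Q d \<Longrightarrow> (\<lambda>t. x t j) \<in> polyfuns J"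
    and y: "\<And>j. j \<in> rep_coords Q d \<Longrightarrow> (\<lambda>t. y t j) \<in> polyfuns J"
    and eq: "x t0 = y t0"
    and scalar: "\<And>F. intertwiner Q d d (x t0) (y t0) F \<Longrightarrow>
      \<exists>c. \<forall>i p q. (i, p, q) \<in> block_index Q d d \<longrightarrow> F (i, p, q) = (if p = q then c else 0)"
  obtains P where "P \<in> polyfuns J" "P t0 \<noteq> 0"
    "\<And>t F v. P t \<noteq> 0 \<Longrightarrow> intertwiner Q d d (x t) (y t) F \<Longrightarrow> \<exists>\<kappa>\<in>block_index Q d d. F \<kappa> \<noteq> 0 \<Longrightarrow>
       v \<in> total_space Q d \<Longrightarrow> block_map Q d d F v = 0 \<Longrightarrow> v = 0"
proof -
  let ?K = "block_index Q d d" and ?E = "hom_eqs Q d d"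
  let ?L = "\<lambda>e \<kappa> t. hom_coeff Q (x t) (y t) e \<kappa>"
  \<comment> \<open>The entry that is not eliminated: a diagonal one, at a vertex with non-zero
    dimension, so that a scalar family vanishing there is zero.\<close>
  define \<kappa>1 where "\<kappa>1 = (i0, 0::nat, 0::nat)"
  have \<kappa>1: "\<kappa>1 \<in> ?K" using i0 by (simp add: block_index_def \<kappa>1_def)
  have K: "?K = insert \<kappa>1 (?K - {\<kappa>1})" using \<kappa>1 by blast
  have fin: "finite (?K - {\<kappa>1})" using finite_block_index by blast
  have L_poly: "?L e \<kappa> \<in> polyfuns J" if "e \<in> ?E" "\<kappa> \<in> ?K" for e \<kappa>
    by (rule polyfuns_hom_coeff[OF x y that])
  have row: "(\<Sum>\<kappa>\<in>?K. h \<kappa>) = h \<kappa>1 + (\<Sum>\<kappa>\<in>?K - {\<kappa>1}. h \<kappa>)" for h :: "_ \<Rightarrow> 'k"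
    by (subst K, subst sum.insert) (use fin in auto)
  have L1: "(\<lambda>t. - ?L e \<kappa>1 t) \<in> polyfuns J" if "e \<in> ?E" for e
    by (rule polyfuns_uminus[OF L_poly[OF that \<kappa>1]])
  \<comment> \<open>A solution at \<open>t0\<close>, extended by 0 at \<open>\<kappa>1\<close>, is
    an intertwiner there; it is scalar, and its scalar is the entry at
    \<open>\<kappa>1\<close>.\<close>
  have triv: "\<forall>\<kappa>\<in>?K - {\<kappa>1}. g \<kappa> = 0" if g: "\<forall>e\<in>?E. (\<Sum>\<kappa>\<in>?K - {\<kappa>1}. ?L e \<kappa> t0 * g \<kappa>) = 0" for g
  proof -
    define F where "F = g(\<kappa>1 := 0)"
    have "(\<Sum>\<kappa>\<in>?K - {\<kappa>1}. ?L e \<kappa> t0 * F \<kappa>) = (\<Sum>\<kappa>\<in>?K - {\<kappa>1}. ?L e \<kappa> t0 * g \<kappa>)" for e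
      by (intro sum.cong refl) (simp add: F_def)
    then have "intertwiner Q d d (x t0) (y t0) F"
      unfolding intertwiner_iff_system[OF fq] row using g by (simp add: F_def)
    then obtain c where c: "\<And>i p q. (i, p, q) \<in> ?K \<Longrightarrow> F (i, p, q) = (if p = q then c else 0)"
      using scalar by blast
    have "c = 0" using c[of i0 0 0] \<kappa>1 by (simp add: \<kappa>1_def F_def)
    then have "F \<kappa> = 0" if "\<kappa> \<in> ?K" for \<kappa> using c that by (cases \<kappa>) auto
    then show ?thesis unfolding F_def by (metis DiffE fun_upd_other singletonI)
  qed
  obtain P f where P: "P \<in> polyfuns J" "P t0 \<noteq> 0" and f: "\<And>\<kappa>. \<kappa> \<in> ?K - {\<kappa>1} \<Longrightarrow> f \<kappa> \<in> polyfuns J"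
    and sol: "\<And>t g s \<kappa>. \<forall>e\<in>?E. (\<Sum>\<kappa>\<in>?K - {\<kappa>1}. ?L e \<kappa> t * g \<kappa>) = s * (- ?L e \<kappa>1 t) \<Longrightarrow>
      \<kappa> \<in> ?K - {\<kappa>1} \<Longrightarrow> P t * g \<kappa> = s * f \<kappa> t"
    by (rule polynomial_elimination[where L = ?L and E = ?E and J = J and ?x0.0 = t0
          and M = "\<lambda>e t. - ?L e \<kappa>1 t", OF fin _ L1 triv])
      (use L_poly in \<open>blast+\<close>)
  \<comment> \<open>With the entry \<open>P\<close> at \<open>\<kappa>1\<close>, every intertwiner
    \<open>F\<close> at \<open>t\<close> satisfies \<open>P t * F = F \<kappa>1 * f'\<close>: up to
    a factor there is only one candidate.\<close>
  define f' where "f' = f(\<kappa>1 := P)"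
  have f'_poly: "f' \<kappa> \<in> polyfuns J" if "\<kappa> \<in> ?K" for \<kappa> using that f P by (auto simp: f'_def)
  have sol': "P t * F \<kappa> = F \<kappa>1 * f' \<kappa> t"
    if F: "intertwiner Q d d (x t) (y t) F" and \<kappa>: "\<kappa> \<in> ?K" for t F \<kappa>
  proof (cases "\<kappa> = \<kappa>1")
    case False
    have "\<forall>e\<in>?E. (\<Sum>\<kappa>\<in>?K - {\<kappa>1}. ?L e \<kappa> t * F \<kappa>) = F \<kappa>1 * (- ?L e \<kappa>1 t)"
      using F unfolding intertwiner_iff_system[OF fq] row by (simp add: eq_neg_iff_add_eq_0 add.commute mult.commute)
    from sol[OF this] show ?thesis using False \<kappa> by (simp add: f'_def)
  qed (simp add: f'_def)
  \<comment> \<open>The identity is an intertwiner at \<open>t0\<close>, so the formula gives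
    \<open>P t0\<close> times the identity for \<open>f'\<close> at \<open>t0\<close>.\<close>
  define F0 where "F0 = (\<lambda>(i::nat, p::nat, q::nat). if p = q then 1 else (0::'k))"
  have F0: "intertwiner Q d d (x t0) (y t0) F0"
    unfolding intertwiner_def eq
  proof (intro ballI allI impI)
    fix a r c assume "r < d (tgt Q a)" "c < d (src Q a)"
    then show "(\<Sum>q<d (tgt Q a). F0 (tgt Q a, r, q) * y t0 (a, q, c)) = (\<Sum>q<d (src Q a). y t0 (a, r, q) * F0 (src Q a, q, c))"
      by (simp add: F0_def if_distrib[of "\<lambda>z. z * _"] if_distrib[of "times _"] cong: if_cong)
  qed
  have f'_t0: "f' \<kappa> t0 = P t0 * F0 \<kappa>" if "\<kappa> \<in> ?K" for \<kappa>
    using sol'[OF F0 that] by (simp add: F0_def \<kappa>1_def)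
  let ?I = "quiver_index Q d"
  \<comment> \<open>The matrix of the block map of \<open>f'\<close>, with entries polynomial in
    \<open>t\<close>. It is invertible at \<open>t0\<close>, and a second elimination keeps it
    injective nearby.\<close>
  define L2 where "L2 = (\<lambda>(i, r) (j, c) t. if j = i then f' (i, r, c) t else 0)"
  have L2_sum: "(\<Sum>q\<in>?I. L2 (i, r) q t * v q) = block_map Q d d (\<lambda>\<kappa>. f' \<kappa> t) v (i, r)"
    if "(i, r) \<in> ?I" for i r t v
    using block_map_as_sum[of i Q r d "\<lambda>\<kappa>. f' \<kappa> t" v] that
    by (auto simp: L2_def quiver_index_def split_def intro!: sum.cong)
  obtain P2 where P2: "P2 \<in> polyfuns J" "P2 t0 \<noteq> 0"
    and inj: "\<And>t v q. P2 t \<noteq> 0 \<Longrightarrow> \<forall>e\<in>?I. (\<Sum>q\<in>?I. L2 e q t * v q) = 0 \<Longrightarrow> q \<in> ?I \<Longrightarrow> v q = 0"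
  proof (rule polynomial_elimination_homogeneous[where L = L2 and K = ?I and E = ?I and J = J and ?x0.0 = t0])
    show "finite ?I" by (rule finite_quiver_index)
    show "L2 e q \<in> polyfuns J" if "e \<in> ?I" "q \<in> ?I" for e q
    proof -
      obtain i r where e: "e = (i, r)" by (cases e)
      obtain j c where q: "q = (j, c)" by (cases q)
      show ?thesis
        using that f'_poly[of "(i, r, c)"] unfolding L2_def e q
        by (cases "j = i") (auto simp: quiver_index_def block_index_def intro: polyfuns.const)
    qed
    fix v assume v: "\<forall>e\<in>?I. (\<Sum>q\<in>?I. L2 e q t0 * v q) = 0"
    show "\<forall>q\<in>?I. v q = 0"
    proof
      fix q assume q: "q \<in> ?I"
      obtain i r where q_eq: "q = (i, r)" by (cases q)
      have ir: "i < num_verts Q" "r < d i" using q by (auto simp: q_eq quiver_index_def)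
      have "0 = block_map Q d d (\<lambda>\<kappa>. f' \<kappa> t0) v (i, r)" using L2_sum[of i r t0 v] v q by (simp add: q_eq)
      also have "\<dots> = (\<Sum>c<d i. P t0 * F0 (i, r, c) * v (i, c))"
        using ir by (simp add: block_map_def f'_t0 block_index_def)
      also have "\<dots> = P t0 * v (i, r)"
        using ir by (simp add: F0_def if_distrib[of "times _"] if_distrib[of "\<lambda>z. z * _"] cong: if_cong)
      finally show "v q = 0" using P(2) by (simp add: q_eq)
    qed
  qed blast
  show ?thesis
  proof (rule that[of "\<lambda>t. P t * P2 t"])
    show "(\<lambda>t. P t * P2 t) \<in> polyfuns J" by (rule polyfuns.mult[OF P(1) P2(1)])
    show "P t0 * P2 t0 \<noteq> 0" using P P2 by simp
    fix t F v
    assume PP: "P t * P2 t \<noteq> 0" and F: "intertwiner Q d d (x t) (y t) F" and nz: "\<exists>\<kappa>\<in>?K. F \<kappa> \<noteq> 0"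
      and v: "v \<in> total_space Q d" and zero: "block_map Q d d F v = 0"
    \<comment> \<open>With \<open>F \<kappa>1 = 0\<close> the proportionality to \<open>f'\<close>
      would make all entries of \<open>F\<close> vanish, as \<open>P t\<close> is non-zero.\<close>
    have F1: "F \<kappa>1 \<noteq> 0" using sol'[OF F] nz PP by auto
    have "block_map Q d d (\<lambda>\<kappa>. f' \<kappa> t) v (i, r) = 0" if ir: "(i, r) \<in> ?I" for i r
    proof -
      have ir': "i < num_verts Q" "r < d i" using ir by (auto simp: quiver_index_def)
      have "F \<kappa>1 * block_map Q d d (\<lambda>\<kappa>. f' \<kappa> t) v (i, r) = (\<Sum>c<d i. F \<kappa>1 * f' (i, r, c) t * v (i, c))"
        using ir' by (simp add: block_map_def sum_distrib_left mult.assoc)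
      also have "\<dots> = (\<Sum>c<d i. P t * F (i, r, c) * v (i, c))"
        using ir' sol'[OF F] by (intro sum.cong refl) (simp add: block_index_def)
      also have "\<dots> = P t * block_map Q d d F v (i, r)"
        using ir' by (simp add: block_map_def sum_distrib_left mult.assoc)
      finally show ?thesis using zero F1 by simp
    qed
    then have "\<forall>e\<in>?I. (\<Sum>q\<in>?I. L2 e q t * v q) = 0" using L2_sum by fastforce
    then have "v q = 0" if "q \<in> ?I" for q using inj[of t v q] PP that by auto
    then show "v = 0" using total_space_outside[OF v] by (auto simp: fun_eq_iff)
  qed
qed

section \<open>The action of the general linear group\<close>

lemma polyfuns_comp:
  assumes "f \<in> polyfuns J" and "\<And>j. j \<in> J \<Longrightarrow> (\<lambda>t. y t j) \<in> polyfuns J'"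
  shows "(\<lambda>t. f (y t)) \<in> polyfuns J'"
  using assms(1) by induction (auto intro: polyfuns.intros assms(2))

lemma polyfuns_power: "f \<in> polyfuns J \<Longrightarrow> (\<lambda>x. f x ^ m) \<in> polyfuns J"
  by (induction m) (auto intro: polyfuns.const polyfuns.mult)

text \<open>Clearing denominators: fractions with common denominator \<open>P\<close> are
  substituted for the coordinates, and a power of \<open>P\<close> makes the result polynomial
  again.\<close>

lemma polyfuns_fraction_subst:
  assumes f: "f \<in> polyfuns J" and P: "P \<in> polyfuns J'" and N: "\<And>j. j \<in> J \<Longrightarrow> N j \<in> polyfuns J'"
  shows "\<exists>m. \<exists>T\<in>polyfuns J'. \<forall>t y. (\<forall>j\<in>J. P t * y j = N j t) \<longrightarrow> f y * P t ^ m = T t"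
  using f
proof induction
  case (const c)
  show ?case by (intro exI[of _ 0] bexI[of _ "\<lambda>_. c"]) (auto intro: polyfuns.const)
next
  case (coord j)
  then show ?case by (intro exI[of _ 1] bexI[of _ "N j"]) (auto simp: mult.commute N)
next
  case (add f g)
  then obtain m T m' T' where T: "T \<in> polyfuns J'" "T' \<in> polyfuns J'"
    and eq: "\<And>t y. \<forall>j\<in>J. P t * y j = N j t \<Longrightarrow> f y * P t ^ m = T t"
      "\<And>t y. \<forall>j\<in>J. P t * y j = N j t \<Longrightarrow> g y * P t ^ m' = T' t"
    by blast
  show ?case
  proof (intro exI[of _ "m + m'"] bexI[of _ "\<lambda>t. T t * P t ^ m' + T' t * P t ^ m"] allI impI)
    show "(\<lambda>t. T t * P t ^ m' + T' t * P t ^ m) \<in> polyfuns J'"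
      by (intro polyfuns.add polyfuns.mult T polyfuns_power P)
    fix t y assume "\<forall>j\<in>J. P t * y j = N j t"
    from eq[OF this, symmetric] show "(f y + g y) * P t ^ (m + m') = T t * P t ^ m' + T' t * P t ^ m"
      by (simp add: power_add algebra_simps)
  qed
next
  case (mult f g)
  then obtain m T m' T' where T: "T \<in> polyfuns J'" "T' \<in> polyfuns J'"
    and eq: "\<And>t y. \<forall>j\<in>J. P t * y j = N j t \<Longrightarrow> f y * P t ^ m = T t"
      "\<And>t y. \<forall>j\<in>J. P t * y j = N j t \<Longrightarrow> g y * P t ^ m' = T' t"
    by blast
  show ?case
  proof (intro exI[of _ "m + m'"] bexI[of _ "\<lambda>t. T t * T' t"] allI impI)
    show "(\<lambda>t. T t * T' t) \<in> polyfuns J'" by (intro polyfuns.mult T)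
    fix t y assume "\<forall>j\<in>J. P t * y j = N j t"
    from eq[OF this, symmetric] show "(f y * g y) * P t ^ (m + m') = T t * T' t"
      by (simp add: power_add algebra_simps)
  qed
qed

section \<open>Conjugation by invertible families of matrices\<close>

lemma finite_rep_coords:
  assumes "finite_quiver Q"
  shows "finite (rep_coords Q d)"
proof -
  have "rep_coords Q d = (SIGMA a:arrows Q. {..<d (tgt Q a)} \<times> {..<d (src Q a)})"
    by (auto simp: rep_coords_def)
  then show ?thesis using assms by (simp add: finite_quiver_def)
qed

lemma GL_pairD:
  assumes "GL_pair Q d g h" "i < num_verts Q" "r < d i" "c < d i"
  shows "(\<Sum>q<d i. g i r q * h i q c) = (if r = c then 1 else 0)"
    "(\<Sum>q<d i. h i r q * g i q c) = (if r = c then 1 else 0)"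
  using assms unfolding GL_pair_def by auto

lemma GL_pair_sym: "GL_pair Q d g h \<Longrightarrow> GL_pair Q d h g"
  by (simp add: GL_pair_def)

lemma GL_pair_cancel:
  assumes "GL_pair Q d g h" "i < num_verts Q" "l < d i"
  shows "(\<Sum>r<d i. h i l r * (\<Sum>q<d i. g i r q * G q)) = G l"
proof -
  have "(\<Sum>r<d i. h i l r * (\<Sum>q<d i. g i r q * G q)) = (\<Sum>r<d i. \<Sum>q<d i. h i l r * g i r q * G q)"
    by (simp add: sum_distrib_left mult.assoc)
  also have "\<dots> = (\<Sum>q<d i. (\<Sum>r<d i. h i l r * g i r q) * G q)"
    by (subst sum.swap) (simp add: sum_distrib_right)
  also have "\<dots> = (\<Sum>q<d i. if q = l then G l else 0)"
    using GL_pairD(2)[OF assms] by (intro sum.cong refl) auto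
  finally show ?thesis using assms(3) by simp
qed

lemma GL_pair_inverse_unique:
  assumes g: "GL_pair Q d g h" "GL_pair Q d g h'" and i: "i < num_verts Q" "r < d i" "c < d i"
  shows "h i r c = h' i r c"
proof -
  have "h' i r c = (\<Sum>l<d i. h i r l * (\<Sum>q<d i. g i l q * h' i q c))"
    using GL_pair_cancel[OF g(1) i(1,2), of "\<lambda>q. h' i q c"] by simp
  also have "\<dots> = (\<Sum>l<d i. if l = c then h i r c else 0)"
    using GL_pairD(1)[OF g(2) i(1) _ i(3)] by (intro sum.cong refl) auto
  finally show ?thesis using i(3) by simp
qed

text \<open>Inverses \<open>h\<close> are determined on the relevant entries, and conjugation reads
  no others. This identifies conjugates obtained from two separately chosen inverses of the same
  \<open>g\<close>.\<close>

lemma conj_act_inverse_unique: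
  assumes fq: "finite_quiver Q" and g: "GL_pair Q d g h" "GL_pair Q d g h'"
  shows "conj_act Q d g h x = conj_act Q d g h' x"
proof
  fix j :: "'a \<times> nat \<times> nat"
  obtain a r c where j: "j = (a, r, c)" by (cases j)
  show "conj_act Q d g h x j = conj_act Q d g h' x j"
  proof (cases "j \<in> rep_coords Q d")
    case True
    then have "src Q a < num_verts Q" "c < d (src Q a)"
      using fq by (auto simp: rep_coords_def finite_quiver_def j)
    then show ?thesis
      using GL_pair_inverse_unique[OF g, of "src Q a"] by (simp add: conj_act_def j)
  qed (simp add: conj_act_def j)
qed

lemma gl_orbitI: "GL_pair Q d g h \<Longrightarrow> conj_act Q d g h x \<in> gl_orbit Q d x"
  unfolding gl_orbit_def by blast

lemma conj_act_affine_space: "conj_act Q d g h x \<in> affine_space (rep_coords Q d)"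
  by (auto simp: affine_space_def conj_act_def)

lemma GL_pair_one: "GL_pair Q d (\<lambda>i r c. if r = c then 1 else 0) (\<lambda>i r c. if r = c then 1 else 0)"
  by (simp add: GL_pair_def if_distrib[of "\<lambda>z. z * _"] cong: if_cong)

lemma conj_act_one:
  assumes "x \<in> affine_space (rep_coords Q d)"
  shows "conj_act Q d (\<lambda>i r c. if r = c then 1 else 0) (\<lambda>i r c. if r = c then 1 else 0) x = x"
proof
  fix j :: "'a \<times> nat \<times> nat"
  obtain a r c where j: "j = (a, r, c)" by (cases j)
  show "conj_act Q d (\<lambda>i r c. if r = c then 1 else 0) (\<lambda>i r c. if r = c then 1 else 0) x j = x j"
  proof (cases "j \<in> rep_coords Q d")
    case True
    then have "r < d (tgt Q a)" "c < d (src Q a)" by (auto simp: rep_coords_def j)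
    then show ?thesis
      using True by (simp add: conj_act_def j if_distrib[of "\<lambda>z. z * _"] if_distrib[of "times _"] cong: if_cong)
  qed (use assms in \<open>auto simp: conj_act_def affine_space_def j\<close>)
qed

text \<open>The family \<open>g\<close> itself carries \<open>x\<close> to its conjugate: in the
  product of \<open>g x h\<close> with \<open>g\<close> the inverse cancels at the source.\<close>

lemma GL_intertwiner:
  assumes fq: "finite_quiver Q" and g: "GL_pair Q d g h"
  shows "intertwiner Q d d x (conj_act Q d g h x) (\<lambda>(i, r, c). g i r c)"
  unfolding intertwiner_def prod.case
proof (intro ballI allI impI)
  fix a r c assume a: "a \<in> arrows Q" and r: "r < d (tgt Q a)" and c: "c < d (src Q a)"
  let ?s = "src Q a" and ?t = "tgt Q a"
  have s: "?s < num_verts Q" using fq a by (simp add: finite_quiver_def)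
  have "(\<Sum>q<d ?s. conj_act Q d g h x (a, r, q) * g ?s q c) =
      (\<Sum>q<d ?s. \<Sum>p<d ?t. \<Sum>l<d ?s. g ?t r p * x (a, p, l) * (h ?s l q * g ?s q c))"
    using a r by (simp add: conj_act_def rep_coords_def sum_distrib_right mult.assoc)
  also have "\<dots> = (\<Sum>p<d ?t. \<Sum>l<d ?s. \<Sum>q<d ?s. g ?t r p * x (a, p, l) * (h ?s l q * g ?s q c))"
    by (subst sum.swap, rule sum.cong[OF refl], subst sum.swap, rule refl)
  also have "\<dots> = (\<Sum>p<d ?t. \<Sum>l<d ?s. g ?t r p * x (a, p, l) * (if l = c then 1 else 0))"
    unfolding sum_distrib_left[symmetric] using GL_pairD(2)[OF g s _ c] by (intro sum.cong refl) simp
  also have "\<dots> = (\<Sum>p<d ?t. g ?t r p * x (a, p, c))"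
    using c by (simp add: if_distrib[of "times _"] cong: if_cong)
  finally show "(\<Sum>q<d ?t. g ?t r q * x (a, q, c)) = (\<Sum>q<d ?s. conj_act Q d g h x (a, r, q) * g ?s q c)" ..
qed

lemma GL_block_map_inverse:
  assumes g: "GL_pair Q d g h" and v: "v \<in> total_space Q d"
  shows "block_map Q d d (\<lambda>(i, r, c). g i r c) (block_map Q d d (\<lambda>(i, r, c). h i r c) v) = v"
proof
  fix q :: "nat \<times> nat"
  obtain i r where q: "q = (i, r)" by (cases q)
  show "block_map Q d d (\<lambda>(i, r, c). g i r c) (block_map Q d d (\<lambda>(i, r, c). h i r c) v) q = v q"
  proof (cases "q \<in> quiver_index Q d")
    case True
    then show ?thesis
      using GL_pair_cancel[OF GL_pair_sym[OF g], of i r "\<lambda>c. v (i, c)"]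
      by (simp add: block_map_def q quiver_index_def)
  next
    case False
    then show ?thesis
      using total_space_outside[OF v False] total_space_outside[OF block_map_total_space False] by simp
  qed
qed

text \<open>The columns of \<open>h\<close> are preimages of the unit vectors under the block map,
  which is surjective because it is injective.\<close>

lemma square_right_inverse:
  fixes \<gamma> :: "nat \<times> nat \<times> nat \<Rightarrow> 'k::field"
  assumes inj: "\<And>v. v \<in> total_space Q d \<Longrightarrow> block_map Q d d \<gamma> v = 0 \<Longrightarrow> v = 0"
  shows "\<exists>h. \<forall>i<num_verts Q. \<forall>r<d i. \<forall>c<d i. (\<Sum>q<d i. \<gamma> (i, r, q) * h i q c) = (if r = c then 1 else 0)"
proof -
  have surj: "block_map Q d d \<gamma> ` total_space Q d = total_space Q d"
    by (rule injective_endo_surjective[OF subspace_total_space finite_dim_total_space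
          linear_on_subset[OF linear_on_block_map subset_UNIV] _ inj])
      (auto simp: block_map_total_space)
  have "\<exists>u. block_map Q d d \<gamma> u = unit_fam p" if "p \<in> quiver_index Q d" for p
  proof -
    have "unit_fam p \<in> block_map Q d d \<gamma> ` total_space Q d"
      unfolding surj by (rule unit_fam_in_total_space[OF that])
    then show ?thesis by (metis imageE)
  qed
  then obtain u where u: "\<And>p. p \<in> quiver_index Q d \<Longrightarrow> block_map Q d d \<gamma> (u p) = unit_fam p" by metis
  show ?thesis
  proof (intro exI[of _ "\<lambda>i q c. u (i, c) (i, q)"] allI impI)
    fix i r c assume irc: "i < num_verts Q" "r < d i" "c < d i"
    then have "block_map Q d d \<gamma> (u (i, c)) (i, r) = unit_fam (i, c) (i, r)"
      using u[of "(i, c)"] by (simp add: quiver_index_def)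
    then show "(\<Sum>q<d i. \<gamma> (i, r, q) * u (i, c) (i, q)) = (if r = c then 1 else 0)"
      using irc by (simp add: block_map_def unit_fam_apply)
  qed
qed

text \<open>Cramer's rule without determinants: the inverse of \<open>\<gamma>\<close> has the entries \<open>f \<kappa> \<gamma> / P \<gamma>\<close>.\<close>

lemma GL_local_inverse:
  fixes g1 :: "nat \<Rightarrow> nat \<Rightarrow> nat \<Rightarrow> 'k::field"
  assumes g1: "GL_pair Q d g1 h1"
  obtains P f where "P \<in> polyfuns (block_index Q d d)" "P (\<lambda>(i, r, c). g1 i r c) \<noteq> 0"
    "\<And>\<kappa>. \<kappa> \<in> block_index Q d d \<Longrightarrow> f \<kappa> \<in> polyfuns (block_index Q d d)"
    "\<And>\<gamma>. P \<gamma> \<noteq> 0 \<Longrightarrow> \<exists>h. GL_pair Q d (\<lambda>i r c. \<gamma> (i, r, c)) h"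
    "\<And>\<gamma> h i q c. GL_pair Q d (\<lambda>i r c. \<gamma> (i, r, c)) h \<Longrightarrow> (i, q, c) \<in> block_index Q d d \<Longrightarrow>
       P \<gamma> * h i q c = f (i, q, c) \<gamma>"
proof -
  let ?K = "block_index Q d d"
  define \<gamma>1 where "\<gamma>1 = (\<lambda>(i, r, c). g1 i r c)"
  \<comment> \<open>The matrix equation \<gamma> h = 1 as a linear system for the entries of
    \<open>h\<close>; the right-hand side \<open>M\<close> is the identity matrix.\<close>
  define L where "L = (\<lambda>(i::nat, r::nat, c::nat) (j, q::nat, c') \<gamma>. if j = i \<and> c' = c then \<gamma> (i, r, q) else (0::'k))"
  define M where "M = (\<lambda>(i::nat, r::nat, c::nat) (\<gamma>::nat \<times> nat \<times> nat \<Rightarrow> 'k). if r = c then 1 else (0::'k))"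
  have L_sum: "(\<Sum>\<kappa>\<in>?K. L (i, r, c) \<kappa> \<gamma> * H \<kappa>) = (\<Sum>q<d i. \<gamma> (i, r, q) * H (i, q, c))"
    if "(i, r, c) \<in> ?K" for i r c \<gamma> H
  proof -
    have "(\<Sum>\<kappa>\<in>?K. L (i, r, c) \<kappa> \<gamma> * H \<kappa>) =
        (\<Sum>(j, q, c')\<in>?K. if j = i \<and> c' = c then \<gamma> (i, r, q) * H (i, q, c) else 0)"
      by (auto simp: L_def intro!: sum.cong)
    also have "\<dots> = (\<Sum>(j, q, c')\<in>(\<lambda>q. (i, q, c)) ` {..<d i}. \<gamma> (i, r, q) * H (i, q, c))"
      by (intro sum.mono_neutral_cong_right finite_block_index) (use that in \<open>auto simp: block_index_def image_iff\<close>)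
    also have "\<dots> = (\<Sum>q<d i. \<gamma> (i, r, q) * H (i, q, c))"
      by (subst sum.reindex) (auto simp: inj_on_def)
    finally show ?thesis .
  qed
  have L_poly: "L e \<kappa> \<in> polyfuns ?K" if "e \<in> ?K" "\<kappa> \<in> ?K" for e \<kappa>
  proof -
    obtain i r c where e: "e = (i, r, c)" by (cases e)
    obtain j q c' where \<kappa>: "\<kappa> = (j, q, c')" by (cases \<kappa>)
    show ?thesis
      using that unfolding L_def e \<kappa>
      by (cases "j = i \<and> c' = c") (auto simp: block_index_def intro!: polyfuns.const polyfuns.coord)
  qed
  have M_poly: "M e \<in> polyfuns ?K" for e
    by (cases e) (auto simp: M_def intro: polyfuns.const)
  have triv: "\<forall>\<kappa>\<in>?K. G \<kappa> = 0" if G: "\<forall>e\<in>?K. (\<Sum>\<kappa>\<in>?K. L e \<kappa> \<gamma>1 * G \<kappa>) = 0" for G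
  proof
    fix \<kappa> assume \<kappa>: "\<kappa> \<in> ?K"
    obtain i l c where \<kappa>_eq: "\<kappa> = (i, l, c)" by (cases \<kappa>)
    have ilc: "i < num_verts Q" "l < d i" "c < d i" using \<kappa> by (auto simp: \<kappa>_eq block_index_def)
    have "(\<Sum>q<d i. g1 i r q * G (i, q, c)) = 0" if "r < d i" for r
      using G L_sum[of i r c \<gamma>1 G] ilc that by (auto simp: block_index_def \<gamma>1_def)
    then show "G \<kappa> = 0"
      using GL_pair_cancel[OF g1 ilc(1,2), of "\<lambda>q. G (i, q, c)"] by (simp add: \<kappa>_eq)
  qed
  obtain P f where P: "P \<in> polyfuns ?K" "P \<gamma>1 \<noteq> 0" and f: "\<And>\<kappa>. \<kappa> \<in> ?K \<Longrightarrow> f \<kappa> \<in> polyfuns ?K"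
    and sol: "\<And>\<gamma> H s \<kappa>. \<forall>e\<in>?K. (\<Sum>\<kappa>\<in>?K. L e \<kappa> \<gamma> * H \<kappa>) = s * M e \<gamma> \<Longrightarrow> \<kappa> \<in> ?K \<Longrightarrow> P \<gamma> * H \<kappa> = s * f \<kappa> \<gamma>"
    by (rule polynomial_elimination[where L = L and M = M and E = ?K and K = ?K and J = ?K and ?x0.0 = \<gamma>1,
          OF finite_block_index L_poly M_poly triv]) blast+
  \<comment> \<open>The homogeneous system is the case of scale factor 0, so it has only the trivial
    solution where \<open>P\<close> is non-zero.\<close>
  have unique: "G (i, q, c) = 0"
    if "P \<gamma> \<noteq> 0" and G: "\<And>i r c. (i, r, c) \<in> ?K \<Longrightarrow> (\<Sum>q<d i. \<gamma> (i, r, q) * G (i, q, c)) = 0"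
      and "(i, q, c) \<in> ?K" for \<gamma> G i q c
  proof -
    have "\<forall>e\<in>?K. (\<Sum>\<kappa>\<in>?K. L e \<kappa> \<gamma> * G \<kappa>) = 0 * M e \<gamma>" using G L_sum by auto
    from sol[OF this that(3)] show ?thesis using that(1) by simp
  qed
  show ?thesis
  proof (rule that[OF P(1) _ f])
    show "P (\<lambda>(i, r, c). g1 i r c) \<noteq> 0" using P(2) by (simp add: \<gamma>1_def)
    show "P \<gamma> * h i q c = f (i, q, c) \<gamma>"
      if h: "GL_pair Q d (\<lambda>i r c. \<gamma> (i, r, c)) h" and \<kappa>: "(i, q, c) \<in> ?K" for \<gamma> h i q c
    proof -
      have "\<forall>e\<in>?K. (\<Sum>\<kappa>\<in>?K. L e \<kappa> \<gamma> * (\<lambda>(i, q, c). h i q c) \<kappa>) = 1 * M e \<gamma>"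
        using GL_pairD(1)[OF h] L_sum by (auto simp: M_def block_index_def)
      from sol[OF this \<kappa>] show ?thesis by simp
    qed
    fix \<gamma> assume P\<gamma>: "P \<gamma> \<noteq> 0"
    have inj: "v = 0" if v: "v \<in> total_space Q d" and zero: "block_map Q d d \<gamma> v = 0" for v
    proof
      fix p :: "nat \<times> nat"
      obtain i q where p: "p = (i, q)" by (cases p)
      show "v p = 0 p"
      proof (cases "p \<in> quiver_index Q d")
        case True
        then have iq: "i < num_verts Q" "q < d i" by (auto simp: quiver_index_def p)
        have rows: "(\<Sum>q<d i. \<gamma> (i, r, q) * v (i, q)) = 0" if "(i, r, c) \<in> ?K" for i r c
          using fun_cong[OF zero, of "(i, r)"] that by (simp add: block_map_def block_index_def)
        have "v (i, q) = 0"
          by (rule unique[OF P\<gamma>, where G = "\<lambda>(i, q, c). v (i, q)" and i = i and q = q and c = 0, unfolded prod.case])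
            (use rows iq in \<open>auto simp: block_index_def\<close>)
        then show ?thesis by (simp add: p)
      qed (simp add: total_space_outside[OF v])
    qed
    have "\<exists>h. \<forall>i<num_verts Q. \<forall>r<d i. \<forall>c<d i. (\<Sum>q<d i. \<gamma> (i, r, q) * h i q c) = (if r = c then 1 else 0)"
      by (rule square_right_inverse[OF inj])
    then obtain h where h: "\<forall>i<num_verts Q. \<forall>r<d i. \<forall>c<d i. (\<Sum>q<d i. \<gamma> (i, r, q) * h i q c) = (if r = c then 1 else 0)"
      by (rule exE)
    \<comment> \<open>\<open>G\<close> is h \<gamma> - 1. Multiplication by \<gamma> from the left
      annihilates it, so uniqueness turns the right inverse into a two-sided one.\<close>
    define G where "G = (\<lambda>(i, q, c). (\<Sum>l<d i. h i q l * \<gamma> (i, l, c)) - (if q = c then 1 else 0))"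
    have G_eq: "(\<Sum>q<d i. \<gamma> (i, r, q) * G (i, q, c)) = 0" if K: "(i, r, c) \<in> ?K" for i r c
    proof -
      have irc: "i < num_verts Q" "r < d i" "c < d i" using K by (auto simp: block_index_def)
      have "(\<Sum>q<d i. \<gamma> (i, r, q) * G (i, q, c)) =
          (\<Sum>q<d i. \<Sum>l<d i. \<gamma> (i, r, q) * h i q l * \<gamma> (i, l, c)) - (\<Sum>q<d i. if q = c then \<gamma> (i, r, c) else 0)"
        unfolding G_def sum_subtractf[symmetric]
        by (intro sum.cong refl) (auto simp: right_diff_distrib sum_distrib_left mult.assoc)
      also have "(\<Sum>q<d i. \<Sum>l<d i. \<gamma> (i, r, q) * h i q l * \<gamma> (i, l, c)) =
          (\<Sum>l<d i. (\<Sum>q<d i. \<gamma> (i, r, q) * h i q l) * \<gamma> (i, l, c))"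
        by (subst sum.swap) (simp add: sum_distrib_right)
      also have "\<dots> = (\<Sum>l<d i. if l = r then \<gamma> (i, r, c) else 0)"
        using h irc by (intro sum.cong refl) auto
      finally show ?thesis using irc by simp
    qed
    have "G (i, q, c) = 0" if "(i, q, c) \<in> ?K" for i q c
      by (rule unique[OF P\<gamma>, where G = G]) (use G_eq that in auto)
    then have "GL_pair Q d (\<lambda>i r c. \<gamma> (i, r, c)) h"
      using h by (auto simp: GL_pair_def G_def block_index_def)
    then show "\<exists>h. GL_pair Q d (\<lambda>i r c. \<gamma> (i, r, c)) h" by blast
  qed
qed

text \<open>The orbit map is rational in the entries of the group element alone, with denominator
  \<open>P\<close>. After clearing denominators the pullback of \<open>\<Theta>\<close> is a
  polynomial function on the space of all matrix families.\<close>

lemma GL_nonvanishing_open: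
  fixes x :: "'e \<times> nat \<times> nat \<Rightarrow> 'k::field"
  assumes fq: "finite_quiver Q" and g1: "GL_pair Q d g1 h1" and \<Theta>: "\<Theta> \<in> polyfuns (rep_coords Q d)"
    and nz: "\<Theta> (conj_act Q d g1 h1 x) \<noteq> 0"
  shows "\<exists>U\<in>polyfuns (block_index Q d d). U (\<lambda>(i, r, c). g1 i r c) \<noteq> 0 \<and>
    (\<forall>\<gamma>. U \<gamma> \<noteq> 0 \<longrightarrow> (\<exists>h. GL_pair Q d (\<lambda>i r c. \<gamma> (i, r, c)) h \<and> \<Theta> (conj_act Q d (\<lambda>i r c. \<gamma> (i, r, c)) h x) \<noteq> 0))"
proof -
  let ?K = "block_index Q d d" and ?\<gamma>1 = "\<lambda>(i, r, c). g1 i r c"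
  obtain P f where P: "P \<in> polyfuns ?K" "P ?\<gamma>1 \<noteq> 0" and f: "\<And>\<kappa>. \<kappa> \<in> ?K \<Longrightarrow> f \<kappa> \<in> polyfuns ?K"
    and inv: "\<And>\<gamma>. P \<gamma> \<noteq> 0 \<Longrightarrow> \<exists>h. GL_pair Q d (\<lambda>i r c. \<gamma> (i, r, c)) h"
    and f_eq: "\<And>\<gamma> h i q c. GL_pair Q d (\<lambda>i r c. \<gamma> (i, r, c)) h \<Longrightarrow> (i, q, c) \<in> ?K \<Longrightarrow> P \<gamma> * h i q c = f (i, q, c) \<gamma>"
    by (rule GL_local_inverse[OF g1]) blast
  \<comment> \<open>The numerators of the coordinates of the conjugate, over the common denominator
    \<open>P\<close>.\<close>
  define N where "N = (\<lambda>(a, r, c) \<gamma>. \<Sum>p<d (tgt Q a). \<Sum>q<d (src Q a).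
    \<gamma> (tgt Q a, r, p) * x (a, p, q) * f (src Q a, q, c) \<gamma>)"
  have N_poly: "N j \<in> polyfuns ?K" if j: "j \<in> rep_coords Q d" for j
  proof -
    obtain a r c where j_eq: "j = (a, r, c)" by (cases j)
    have "a \<in> arrows Q" "r < d (tgt Q a)" "c < d (src Q a)" "src Q a < num_verts Q" "tgt Q a < num_verts Q"
      using j fq by (auto simp: j_eq rep_coords_def finite_quiver_def)
    then show ?thesis
      unfolding N_def j_eq prod.case
      by (intro polyfuns_sum polyfuns.mult polyfuns.const polyfuns.coord f) (auto simp: block_index_def)
  qed
  have N_eq: "\<forall>j\<in>rep_coords Q d. P \<gamma> * conj_act Q d (\<lambda>i r c. \<gamma> (i, r, c)) h x j = N j \<gamma>"
    if h: "GL_pair Q d (\<lambda>i r c. \<gamma> (i, r, c)) h" for \<gamma> h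
  proof
    fix j assume j: "j \<in> rep_coords Q d"
    obtain a r c where j_eq: "j = (a, r, c)" by (cases j)
    have ac: "c < d (src Q a)" "src Q a < num_verts Q"
      using j fq by (auto simp: j_eq rep_coords_def finite_quiver_def)
    have "P \<gamma> * conj_act Q d (\<lambda>i r c. \<gamma> (i, r, c)) h x j = (\<Sum>p<d (tgt Q a). \<Sum>q<d (src Q a).
        \<gamma> (tgt Q a, r, p) * x (a, p, q) * (P \<gamma> * h (src Q a) q c))"
      using j by (simp add: conj_act_def j_eq sum_distrib_left ac_simps)
    also have "\<dots> = N j \<gamma>"
      unfolding N_def j_eq prod.case
      using f_eq[OF h] ac by (intro sum.cong refl) (simp add: block_index_def)
    finally show "P \<gamma> * conj_act Q d (\<lambda>i r c. \<gamma> (i, r, c)) h x j = N j \<gamma>" .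
  qed
  obtain m T where T: "T \<in> polyfuns ?K"
    and T_eq: "\<And>\<gamma> y. \<forall>j\<in>rep_coords Q d. P \<gamma> * y j = N j \<gamma> \<Longrightarrow> \<Theta> y * P \<gamma> ^ m = T \<gamma>"
    using polyfuns_fraction_subst[OF \<Theta> P(1), of N] N_poly by blast
  show ?thesis
  proof (intro bexI[of _ "\<lambda>\<gamma>. P \<gamma> * T \<gamma>"] conjI allI impI)
    show "(\<lambda>\<gamma>. P \<gamma> * T \<gamma>) \<in> polyfuns ?K" by (rule polyfuns.mult[OF P(1) T])
    have "GL_pair Q d (\<lambda>i r c. ?\<gamma>1 (i, r, c)) h1" using g1 by simp
    from T_eq[OF N_eq[OF this]] have "\<Theta> (conj_act Q d g1 h1 x) * P ?\<gamma>1 ^ m = T ?\<gamma>1" by simp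
    moreover have "\<Theta> (conj_act Q d g1 h1 x) * P ?\<gamma>1 ^ m \<noteq> 0" using nz P(2) by simp
    ultimately show "P ?\<gamma>1 * T ?\<gamma>1 \<noteq> 0" using P(2) by simp
    fix \<gamma> assume nz': "P \<gamma> * T \<gamma> \<noteq> 0"
    then obtain h where h: "GL_pair Q d (\<lambda>i r c. \<gamma> (i, r, c)) h" using inv by auto
    from T_eq[OF N_eq[OF h]] nz' have "\<Theta> (conj_act Q d (\<lambda>i r c. \<gamma> (i, r, c)) h x) \<noteq> 0" by auto
    then show "\<exists>h. GL_pair Q d (\<lambda>i r c. \<gamma> (i, r, c)) h \<and> \<Theta> (conj_act Q d (\<lambda>i r c. \<gamma> (i, r, c)) h x) \<noteq> 0"
      using h by blast
  qed
qed

lemma polyfuns_conj_act: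
  assumes "\<Theta> \<in> polyfuns (rep_coords Q d)"
  shows "(\<lambda>x. \<Theta> (conj_act Q d g h x)) \<in> polyfuns (rep_coords Q d)"
proof (rule polyfuns_comp[OF assms])
  fix j assume j: "j \<in> rep_coords Q d"
  obtain a r c where j_eq: "j = (a, r, c)" by (cases j)
  have "(\<lambda>x. conj_act Q d g h x j) = (\<lambda>x. \<Sum>p<d (tgt Q a). \<Sum>q<d (src Q a). g (tgt Q a) r p * x (a, p, q) * h (src Q a) q c)"
    using j by (simp add: conj_act_def j_eq)
  also have "\<dots> \<in> polyfuns (rep_coords Q d)"
    using j by (intro polyfuns_sum polyfuns.mult polyfuns.const polyfuns.coord) (auto simp: j_eq rep_coords_def)
  finally show "(\<lambda>x. conj_act Q d g h x j) \<in> polyfuns (rep_coords Q d)" .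
qed

section \<open>Stability of irreducible components under conjugation\<close>

lemma rep_points_affine: "rep_points Q I d \<subseteq> affine_space (rep_coords Q d)"
  by (auto simp: rep_points_def)

lemma irreducible_componentD:
  assumes "irreducible_component Q I d Z"
  shows "\<exists>i<num_verts Q. d i \<noteq> 0" "Z \<subseteq> rep_points Q I d" "poly_irreducible (rep_coords Q d) Z"
    "S \<subseteq> rep_points Q I d \<Longrightarrow> poly_irreducible (rep_coords Q d) S \<Longrightarrow> Z \<subseteq> S \<Longrightarrow> S = Z"
proof -
  have Z: "irreducible_component_of (subtopology (zariski (rep_coords Q d)) (rep_points Q I d)) Z"
    and d: "\<exists>i<num_verts Q. d i \<noteq> 0"
    using assms by (auto simp: irreducible_component_def rep_variety_def)
  show "\<exists>i<num_verts Q. d i \<noteq> 0" by (rule d)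
  note Z' = irreducible_component_of_zariski[OF rep_points_affine Z]
  show "Z \<subseteq> rep_points Q I d" "poly_irreducible (rep_coords Q d) Z" by (rule Z')+
  show "S \<subseteq> rep_points Q I d \<Longrightarrow> poly_irreducible (rep_coords Q d) S \<Longrightarrow> Z \<subseteq> S \<Longrightarrow> S = Z"
    by (rule Z'(3))
qed

context bound_quiver_algebra
begin

lemma gl_orbit_rep_points:
  assumes x: "x \<in> rep_points Q I d" and y: "y \<in> gl_orbit Q d x"
  shows "y \<in> rep_points Q I d" "module_iso (pm d x) (pm d y)"
proof -
  obtain g h where gh: "GL_pair Q d g h" "y = conj_act Q d g h x" using y by (auto simp: gl_orbit_def)
  let ?F = "\<lambda>(i, r, c). g i r c" and ?H = "\<lambda>(i, r, c). h i r c"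
  have F: "intertwiner Q d d x y ?F" using GL_intertwiner[OF fq gh(1)] gh(2) by simp
  show yr: "y \<in> rep_points Q I d"
  proof (rule block_map_in_rep_points[OF fq ideal_subset x _ F])
    show "y \<in> affine_space (rep_coords Q d)" by (simp add: gh(2) conj_act_affine_space)
    show "total_space Q d \<subseteq> block_map Q d d ?F ` total_space Q d"
    proof
      fix v :: "'k fam" assume v: "v \<in> total_space Q d"
      show "v \<in> block_map Q d d ?F ` total_space Q d"
        using GL_block_map_inverse[OF gh(1) v] block_map_total_space by (metis image_eqI)
    qed
  qed
  show "module_iso (pm d x) (pm d y)"
  proof (rule intertwiner_iso[OF x yr F])
    fix v :: "'k fam" assume v: "v \<in> total_space Q d" "block_map Q d d ?F v = 0"
    then show "v = 0"
      using GL_block_map_inverse[OF GL_pair_sym[OF gh(1)] v(1)]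
        linear_on_UNIV_D(3)[OF linear_on_block_map, of Q d d ?H] by simp
  qed
qed

text \<open>The union \<open>S\<close> of all orbits through \<open>Z\<close> is irreducible, being
  in effect the image of a product of two irreducible sets, the group and \<open>Z\<close>. As it
  contains \<open>Z\<close> and lies in \<open>rep_points\<close>, maximality of \<open>Z\<close>
  gives \<open>S = Z\<close>.\<close>

lemma irreducible_component_stable:
  assumes Z: "irreducible_component Q I d Z" and x: "x \<in> Z"
  shows "gl_orbit Q d x \<subseteq> Z"
proof -
  let ?J = "rep_coords Q d"
  define S where "S = (\<Union>x\<in>Z. gl_orbit Q d x)"
  note ZD = irreducible_componentD[OF Z]
  have S_rep: "S \<subseteq> rep_points Q I d" using ZD(2) gl_orbit_rep_points(1) by (auto simp: S_def)
  have Z_S: "Z \<subseteq> S"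
  proof
    fix z assume z: "z \<in> Z"
    then have "z \<in> affine_space (rep_coords Q d)" using ZD(2) rep_points_affine by blast
    from conj_act_one[OF this] have "z \<in> gl_orbit Q d z"
      using gl_orbitI[OF GL_pair_one, of Q d z] by simp
    then show "z \<in> S" using z by (auto simp: S_def)
  qed
  have "poly_irreducible ?J S"
    unfolding poly_irreducible_def
  proof (intro conjI ballI impI)
    show "S \<noteq> {}" using x Z_S by blast
    fix P R assume P: "P \<in> polyfuns ?J" and R: "R \<in> polyfuns ?J" and "\<exists>x\<in>S. P x \<noteq> 0" "\<exists>x\<in>S. R x \<noteq> 0"
    then obtain x1 g1 h1 x2 g2 h2 where
      1: "x1 \<in> Z" "GL_pair Q d g1 h1" "P (conj_act Q d g1 h1 x1) \<noteq> 0" and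
      2: "x2 \<in> Z" "GL_pair Q d g2 h2" "R (conj_act Q d g2 h2 x2) \<noteq> 0"
      by (auto simp: S_def gl_orbit_def)
    \<comment> \<open>The group elements \<open>g1\<close> and \<open>g2\<close> stay fixed while
      irreducibility of \<open>Z\<close> replaces \<open>x1\<close> and \<open>x2\<close> by a
      common point.\<close>
    obtain z where z: "z \<in> Z" "P (conj_act Q d g1 h1 z) \<noteq> 0" "R (conj_act Q d g2 h2 z) \<noteq> 0"
      using poly_irreducibleD[of ?J Z "\<lambda>x. P (conj_act Q d g1 h1 x)" "\<lambda>x. R (conj_act Q d g2 h2 x)" x1 x2]
        ZD(3) polyfuns_conj_act[OF P] polyfuns_conj_act[OF R] 1 2 by metis
    \<comment> \<open>Now \<open>z\<close> is fixed and the group element moves: the two open sets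
      of matrix families around \<open>g1\<close> and \<open>g2\<close> have a common member
      \<open>\<gamma>\<close>.\<close>
    obtain U1 where U1: "U1 \<in> polyfuns (block_index Q d d)" "U1 (\<lambda>(i, r, c). g1 i r c) \<noteq> 0"
      "\<forall>\<gamma>. U1 \<gamma> \<noteq> 0 \<longrightarrow> (\<exists>h. GL_pair Q d (\<lambda>i r c. \<gamma> (i, r, c)) h \<and> P (conj_act Q d (\<lambda>i r c. \<gamma> (i, r, c)) h z) \<noteq> 0)"
      using GL_nonvanishing_open[OF fq 1(2) P z(2)] by (elim bexE conjE) (rule that)
    obtain U2 where U2: "U2 \<in> polyfuns (block_index Q d d)" "U2 (\<lambda>(i, r, c). g2 i r c) \<noteq> 0"
      "\<forall>\<gamma>. U2 \<gamma> \<noteq> 0 \<longrightarrow> (\<exists>h. GL_pair Q d (\<lambda>i r c. \<gamma> (i, r, c)) h \<and> R (conj_act Q d (\<lambda>i r c. \<gamma> (i, r, c)) h z) \<noteq> 0)"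
      using GL_nonvanishing_open[OF fq 2(2) R z(3)] by (elim bexE conjE) (rule that)
    obtain \<gamma> where "U1 \<gamma> \<noteq> 0" "U2 \<gamma> \<noteq> 0" by (rule polyfuns_common_nonzero[where P = U1 and R = U2, OF U1(1,2) U2(1,2)])
    let ?g = "\<lambda>i r c. \<gamma> (i, r, c)"
    obtain h where h: "GL_pair Q d ?g h" "P (conj_act Q d ?g h z) \<noteq> 0" using U1(3)[rule_format, OF \<open>U1 \<gamma> \<noteq> 0\<close>] by (elim exE conjE) (rule that)
    obtain h' where h': "GL_pair Q d ?g h'" "R (conj_act Q d ?g h' z) \<noteq> 0" using U2(3)[rule_format, OF \<open>U2 \<gamma> \<noteq> 0\<close>] by (elim exE conjE) (rule that)
    have "conj_act Q d ?g h z \<in> S" using z(1) gl_orbitI[OF h(1)] by (auto simp: S_def)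
    moreover have "R (conj_act Q d ?g h z) \<noteq> 0"
      using h'(2) unfolding conj_act_inverse_unique[OF fq h'(1) h(1)] .
    ultimately show "\<exists>x\<in>S. P x \<noteq> 0 \<and> R x \<noteq> 0" using h(2) by blast
  qed
  then have "S = Z" by (rule ZD(4)[OF S_rep _ Z_S])
  then show ?thesis using x by (auto simp: S_def)
qed

end

section \<open>Bricks and orthogonal orbits\<close>

lemma brick_iso:
  assumes k: "k_algebra scl" and M: "brick scl M" and N: "fg_module scl N" and iso: "module_iso M N"
  shows "brick scl N"
proof -
  have lmM: "left_module scl M" and lmN: "left_module scl N"
    using M N brick_iff[OF k, of M] by (auto simp: fg_module_left_module)
  have M_nz: "mod_space M \<noteq> {0}" and scalar: "\<forall>f\<in>Hom M M. \<exists>c. \<forall>v\<in>mod_space M. f v = fscale c v"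
    using M brick_iff[OF k, of M] by auto
  obtain f where f: "f \<in> Hom M N" "bij_betw f (mod_space M) (mod_space N)"
    using iso by (auto simp: module_iso_def)
  obtain g where g: "g \<in> Hom N M" "bij_betw g (mod_space N) (mod_space M)"
    using module_iso_sym[OF lmM lmN iso] by (auto simp: module_iso_def)
  note subM = left_moduleD(1)[OF lmM] and subN = left_moduleD(1)[OF lmN]
  note flin = Hom_linear_on[OF lmM lmN f(1)] and glin = Hom_linear_on[OF lmN lmM g(1)]
  have g_inj: "u = w" if "u \<in> mod_space N" "w \<in> mod_space N" "g u = g w" for u w
    using that g(2) by (auto simp: bij_betw_def inj_on_def)
  have f_inj: "u = w" if "u \<in> mod_space M" "w \<in> mod_space M" "f u = f w" for u w
    using that f(2) by (auto simp: bij_betw_def inj_on_def)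
  note f0 = linear_on_zero[OF subM flin] and g0 = linear_on_zero[OF subN glin]
  obtain v0 where v0: "v0 \<in> mod_space M" "v0 \<noteq> 0" using M_nz fam.subspace_0[OF subM] by blast
  have fv0: "f v0 \<in> mod_space N" "f v0 \<noteq> 0"
    using HomD(1)[OF f(1) v0(1)] f_inj[OF v0(1) fam.subspace_0[OF subM]] v0(2) f0 by auto
  \<comment> \<open>The isomorphism \<open>g\<close> was not chosen as the inverse of
    \<open>f\<close>. As \<open>M\<close> is a brick, their composite is still a scalar, and
    dividing by it repairs the difference.\<close>
  obtain c0 where c0: "\<forall>v\<in>mod_space M. (g \<circ> f) v = fscale c0 v"
    using bspec[OF scalar Hom_comp[OF lmM lmN lmM f(1) g(1)]] by (rule exE)
  have "g (f v0) \<noteq> 0" using g_inj[OF fv0(1) fam.subspace_0[OF subN]] fv0(2) g0 by auto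
  then have "c0 \<noteq> 0" using bspec[OF c0 v0(1)] by auto
  have "\<exists>c. \<forall>w\<in>mod_space N. h w = fscale c w" if h: "h \<in> Hom N N" for h
  proof -
    have "g \<circ> (h \<circ> f) \<in> Hom M M" by (intro Hom_comp[OF lmM lmN lmM] Hom_comp[OF lmM lmN lmN] f g h)
    from bspec[OF scalar this] obtain c where c: "\<forall>v\<in>mod_space M. (g \<circ> (h \<circ> f)) v = fscale c v" by (rule exE)
    have "h w = fscale (c / c0) w" if w: "w \<in> mod_space N" for w
    proof (rule g_inj[OF HomD(1)[OF h w] fam.subspace_scale[OF subN w]])
      obtain v where v: "v \<in> mod_space M" "w = f v" using w f(2) by (auto simp: bij_betw_def)
      have "g (fscale (c / c0) w) = fscale (c / c0) (g w)" using glin w by (simp add: linear_on_def)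
      also have "\<dots> = fscale (c / c0) (fscale c0 v)" using bspec[OF c0 v(1)] v(2) by simp
      also have "\<dots> = fscale c v" using \<open>c0 \<noteq> 0\<close> by simp
      finally show "g (h w) = g (fscale (c / c0) w)" using bspec[OF c v(1)] v(2) by simp
    qed
    then show ?thesis by blast
  qed
  moreover have "mod_space N \<noteq> {0}" using fv0 by blast
  ultimately show ?thesis using N brick_iff[OF k, of N] by blast
qed

section \<open>Open conditions on homomorphisms between points\<close>

context bound_quiver_algebra
begin

lemma Hom_zero_open_right:
  assumes x: "x \<in> rep_points Q I d" and y0: "y0 \<in> rep_points Q I d'" and zero: "Hom (pm d x) (pm d' y0) = {0}"
  shows "\<exists>P\<in>polyfuns (rep_coords Q d'). P y0 \<noteq> 0 \<and>
    (\<forall>y\<in>rep_points Q I d'. P y \<noteq> 0 \<longrightarrow> Hom (pm d x) (pm d' y) = {0})"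
proof (rule intertwiner_zero_open[OF fq, where d = d and d' = d' and x = "\<lambda>t. x" and y = "\<lambda>t. t"
      and ?t0.0 = y0 and J = "rep_coords Q d'"])
  show "\<forall>\<kappa>\<in>block_index Q d d'. F \<kappa> = 0" if "intertwiner Q d d' x y0 F" for F
    using zero that Hom_point_module_zero_iff[OF x y0] by blast
  fix P assume P: "P \<in> polyfuns (rep_coords Q d')" "P y0 \<noteq> 0"
    "\<And>t F. P t \<noteq> 0 \<Longrightarrow> intertwiner Q d d' x t F \<Longrightarrow> \<forall>\<kappa>\<in>block_index Q d d'. F \<kappa> = 0"
  show ?thesis
  proof (intro bexI[OF _ P(1)] conjI P(2) ballI impI)
    fix y assume "y \<in> rep_points Q I d'" "P y \<noteq> 0"
    then show "Hom (pm d x) (pm d' y) = {0}" using P(3) Hom_point_module_zero_iff[OF x] by simp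
  qed
qed (auto intro: polyfuns.const polyfuns.coord)

lemma Hom_zero_open_left:
  assumes x0: "x0 \<in> rep_points Q I d" and y: "y \<in> rep_points Q I d'" and zero: "Hom (pm d x0) (pm d' y) = {0}"
  shows "\<exists>P\<in>polyfuns (rep_coords Q d). P x0 \<noteq> 0 \<and>
    (\<forall>x\<in>rep_points Q I d. P x \<noteq> 0 \<longrightarrow> Hom (pm d x) (pm d' y) = {0})"
proof (rule intertwiner_zero_open[OF fq, where d = d and d' = d' and x = "\<lambda>t. t" and y = "\<lambda>t. y"
      and ?t0.0 = x0 and J = "rep_coords Q d"])
  show "\<forall>\<kappa>\<in>block_index Q d d'. F \<kappa> = 0" if "intertwiner Q d d' x0 y F" for F
    using zero that Hom_point_module_zero_iff[OF x0 y] by blast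
  fix P assume P: "P \<in> polyfuns (rep_coords Q d)" "P x0 \<noteq> 0"
    "\<And>t F. P t \<noteq> 0 \<Longrightarrow> intertwiner Q d d' t y F \<Longrightarrow> \<forall>\<kappa>\<in>block_index Q d d'. F \<kappa> = 0"
  show ?thesis
  proof (intro bexI[OF _ P(1)] conjI P(2) ballI impI)
    fix x assume "x \<in> rep_points Q I d" "P x \<noteq> 0"
    then show "Hom (pm d x) (pm d' y) = {0}" using P(3) Hom_point_module_zero_iff[OF _ y] by simp
  qed
qed (auto intro: polyfuns.const polyfuns.coord)

text \<open>The endomorphism is scalar on the whole total space, so one constant serves all
  vertices.\<close>

lemma brick_scalar:
  assumes x: "x \<in> rep_points Q I d" and brick: "brick scl (pm d x)" and F: "intertwiner Q d d x x F"
  shows "\<exists>c. \<forall>i p q. (i, p, q) \<in> block_index Q d d \<longrightarrow> F (i, p, q) = (if p = q then c else 0)"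
proof -
  have scalar: "\<forall>f\<in>Hom (pm d x) (pm d x). \<exists>c. \<forall>v\<in>total_space Q d. f v = fscale c v"
    using brick brick_iff[OF alg_k, of "pm d x"] by (simp add: mod_space_point_module)
  obtain c where c: "\<forall>v\<in>total_space Q d. (if v \<in> total_space Q d then block_map Q d d F v else 0) = fscale c v"
    using bspec[OF scalar intertwiner_Hom[OF x x F]] by (rule exE)
  have "F (i, p, q) = (if p = q then c else 0)" if K: "(i, p, q) \<in> block_index Q d d" for i p q
  proof -
    have K': "i < num_verts Q" "p < d i" "q < d i" using K by (auto simp: block_index_def)
    have "(unit_fam (i, q) :: 'k fam) \<in> total_space Q d"
      using K' by (intro unit_fam_in_total_space) (simp add: quiver_index_def)
    then have "block_map Q d d F (unit_fam (i, q)) = fscale c (unit_fam (i, q))" using c by auto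
    then have "block_map Q d d F (unit_fam (i, q)) (i, p) = fscale c (unit_fam (i, q)) (i, p)" by simp
    then show ?thesis
      using K' by (simp add: block_map_def unit_fam_apply fscale_def if_distrib[of "times _"] cong: if_cong)
  qed
  then show ?thesis by blast
qed

lemma brick_space_nonzero:
  assumes "brick scl (pm d x)"
  shows "\<exists>i<num_verts Q. d i \<noteq> 0"
proof (rule ccontr)
  assume "\<not> ?thesis"
  then have "quiver_index Q d = {}" by (auto simp: quiver_index_def)
  then have "v = 0" if "v \<in> total_space Q d" for v :: "'k fam"
    using total_space_outside[OF that] by (auto simp: fun_eq_iff)
  then have "total_space Q d = ({0} :: 'k fam set)" using fam.subspace_0[OF subspace_total_space] by blast
  then show False using assms brick_iff[OF alg_k, of "pm d x"] by (simp add: mod_space_point_module)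
qed

lemma intertwiner_exists:
  assumes "x \<in> rep_points Q I d" "y \<in> rep_points Q I d" "Hom (pm d x) (pm d y) \<noteq> {0}"
  obtains F where "intertwiner Q d d x y F" "\<exists>\<kappa>\<in>block_index Q d d. F \<kappa> \<noteq> 0"
  using assms Hom_point_module_zero_iff by blast

text \<open>Near \<open>x\<close> all homomorphisms from the brick are multiples of a single family
  that specialises to a non-zero multiple of the identity at \<open>x\<close>. A non-zero one is
  then injective, and injective suffices by equality of dimension vectors.\<close>

lemma brick_iso_open_right:
  assumes x: "x \<in> rep_points Q I d" and brick: "brick scl (pm d x)"
  shows "\<exists>P\<in>polyfuns (rep_coords Q d). P x \<noteq> 0 \<and>
    (\<forall>y\<in>rep_points Q I d. P y \<noteq> 0 \<longrightarrow> Hom (pm d x) (pm d y) \<noteq> {0} \<longrightarrow> module_iso (pm d x) (pm d y))"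
proof -
  obtain i0 where i0: "i0 < num_verts Q" "d i0 \<noteq> 0" using brick_space_nonzero[OF brick] by blast
  show ?thesis
  proof (rule intertwiner_injective_open[OF fq, where d = d and x = "\<lambda>t. x" and y = "\<lambda>t. t"
        and ?t0.0 = x and J = "rep_coords Q d" and ?i0.0 = i0])
    show "\<exists>c. \<forall>i p q. (i, p, q) \<in> block_index Q d d \<longrightarrow> F (i, p, q) = (if p = q then c else 0)"
      if "intertwiner Q d d x x F" for F by (rule brick_scalar[OF x brick that])
    fix P assume P: "P \<in> polyfuns (rep_coords Q d)" "P x \<noteq> 0"
      "\<And>t F v. P t \<noteq> 0 \<Longrightarrow> intertwiner Q d d x t F \<Longrightarrow> \<exists>\<kappa>\<in>block_index Q d d. F \<kappa> \<noteq> 0 \<Longrightarrow>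
        v \<in> total_space Q d \<Longrightarrow> block_map Q d d F v = 0 \<Longrightarrow> v = 0"
    show ?thesis
    proof (intro bexI[OF _ P(1)] conjI P(2) ballI impI)
      fix y assume y: "y \<in> rep_points Q I d" "P y \<noteq> 0" "Hom (pm d x) (pm d y) \<noteq> {0}"
      obtain F where F: "intertwiner Q d d x y F" "\<exists>\<kappa>\<in>block_index Q d d. F \<kappa> \<noteq> 0"
        by (rule intertwiner_exists[OF x y(1,3)])
      show "module_iso (pm d x) (pm d y)" by (rule intertwiner_iso[OF x y(1) F(1) P(3)[OF y(2) F]])
    qed
  qed (use i0 in \<open>auto intro: polyfuns.const polyfuns.coord\<close>)
qed

lemma brick_iso_open_left:
  assumes x: "x \<in> rep_points Q I d" and brick: "brick scl (pm d x)"
  shows "\<exists>P\<in>polyfuns (rep_coords Q d). P x \<noteq> 0 \<and>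
    (\<forall>y\<in>rep_points Q I d. P y \<noteq> 0 \<longrightarrow> Hom (pm d y) (pm d x) \<noteq> {0} \<longrightarrow> module_iso (pm d y) (pm d x))"
proof -
  obtain i0 where i0: "i0 < num_verts Q" "d i0 \<noteq> 0" using brick_space_nonzero[OF brick] by blast
  show ?thesis
  proof (rule intertwiner_injective_open[OF fq, where d = d and x = "\<lambda>t. t" and y = "\<lambda>t. x"
        and ?t0.0 = x and J = "rep_coords Q d" and ?i0.0 = i0])
    show "\<exists>c. \<forall>i p q. (i, p, q) \<in> block_index Q d d \<longrightarrow> F (i, p, q) = (if p = q then c else 0)"
      if "intertwiner Q d d x x F" for F by (rule brick_scalar[OF x brick that])
    fix P assume P: "P \<in> polyfuns (rep_coords Q d)" "P x \<noteq> 0"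
      "\<And>t F v. P t \<noteq> 0 \<Longrightarrow> intertwiner Q d d t x F \<Longrightarrow> \<exists>\<kappa>\<in>block_index Q d d. F \<kappa> \<noteq> 0 \<Longrightarrow>
        v \<in> total_space Q d \<Longrightarrow> block_map Q d d F v = 0 \<Longrightarrow> v = 0"
    show ?thesis
    proof (intro bexI[OF _ P(1)] conjI P(2) ballI impI)
      fix y assume y: "y \<in> rep_points Q I d" "P y \<noteq> 0" "Hom (pm d y) (pm d x) \<noteq> {0}"
      obtain F where F: "intertwiner Q d d y x F" "\<exists>\<kappa>\<in>block_index Q d d. F \<kappa> \<noteq> 0"
        by (rule intertwiner_exists[OF y(1) x y(3)])
      show "module_iso (pm d y) (pm d x)" by (rule intertwiner_iso[OF y(1) x F(1) P(3)[OF y(2) F]])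
    qed
  qed (use i0 in \<open>auto intro: polyfuns.const polyfuns.coord\<close>)
qed

section \<open>Non-vanishing of homomorphisms within a component\<close>

lemma total_space_nonzero:
  assumes "\<exists>i<num_verts Q. d i \<noteq> 0"
  shows "total_space Q d \<noteq> ({0} :: 'k fam set)"
proof -
  obtain i where i: "i < num_verts Q" "d i \<noteq> 0" using assms by blast
  have "(unit_fam (i, 0) :: 'k fam) \<in> total_space Q d"
    using i by (intro unit_fam_in_total_space) (simp add: quiver_index_def)
  moreover have "(unit_fam (i, 0) :: 'k fam) (i, 0) \<noteq> 0" by (simp add: unit_fam_apply)
  ultimately show ?thesis by (metis singletonD zero_fun_apply)
qed

lemma dense_orbit_Hom_nonzero:
  assumes Z: "irreducible_component Q I d Z" and dense: "has_dense_orbit Q I d Z" and XY: "X \<in> Z" "Y \<in> Z"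
  shows "Hom (pm d X) (pm d Y) \<noteq> {0}"
proof
  assume zero: "Hom (pm d X) (pm d Y) = {0}"
  note ZD = irreducible_componentD[OF Z]
  have rep: "X \<in> rep_points Q I d" "Y \<in> rep_points Q I d" using ZD(2) XY by auto
  obtain x where x: "x \<in> Z" and orbit: "gl_orbit Q d x \<subseteq> Z"
    and closure: "subtopology (rep_variety Q I d) Z closure_of gl_orbit Q d x = Z"
    using dense unfolding has_dense_orbit_def by blast
  have xr: "x \<in> rep_points Q I d" using x ZD(2) by blast
  have meets: "\<exists>y\<in>gl_orbit Q d x. P y \<noteq> 0" if "P \<in> polyfuns (rep_coords Q d)" "z \<in> Z" "P z \<noteq> 0" for P z
    using dense_subset_nonvanishing[of "rep_points Q I d" "rep_coords Q d" Z "gl_orbit Q d x" P z]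
      rep_points_affine ZD(2) orbit closure that unfolding rep_variety_def by metis
  obtain P where P: "P \<in> polyfuns (rep_coords Q d)" "P Y \<noteq> 0"
    "\<forall>y\<in>rep_points Q I d. P y \<noteq> 0 \<longrightarrow> Hom (pm d X) (pm d y) = {0}"
    using Hom_zero_open_right[OF rep zero] by (elim bexE conjE) (rule that)
  obtain N where N: "N \<in> gl_orbit Q d x" "P N \<noteq> 0" using meets[OF P(1) XY(2) P(2)] by blast
  note Nr = gl_orbit_rep_points[OF xr N(1)]
  have XN: "Hom (pm d X) (pm d N) = {0}" using P(3) Nr(1) N(2) by blast
  obtain P' where P': "P' \<in> polyfuns (rep_coords Q d)" "P' X \<noteq> 0"
    "\<forall>x\<in>rep_points Q I d. P' x \<noteq> 0 \<longrightarrow> Hom (pm d x) (pm d N) = {0}"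
    using Hom_zero_open_left[OF rep(1) Nr(1) XN] by (elim bexE conjE) (rule that)
  obtain N' where N': "N' \<in> gl_orbit Q d x" "P' N' \<noteq> 0" using meets[OF P'(1) XY(1) P'(2)] by blast
  note Nr' = gl_orbit_rep_points[OF xr N'(1)]
  note lm = left_module_point_module
  have "module_iso (pm d N') (pm d N)"
    using module_iso_trans[OF lm lm lm] module_iso_sym[OF lm lm] Nr Nr' xr by metis
  then have "Hom (pm d N') (pm d N) \<noteq> {0}"
    using iso_Hom_nonzero[OF lm lm, OF Nr'(1) Nr(1)] total_space_nonzero[OF ZD(1)]
    by (simp add: mod_space_point_module)
  then show False using P'(3) Nr'(1) N'(2) by blast
qed

lemma Hom_nonzero_of_finitely_many_bricks:
  assumes fin: "\<And>m. finite (iso_classes scl (\<lambda>M. brick scl M \<and> fam.dim (mod_space M) = m))"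
    and Z: "irreducible_component Q I d Z" and XY: "X \<in> Z" "Y \<in> Z"
  shows "Hom (pm d X) (pm d Y) \<noteq> {0}"
proof
  assume zero: "Hom (pm d X) (pm d Y) = {0}"
  note ZD = irreducible_componentD[OF Z] and lm = left_module_point_module
  let ?J = "rep_coords Q d"
  have rep: "X \<in> rep_points Q I d" "Y \<in> rep_points Q I d" using ZD(2) XY by auto
  define D where "D = fam.dim (total_space Q d :: 'k fam set)"
  \<comment> \<open>The bricks to be tested are submodules of modules of dimension \<open>D\<close>;
    finiteness in each dimension therefore suffices.\<close>
  define \<C> where "\<C> = (\<Union>m\<le>D. iso_classes scl (\<lambda>M. brick scl M \<and> fam.dim (mod_space M) = m))"
  have fin_C: "finite \<C>" unfolding \<C>_def using fin by blast
  \<comment> \<open>Openness is known only for modules of points, so every class is represented by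
    one.\<close>
  have "\<exists>p. snd p \<in> rep_points Q I (fst p) \<and> pm (fst p) (snd p) \<in> \<c>" if c: "\<c> \<in> \<C>" for \<c>
  proof -
    obtain M where M: "fg_module scl M" "\<c> = {N. fg_module scl N \<and> module_iso M N}"
      using c unfolding \<C>_def iso_classes_def by blast
    obtain d' b where b: "b \<in> rep_points Q I d'" "module_iso (pm d' b) M"
      using module_iso_point_module[OF M(1)] by metis
    then have "pm d' b \<in> \<c>"
      using M fg_module_point_module[OF b(1)] module_iso_sym[OF lm[OF b(1)] fg_module_left_module[OF M(1)]] by blast
    then show ?thesis using b(1) by (intro exI[of _ "(d', b)"]) simp
  qed
  then obtain \<rho> where \<rho>: "\<And>\<c>. \<c> \<in> \<C> \<Longrightarrow> snd (\<rho> \<c>) \<in> rep_points Q I (fst (\<rho> \<c>)) \<and> pm (fst (\<rho> \<c>)) (snd (\<rho> \<c>)) \<in> \<c>"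
    by metis
  let ?b = "\<lambda>\<c>. pm (fst (\<rho> \<c>)) (snd (\<rho> \<c>))"
  \<comment> \<open>The classes of bricks in the torsion-free class of all \<open>N\<close> with
    \<open>Hom X N = 0\<close>.\<close>
  define \<D> where "\<D> = {\<c> \<in> \<C>. Hom (pm d X) (?b \<c>) = {0}}"
  have fin_D: "finite \<D>" using fin_C by (simp add: \<D>_def)
  have "\<exists>P. P \<in> polyfuns ?J \<and> P X \<noteq> 0 \<and> (\<forall>x\<in>rep_points Q I d. P x \<noteq> 0 \<longrightarrow> Hom (pm d x) (?b \<c>) = {0})"
    if "\<c> \<in> \<D>" for \<c>
    using Hom_zero_open_left[OF rep(1), of "snd (\<rho> \<c>)" "fst (\<rho> \<c>)"] \<rho> that unfolding \<D>_def by blast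
  then have "\<forall>\<c>\<in>\<D>. \<exists>P. P \<in> polyfuns ?J \<and> P X \<noteq> 0 \<and> (\<forall>x\<in>rep_points Q I d. P x \<noteq> 0 \<longrightarrow> Hom (pm d x) (?b \<c>) = {0})"
    by blast
  from bchoice[OF this] obtain P where P: "\<forall>\<c>\<in>\<D>. P \<c> \<in> polyfuns ?J \<and> P \<c> X \<noteq> 0 \<and>
      (\<forall>x\<in>rep_points Q I d. P \<c> x \<noteq> 0 \<longrightarrow> Hom (pm d x) (?b \<c>) = {0})" by (rule exE)
  \<comment> \<open>A finite intersection of basic open sets is again basic: the product is non-zero
    exactly where all its factors are.\<close>
  define U where "U x = (\<Prod>\<c>\<in>\<D>. P \<c> x)" for x
  have U_poly: "U \<in> polyfuns ?J"
    unfolding U_def using P by (intro polyfuns_prod fin_D) blast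
  have UX: "U X \<noteq> 0" using P fin_D by (simp add: U_def)
  obtain V where V: "V \<in> polyfuns ?J" "V Y \<noteq> 0"
    "\<forall>y\<in>rep_points Q I d. V y \<noteq> 0 \<longrightarrow> Hom (pm d X) (pm d y) = {0}"
    using Hom_zero_open_right[OF rep zero] by (elim bexE conjE) (rule that)
  obtain N where N: "N \<in> Z" "U N \<noteq> 0" "V N \<noteq> 0"
    by (rule poly_irreducibleD[where P = U and R = V, OF ZD(3) U_poly V(1) XY(1) UX XY(2) V(2)])
  have Nr: "N \<in> rep_points Q I d" using N(1) ZD(2) by blast
  have XN: "Hom (pm d X) (pm d N) = {0}" using V(3) Nr N(3) by blast
  have space: "mod_space (pm d N) \<noteq> {0}"
    using total_space_nonzero[OF ZD(1)] by (simp add: mod_space_point_module)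
  obtain B f where B: "brick scl B" "mod_space B \<subseteq> mod_space (pm d N)" "mod_act B = mod_act (pm d N)"
    "f \<in> Hom (pm d N) B" "f \<noteq> 0" "fam.dim (mod_space B) \<le> fam.dim (mod_space (pm d N))"
    by (rule brick_quotient_submodule[OF alg fg_module_point_module[OF Nr] space])
  have B_fg: "fg_module scl B" using B(1) brick_iff[OF alg_k, of B] by simp
  note B_lm = fg_module_left_module[OF B_fg]
  define \<c> where "\<c> = {N. fg_module scl N \<and> module_iso B N}"
  have "\<c> \<in> \<C>"
    unfolding \<C>_def iso_classes_def \<c>_def
    using B(1,6) B_fg by (intro UN_I[of "fam.dim (mod_space B)"]) (auto simp: D_def mod_space_point_module)
  then have b: "snd (\<rho> \<c>) \<in> rep_points Q I (fst (\<rho> \<c>))" "module_iso B (?b \<c>)"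
    using \<rho>[of \<c>] by (auto simp: \<c>_def)
  have "Hom (pm d X) B = {0}"
    using Hom_eq_zero_iff[OF lm[OF rep(1)] B_lm] Hom_into_submodule[OF B(2,3)] XN by blast
  then have "Hom (pm d X) (?b \<c>) = {0}" by (rule Hom_zero_iso_right[OF lm[OF rep(1)] B_lm lm[OF b(1)] b(2)])
  then have "\<c> \<in> \<D>" using \<open>\<c> \<in> \<C>\<close> by (simp add: \<D>_def)
  moreover have "P \<c> N \<noteq> 0" using N(2) \<open>\<c> \<in> \<D>\<close> fin_D by (auto simp: U_def)
  ultimately have "Hom (pm d N) (?b \<c>) = {0}" using P Nr by blast
  then have "Hom (pm d N) B = {0}"
    by (rule Hom_zero_iso_right[OF lm[OF Nr] lm[OF b(1)] B_lm module_iso_sym[OF B_lm lm[OF b(1)] b(2)]])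
  then show False using B(4,5) by blast
qed

section \<open>From infinitely many bricks to orthogonal orbits\<close>

lemma orthogonal_partner:
  assumes Z: "irreducible_component Q I d Z" and X: "X \<in> Z" "brick scl (pm d X)"
    and Y: "Y \<in> Z" "brick scl (pm d Y)" and niso: "\<not> module_iso (pm d X) (pm d Y)"
  shows "\<exists>N\<in>Z. Hom (pm d X) (pm d N) = {0} \<and> Hom (pm d N) (pm d X) = {0}"
proof -
  note ZD = irreducible_componentD[OF Z] and lm = left_module_point_module
  let ?J = "rep_coords Q d"
  have rep: "N \<in> rep_points Q I d" if "N \<in> Z" for N using ZD(2) that by auto
  have common: "\<exists>N\<in>Z. P N \<noteq> 0 \<and> R N \<noteq> 0"
    if "P \<in> polyfuns ?J" "R \<in> polyfuns ?J" "u \<in> Z" "P u \<noteq> 0" "w \<in> Z" "R w \<noteq> 0" for P R u w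
    using ZD(3) that unfolding poly_irreducible_def by blast
  have niso': "\<not> module_iso (pm d Y) (pm d X)"
    using niso module_iso_sym[OF lm[OF rep[OF Y(1)]] lm[OF rep[OF X(1)]]] by blast
  have right: "\<exists>N\<in>Z. Hom (pm d X) (pm d N) = {0}"
  proof (rule ccontr)
    assume "\<not> ?thesis"
    then have XN: "\<And>N. N \<in> Z \<Longrightarrow> Hom (pm d X) (pm d N) \<noteq> {0}" by blast
    obtain P where P: "P \<in> polyfuns ?J" "P X \<noteq> 0"
      "\<And>N. N \<in> Z \<Longrightarrow> P N \<noteq> 0 \<Longrightarrow> module_iso (pm d X) (pm d N)"
      using brick_iso_open_right[OF rep[OF X(1)] X(2)] XN rep by metis
    \<comment> \<open>Otherwise maps to \<open>Y\<close> vanish on a neighbourhood of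
      \<open>N\<close>. It meets the neighbourhood of \<open>X\<close> that consists of copies of
      \<open>X\<close>, although \<open>Hom X Y\<close> is non-zero.\<close>
    have NY: "Hom (pm d N) (pm d Y) \<noteq> {0}" if N: "N \<in> Z" for N
    proof
      assume "Hom (pm d N) (pm d Y) = {0}"
      then obtain R where R: "R \<in> polyfuns ?J" "R N \<noteq> 0"
        "\<And>u. u \<in> Z \<Longrightarrow> R u \<noteq> 0 \<Longrightarrow> Hom (pm d u) (pm d Y) = {0}"
        using Hom_zero_open_left[OF rep[OF N] rep[OF Y(1)]] rep by metis
      obtain u where u: "u \<in> Z" "P u \<noteq> 0" "R u \<noteq> 0" using common[OF P(1) R(1) X(1) P(2) N R(2)] by blast
      have "module_iso (pm d u) (pm d X)"
        by (rule module_iso_sym[OF lm[OF rep[OF X(1)]] lm[OF rep[OF u(1)]] P(3)[OF u(1,2)]])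
      then have "Hom (pm d X) (pm d Y) = {0}"
        by (rule Hom_zero_iso_left[OF lm[OF rep[OF u(1)]] lm[OF rep[OF X(1)]] lm[OF rep[OF Y(1)]] _ R(3)[OF u(1,3)]])
      then show False using XN[OF Y(1)] by blast
    qed
    obtain R where R: "R \<in> polyfuns ?J" "R Y \<noteq> 0"
      "\<And>N. N \<in> Z \<Longrightarrow> R N \<noteq> 0 \<Longrightarrow> module_iso (pm d N) (pm d Y)"
      using brick_iso_open_left[OF rep[OF Y(1)] Y(2)] NY rep by metis
    obtain u where u: "u \<in> Z" "P u \<noteq> 0" "R u \<noteq> 0" using common[OF P(1) R(1) X(1) P(2) Y(1) R(2)] by blast
    have "module_iso (pm d X) (pm d Y)"
      by (rule module_iso_trans[OF lm[OF rep[OF X(1)]] lm[OF rep[OF u(1)]] lm[OF rep[OF Y(1)]] P(3)[OF u(1,2)] R(3)[OF u(1,3)]])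
    then show False using niso by blast
  qed
  \<comment> \<open>The mirror image, with sources and targets of homomorphisms exchanged.\<close>
  have left: "\<exists>N\<in>Z. Hom (pm d N) (pm d X) = {0}"
  proof (rule ccontr)
    assume "\<not> ?thesis"
    then have NX: "\<And>N. N \<in> Z \<Longrightarrow> Hom (pm d N) (pm d X) \<noteq> {0}" by blast
    obtain P where P: "P \<in> polyfuns ?J" "P X \<noteq> 0"
      "\<And>N. N \<in> Z \<Longrightarrow> P N \<noteq> 0 \<Longrightarrow> module_iso (pm d N) (pm d X)"
      using brick_iso_open_left[OF rep[OF X(1)] X(2)] NX rep by metis
    have YN: "Hom (pm d Y) (pm d N) \<noteq> {0}" if N: "N \<in> Z" for N
    proof
      assume "Hom (pm d Y) (pm d N) = {0}"
      then obtain R where R: "R \<in> polyfuns ?J" "R N \<noteq> 0"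
        "\<And>u. u \<in> Z \<Longrightarrow> R u \<noteq> 0 \<Longrightarrow> Hom (pm d Y) (pm d u) = {0}"
        using Hom_zero_open_right[OF rep[OF Y(1)] rep[OF N]] rep by metis
      obtain u where u: "u \<in> Z" "P u \<noteq> 0" "R u \<noteq> 0" using common[OF P(1) R(1) X(1) P(2) N R(2)] by blast
      have "Hom (pm d Y) (pm d X) = {0}"
        by (rule Hom_zero_iso_right[OF lm[OF rep[OF Y(1)]] lm[OF rep[OF u(1)]] lm[OF rep[OF X(1)]] P(3)[OF u(1,2)] R(3)[OF u(1,3)]])
      then show False using NX[OF Y(1)] by blast
    qed
    obtain R where R: "R \<in> polyfuns ?J" "R Y \<noteq> 0"
      "\<And>N. N \<in> Z \<Longrightarrow> R N \<noteq> 0 \<Longrightarrow> module_iso (pm d Y) (pm d N)"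
      using brick_iso_open_right[OF rep[OF Y(1)] Y(2)] YN rep by metis
    obtain u where u: "u \<in> Z" "P u \<noteq> 0" "R u \<noteq> 0" using common[OF P(1) R(1) X(1) P(2) Y(1) R(2)] by blast
    have "module_iso (pm d Y) (pm d X)"
      by (rule module_iso_trans[OF lm[OF rep[OF Y(1)]] lm[OF rep[OF u(1)]] lm[OF rep[OF X(1)]] R(3)[OF u(1,3)] P(3)[OF u(1,2)]])
    then show False using niso' by blast
  qed
  obtain N1 where N1: "N1 \<in> Z" "Hom (pm d X) (pm d N1) = {0}" using right by blast
  obtain N2 where N2: "N2 \<in> Z" "Hom (pm d N2) (pm d X) = {0}" using left by blast
  obtain P where P: "P \<in> polyfuns ?J" "P N1 \<noteq> 0" "\<And>N. N \<in> Z \<Longrightarrow> P N \<noteq> 0 \<Longrightarrow> Hom (pm d X) (pm d N) = {0}"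
    using Hom_zero_open_right[OF rep[OF X(1)] rep[OF N1(1)] N1(2)] rep by metis
  obtain R where R: "R \<in> polyfuns ?J" "R N2 \<noteq> 0" "\<And>N. N \<in> Z \<Longrightarrow> R N \<noteq> 0 \<Longrightarrow> Hom (pm d N) (pm d X) = {0}"
    using Hom_zero_open_left[OF rep[OF N2(1)] rep[OF X(1)] N2(2)] rep by metis
  obtain N where "N \<in> Z" "P N \<noteq> 0" "R N \<noteq> 0" using common[OF P(1) R(1) N1(1) P(2) N2(1) R(2)] by blast
  then show ?thesis using P(3) R(3) by blast
qed

lemma orthogonal_orbits_of_infinitely_many_bricks:
  assumes inf: "infinite (iso_classes scl (\<lambda>M. brick scl M \<and> fam.dim (mod_space M) = m))"
  shows "\<exists>d Z. irreducible_component Q I d Z \<and> has_orthogonal_orbits Q \<phi> d Z"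
proof -
  let ?C = "iso_classes scl (\<lambda>M. brick scl M \<and> fam.dim (mod_space M) = m)"
  note lm = left_module_point_module
  define good where "good \<c> p \<longleftrightarrow> snd p \<in> rep_points Q I (fst p) \<and> pm (fst p) (snd p) \<in> \<c> \<and>
    brick scl (pm (fst p) (snd p)) \<and> (\<forall>i\<ge>num_verts Q. fst p i = 0) \<and> (\<forall>i. fst p i \<le> m)" for \<c> p
  have "\<exists>p. good \<c> p" if c: "\<c> \<in> ?C" for \<c>
  proof -
    obtain M where M: "fg_module scl M" "brick scl M" "fam.dim (mod_space M) = m"
        "\<c> = {N. fg_module scl N \<and> module_iso M N}"
      using c unfolding iso_classes_def by blast
    obtain d x where x: "x \<in> rep_points Q I d" "module_iso (pm d x) M"
      and d: "\<forall>i\<ge>num_verts Q. d i = 0" "\<forall>i. d i \<le> fam.dim (mod_space M)"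
      using module_iso_point_module[OF M(1)] by metis
    note fg = fg_module_point_module[OF x(1)]
    have iso: "module_iso M (pm d x)"
      by (rule module_iso_sym[OF lm[OF x(1)] fg_module_left_module[OF M(1)] x(2)])
    have "good \<c> (d, x)"
      unfolding good_def using x(1) M(3,4) fg iso d brick_iso[OF alg_k M(2) fg iso] by simp
    then show ?thesis by blast
  qed
  then obtain \<rho> where \<rho>: "\<And>\<c>. \<c> \<in> ?C \<Longrightarrow> good \<c> (\<rho> \<c>)" by metis
  have niso: "\<c> = \<c>'" if c: "\<c> \<in> ?C" "\<c>' \<in> ?C"
    and iso: "module_iso (pm (fst (\<rho> \<c>)) (snd (\<rho> \<c>))) (pm (fst (\<rho> \<c>')) (snd (\<rho> \<c>')))" for \<c> \<c>'
  proof -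
    obtain M where M: "fg_module scl M" "\<c> = {N. fg_module scl N \<and> module_iso M N}"
      using c(1) unfolding iso_classes_def by blast
    obtain M' where M': "fg_module scl M'" "\<c>' = {N. fg_module scl N \<and> module_iso M' N}"
      using c(2) unfolding iso_classes_def by blast
    let ?x = "pm (fst (\<rho> \<c>)) (snd (\<rho> \<c>))" and ?x' = "pm (fst (\<rho> \<c>')) (snd (\<rho> \<c>'))"
    note fgl = fg_module_left_module
    have x: "fg_module scl ?x" "module_iso M ?x" and x': "fg_module scl ?x'" "module_iso M' ?x'"
      using \<rho>[OF c(1)] \<rho>[OF c(2)] M(2) M'(2) unfolding good_def by auto
    have "module_iso M ?x'" by (rule module_iso_trans[OF fgl fgl fgl, OF M(1) x(1) x'(1) x(2) iso])
    then have MM': "module_iso M M'"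
      by (rule module_iso_trans[OF fgl fgl fgl, OF M(1) x'(1) M'(1) _ module_iso_sym[OF fgl fgl, OF M'(1) x'(1,2)]])
    note M'M = module_iso_sym[OF fgl fgl, OF M(1) M'(1) MM']
    show "\<c> = \<c>'"
      unfolding M(2) M'(2)
      using module_iso_trans[OF fgl fgl fgl, OF M(1) M'(1) _ MM'] module_iso_trans[OF fgl fgl fgl, OF M'(1) M(1) _ M'M]
      by blast
  qed
  \<comment> \<open>All entries are at most \<open>m\<close> and vanish beyond the vertices, so
    finitely many dimension vectors occur, and one of them carries infinitely many classes.\<close>
  have "finite {d. \<forall>i. (i \<in> {..<num_verts Q} \<longrightarrow> d i \<in> {..m}) \<and> (i \<notin> {..<num_verts Q} \<longrightarrow> d i = 0)}"
    by (rule finite_set_of_finite_funs) auto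
  moreover have "(fst \<circ> \<rho>) ` ?C \<subseteq> {d. \<forall>i. (i \<in> {..<num_verts Q} \<longrightarrow> d i \<in> {..m}) \<and> (i \<notin> {..<num_verts Q} \<longrightarrow> d i = 0)}"
    using \<rho> by (auto simp: good_def)
  ultimately have "finite ((fst \<circ> \<rho>) ` ?C)" using finite_subset by blast
  from pigeonhole_infinite[OF inf this] obtain \<c>0 where
    inf': "infinite {\<c> \<in> ?C. (fst \<circ> \<rho>) \<c> = (fst \<circ> \<rho>) \<c>0}" by blast
  define d where "d = fst (\<rho> \<c>0)"
  define \<J> where "\<J> = {\<c> \<in> ?C. fst (\<rho> \<c>) = d}"
  have inf_J: "infinite \<J>" using inf' by (simp add: \<J>_def d_def)
  have J: "snd (\<rho> \<c>) \<in> rep_points Q I d" "brick scl (pm d (snd (\<rho> \<c>)))" if "\<c> \<in> \<J>" for \<c>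
    using \<rho>[of \<c>] that by (auto simp: \<J>_def good_def)
  have J_niso: "\<c> = \<c>'" if "\<c> \<in> \<J>" "\<c>' \<in> \<J>" "module_iso (pm d (snd (\<rho> \<c>))) (pm d (snd (\<rho> \<c>')))" for \<c> \<c>'
    using niso[of \<c> \<c>'] that by (simp add: \<J>_def)
  \<comment> \<open>A common point would represent both classes, so infinitely many classes give
    infinitely many points.\<close>
  have "inj_on (snd \<circ> \<rho>) \<J>"
  proof (rule inj_onI)
    fix \<c> \<c>' assume c: "\<c> \<in> \<J>" "\<c>' \<in> \<J>" "(snd \<circ> \<rho>) \<c> = (snd \<circ> \<rho>) \<c>'"
    then show "\<c> = \<c>'" using J_niso[OF c(1,2)] module_iso_refl[OF lm[OF J(1)[OF c(2)]]] by simp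
  qed
  then have inf_E: "infinite ((snd \<circ> \<rho>) ` \<J>)" using inf_J finite_image_iff by blast
  \<comment> \<open>Irreducibility puts \<open>S\<close> into a single component; its infinity
    supplies two different points, which are non-isomorphic bricks because distinct points come from
    distinct classes.\<close>
  obtain S where S: "S \<subseteq> (snd \<circ> \<rho>) ` \<J>" "infinite S" "poly_irreducible (rep_coords Q d) S"
    by (rule infinite_irreducible_subset[OF finite_rep_coords[OF fq] inf_E])
  have S_rep: "S \<subseteq> rep_points Q I d" using S(1) J(1) by auto
  obtain Z where Z: "irreducible_component_of (subtopology (zariski (rep_coords Q d)) (rep_points Q I d)) Z" "S \<subseteq> Z"
    by (rule irreducible_component_exists[OF rep_points_affine S_rep S(3)])
  obtain X where X: "X \<in> S" using S(2) by (metis ex_in_conv finite.emptyI)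
  have "infinite (S - {X})" using S(2) by simp
  then obtain Y where Y: "Y \<in> S" "Y \<noteq> X" by (metis DiffE ex_in_conv finite.emptyI singletonI)
  obtain \<c> where c: "\<c> \<in> \<J>" "X = snd (\<rho> \<c>)" using S(1) X by auto
  obtain \<c>' where c': "\<c>' \<in> \<J>" "Y = snd (\<rho> \<c>')" using S(1) Y(1) by auto
  have bricks: "brick scl (pm d X)" "brick scl (pm d Y)" using J(2) c c' by auto
  have "\<not> module_iso (pm d X) (pm d Y)" using J_niso[OF c(1) c'(1)] c(2) c'(2) Y(2) by auto
  moreover have comp: "irreducible_component Q I d Z"
    using Z(1) brick_space_nonzero[OF bricks(1)] by (simp add: irreducible_component_def rep_variety_def)
  moreover have XZ: "X \<in> Z" "Y \<in> Z" using X Y(1) Z(2) by auto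
  ultimately obtain N where N: "N \<in> Z" "Hom (pm d X) (pm d N) = {0}" "Hom (pm d N) (pm d X) = {0}"
    using orthogonal_partner[OF comp XZ(1) bricks(1) XZ(2) bricks(2)] by blast
  have "has_orthogonal_orbits Q \<phi> d Z"
    unfolding has_orthogonal_orbits_def
    using XZ(1) N irreducible_component_stable[OF comp] by blast
  then show ?thesis using comp by blast
qed

end

theorem propositionB:
  fixes scl :: "'k::alg_closed_field \<Rightarrow> 'a::ring_1 \<Rightarrow> 'a"
    and n :: nat
    and Q :: "'e quiver"
    and I :: "('e path \<Rightarrow> 'k) set"
    and \<phi> :: "('e path \<Rightarrow> 'k) \<Rightarrow> 'a"
  assumes "finite_dimensional_algebra scl"
    and "basic_algebra TYPE('a)"
    and "connected_algebra TYPE('a)"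
    and "algebra_rank scl = n"
    and "num_verts Q = n"
    and "bound_quiver_presentation scl Q I \<phi>"
  shows "(\<forall>d Z. irreducible_component Q I d Z \<and> has_dense_orbit Q I d Z \<longrightarrow>
            (\<forall>X\<in>Z. \<forall>Y\<in>Z. Hom (point_module Q \<phi> d X) (point_module Q \<phi> d Y) \<noteq> {0})) \<and>
         ((\<exists>d Z. irreducible_component Q I d Z \<and> has_orthogonal_orbits Q \<phi> d Z) \<longleftrightarrow>
          (\<exists>m. infinite (iso_classes scl (\<lambda>M. brick scl M \<and> fam.dim (mod_space M) = m)))) \<and>
         (brick_finite scl \<longrightarrow>
            (\<forall>d Z. irreducible_component Q I d Z \<longrightarrow>
              (\<forall>X\<in>Z. \<forall>Y\<in>Z. Hom (point_module Q \<phi> d X) (point_module Q \<phi> d Y) \<noteq> {0})))"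
proof -
  interpret bound_quiver_algebra scl Q I \<phi>
    by (unfold_locales) (rule assms)+
  let ?C = "\<lambda>m. iso_classes scl (\<lambda>M. brick scl M \<and> fam.dim (mod_space M) = m)"
  show ?thesis
  proof (intro conjI allI impI ballI iffI)
    fix d Z X Y assume "irreducible_component Q I d Z \<and> has_dense_orbit Q I d Z" "X \<in> Z" "Y \<in> Z"
    then show "Hom (pm d X) (pm d Y) \<noteq> {0}" by (elim conjE) (rule dense_orbit_Hom_nonzero)
  next
    assume "\<exists>d Z. irreducible_component Q I d Z \<and> has_orthogonal_orbits Q \<phi> d Z"
    then obtain d Z where Z: "irreducible_component Q I d Z" "has_orthogonal_orbits Q \<phi> d Z"
      by (elim exE conjE)
    show "\<exists>m. infinite (?C m)"
    proof (rule ccontr)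
      assume "\<not> ?thesis"
      then have "\<And>m. finite (?C m)" by blast
      from Hom_nonzero_of_finitely_many_bricks[OF this Z(1)] Z(2) show False
        unfolding has_orthogonal_orbits_def by blast
    qed
  next
    assume "\<exists>m. infinite (?C m)"
    then obtain m where "infinite (?C m)" by (rule exE)
    then show "\<exists>d Z. irreducible_component Q I d Z \<and> has_orthogonal_orbits Q \<phi> d Z"
      by (rule orthogonal_orbits_of_infinitely_many_bricks)
  next
    fix d Z X Y assume fin: "brick_finite scl" and Z: "irreducible_component Q I d Z" "X \<in> Z" "Y \<in> Z"
    \<comment> \<open>Finitely many bricks altogether leave finitely many in each dimension, which
      is the hypothesis of the preceding non-vanishing result.\<close>
    have "finite (?C m)" for m
    proof (rule finite_subset)
      show "?C m \<subseteq> iso_classes scl (brick scl)" unfolding iso_classes_def by blast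
      show "finite (iso_classes scl (brick scl))" using fin by (simp add: brick_finite_def)
    qed
    then show "Hom (pm d X) (pm d Y) \<noteq> {0}" using Z by (rule Hom_nonzero_of_finitely_many_bricks)
  qed
qed

end
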